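(* Let $\lambda,n,m,\kappa$ be positive integers, and let $\Sigma$ be an ODE model $$\mathbf{x}'=\frac{\mathbf{f}(\mathbf{x},\boldsymbol{\mu},\mathbf{u})}{Q(\mathbf{x},\boldsymbol{\mu},\mathbf{u})},\qquad \mathbf{y}=\frac{\mathbf{g}(\mathbf{x},\boldsymbol{\mu},\mathbf{u})}{Q(\mathbf{x},\boldsymbol{\mu},\mathbf{u})},\qquad \mathbf{x}(0)=\mathbf{x}^\ast,$$ with parameters $\boldsymbol{\mu}=(\mu_1,\dots,\mu_\lambda)$, state variables $\mathbf{x}=(x_1,\dots,x_n)$, outputs $\mathbf{y}=(y_1,\dots,y_m)$, inputs $\mathbf{u}=(u_1,\dots,u_\kappa)$, where $\mathbf{f}$ and $\mathbf{g}$ are tuples (of lengths $n$ and $m$) of elements of $\mathbb{C}[\boldsymbol{\mu},\mathbf{x},\mathbf{u}]$ and $Q\in\mathbb{C}[\boldsymbol{\mu},\mathbf{x},\mathbf{u}]\setminus\{0\}$. Let $I_\Sigma$ be the differential ideal of $\Sigma$. If $\mathcal{C}$ is a monic characteristic presentation (with respect to some differential ranking) of $I_\Sigma\cap\mathbb{C}(\boldsymbol{\mu})\{\mathbf{y},\mathbf{u}\}$, then the field of IO-identifiable functions of $\Sigma$ is generated over $\mathbb{C}$ by the coefficients of the elements of $\mathcal{C}$.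
   Context: Differential algebra. For a field $K$, $K\{z_1,\dots,z_s\}$ is the polynomial ring $K[z_j^{(i)}\mid i\ge0,\,1\le j\le s]$ with the derivation given by $(z_j^{(i)})'=z_j^{(i+1)}$; here elements of $K=\mathbb{C}(\boldsymbol{\mu})$ are constants. $[F]$ is the smallest differential ideal (ideal closed under derivation) containing $F$, and for an ideal $I$ and ring element $a$, $I:a^\infty=\{r\mid\exists\ell:\ a^\ell r\in I\}$. The differential ideal of $\Sigma$ is $I_\Sigma=[Q\mathbf{x}'-\mathbf{f},\,Q\mathbf{y}-\mathbf{g}]:Q^\infty\subset\mathbb{C}(\boldsymbol{\mu})\{\mathbf{x},\mathbf{y},\mathbf{u}\}$; it is a prime ideal. IO-identifiability. The field of IO-identifiable functions is the smallest field $k$ with $\mathbb{C}\subset k\subset\mathbb{C}(\boldsymbol{\mu})$ such that $I_\Sigma\cap\mathbb{C}(\boldsymbol{\mu})\{\mathbf{y},\mathbf{u}\}$ is generated, as an ideal of $\mathbb{C}(\boldsymbol{\mu})\{\mathbf{y},\mathbf{u}\}$ (equivalently, as a differential ideal), by $I_\Sigma\cap k\{\mathbf{y},\mathbf{u}\}$. Rankings. A differential ranking on $K\{z_1,\dots,z_s\}$ is a total order $>$ on $\{z_j^{(i)}\}$ such that $v'>v$ for all $v$, and $v>w$ implies $v'>w'$. Fix one. For $f\in K\{z_1,\dots,z_s\}\setminus K$: $\operatorname{lead}(f)$ is the greatest $z_j^{(i)}$ appearing in $f$; the initial of $f$ is the leading coefficient of $f$ viewed as a univariate polynomial in $\operatorname{lead}(f)$;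 $\operatorname{rank}(f)=\operatorname{lead}(f)^{\deg_{\operatorname{lead}(f)}f}$. Ranks are compared first by leader and then by degree, and $f<g$ means $\operatorname{rank}(f)<\operatorname{rank}(g)$. Characteristic sets. $f$ is reduced with respect to $g$ if no proper derivative of $\operatorname{lead}(g)$ appears in $f$ and $\deg_{\operatorname{lead}(g)}f<\deg_{\operatorname{lead}(g)}g$. A set $\mathcal{A}\subset K\{z_1,\dots,z_s\}\setminus K$ is autoreduced if each $p\in\mathcal{A}$ is reduced with respect to every element of $\mathcal{A}\setminus\{p\}$ (such sets are finite). For autoreduced sets $\mathcal{A}=\{A_1<\dots<A_r\}$ and $\mathcal{B}=\{B_1<\dots<B_q\}$, $\mathcal{A}<\mathcal{B}$ means: either $r>q$ and $\operatorname{rank}(A_i)=\operatorname{rank}(B_i)$ for $1\le i\le q$, or there is $j$ with $\operatorname{rank}(A_j)<\operatorname{rank}(B_j)$ and $\operatorname{rank}(A_i)=\operatorname{rank}(B_i)$ for $1\le i<j$. A characteristic set of a differential ideal $I$ is an autoreduced subset of $I$ that is minimal for this order. Characteristic presentations. Let $\mathcal{C}$ be a characteristic set of a prime differential ideal $P\subset K\{z_1,\dots,z_s\}$, and let $N(\mathcal{C})$ be the set of non-leading variables of $\mathcal{C}$ (those $z_j^{(i)}$ appearing in $\mathcal{C}$ that are not the leader of any element of $\mathcal{C}$). $\mathcal{C}$ is a characteristic presentation of $P$ if all initials of elements of $\mathcal{C}$ belong to $K[N(\mathcal{C})]$ and no element of $\mathcal{C}$ has a factor in $K[N(\mathcal{C})]\setminus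 K$. A polynomial is monic if at least one of its coefficients is $1$; a set of polynomials is monic if each of its elements is monic. (Coefficients are those in $K$ of the polynomial written as a $K$-linear combination of monomials in the variables $z_j^{(i)}$.) *)

theory Defs
  imports
    Complex_Main
    "HOL-Library.Poly_Mapping"
    "HOL-Computational_Algebra.Polynomial_Factorial"
begin

section \<open>Multivariate polynomials\<close>

text \<open>A polynomial in the variables \<open>'v\<close> is a finitely supported map from monomials
  (finitely supported exponent vectors) to coefficients; the ring structure is the
  convolution product of \<^theory>\<open>HOL-Library.Poly_Mapping\<close>.\<close>

type_synonym ('v, 'a) mpoly = "('v \<Rightarrow>\<^sub>0 nat) \<Rightarrow>\<^sub>0 'a"

definition Const :: "'a \<Rightarrow> ('v, 'a::zero) mpoly" where
  "Const c = Poly_Mapping.single 0 c"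

definition Var :: "'v \<Rightarrow> ('v, 'a::zero_neq_one) mpoly" where
  "Var v = Poly_Mapping.single (Poly_Mapping.single v 1) 1"

definition mcoeffs :: "('v, 'a::zero) mpoly \<Rightarrow> 'a set" where
  "mcoeffs p = Poly_Mapping.lookup p ` Poly_Mapping.keys p"

definition mvars :: "('v, 'a::zero) mpoly \<Rightarrow> 'v set" where
  "mvars p = (\<Union>m\<in>Poly_Mapping.keys p. Poly_Mapping.keys m)"

text \<open>\<open>polys A V\<close> is \<open>A[V]\<close>, as a subset of the ring of all polynomials.\<close>

definition polys :: "'a set \<Rightarrow> 'v set \<Rightarrow> ('v, 'a::zero) mpoly set" where
  "polys A V = {p. mcoeffs p \<subseteq> A \<and> mvars p \<subseteq> V}"

definition degree_in :: "'v \<Rightarrow> ('v, 'a::zero) mpoly \<Rightarrow> nat" where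
  "degree_in v p = Max (insert 0 ((\<lambda>m. Poly_Mapping.lookup m v) ` Poly_Mapping.keys p))"

text \<open>The coefficient of \<open>v ^ d\<close> in \<open>p\<close>, viewed as a univariate polynomial in \<open>v\<close>.\<close>

definition coeff_in :: "'v \<Rightarrow> nat \<Rightarrow> ('v, 'a::comm_monoid_add) mpoly \<Rightarrow> ('v, 'a) mpoly" where
  "coeff_in v d p =
     (\<Sum>m\<in>{m \<in> Poly_Mapping.keys p. Poly_Mapping.lookup m v = d}.
        Poly_Mapping.single (m - Poly_Mapping.single v d) (Poly_Mapping.lookup p m))"


section \<open>Ideals and subfields\<close>

text \<open>Ideals are taken relative to a subring \<open>R\<close> of the ambient ring, since ideals of
  \<open>K{y,u}\<close> are needed inside \<open>K{x,y,u}\<close>.\<close>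

definition ideal_of :: "'a::comm_ring_1 set \<Rightarrow> 'a set \<Rightarrow> bool" where
  "ideal_of R I \<longleftrightarrow> I \<subseteq> R \<and> 0 \<in> I \<and> (\<forall>a\<in>I. \<forall>b\<in>I. a + b \<in> I) \<and> (\<forall>r\<in>R. \<forall>a\<in>I. r * a \<in> I)"

definition generated_ideal :: "'a::comm_ring_1 set \<Rightarrow> 'a set \<Rightarrow> 'a set" where
  "generated_ideal R F = \<Inter>{I. ideal_of R I \<and> F \<subseteq> I}"

definition saturation :: "'a::comm_ring_1 set \<Rightarrow> 'a \<Rightarrow> 'a set" where
  "saturation I a = {r. \<exists>l. a ^ l * r \<in> I}"

definition is_subfield :: "'a::field set \<Rightarrow> bool" where
  "is_subfield k \<longleftrightarrow> 0 \<in> k \<and> 1 \<in> k \<and>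
     (\<forall>a\<in>k. \<forall>b\<in>k. a + b \<in> k \<and> a - b \<in> k \<and> a * b \<in> k \<and> a / b \<in> k)"

definition generated_subfield :: "'a::field set \<Rightarrow> 'a set" where
  "generated_subfield S = \<Inter>{k. is_subfield k \<and> S \<subseteq> k}"


section \<open>Differential polynomials\<close>

text \<open>The pair \<open>(z, i)\<close> is the derivative \<open>z\<^sup>(\<^sup>i\<^sup>)\<close> of the differential indeterminate \<open>z\<close>.
  All coefficients are constants for the derivation.\<close>

type_synonym ('s, 'a) dpoly = "('s \<times> nat, 'a) mpoly"

fun next_der :: "'s \<times> nat \<Rightarrow> 's \<times> nat" where
  "next_der (z, i) = (z, Suc i)"

definition dderiv :: "('s, 'a::comm_ring_1) dpoly \<Rightarrow> ('s, 'a) dpoly" where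
  "dderiv p =
     (\<Sum>m\<in>Poly_Mapping.keys p. \<Sum>v\<in>Poly_Mapping.keys m.
        Poly_Mapping.single
          (m - Poly_Mapping.single v 1 + Poly_Mapping.single (next_der v) 1)
          (of_nat (Poly_Mapping.lookup m v) * Poly_Mapping.lookup p m))"

definition ders :: "'s set \<Rightarrow> ('s \<times> nat) set" where
  "ders Z = Z \<times> UNIV"

text \<open>\<open>dpolys k Z\<close> is \<open>k{Z}\<close>.\<close>

definition dpolys :: "'a set \<Rightarrow> 's set \<Rightarrow> ('s, 'a::zero) dpoly set" where
  "dpolys k Z = polys k (ders Z)"

definition differential_ideal :: "('s, 'a::comm_ring_1) dpoly set \<Rightarrow> bool" where
  "differential_ideal I \<longleftrightarrow> ideal_of UNIV I \<and> (\<forall>p\<in>I. dderiv p \<in> I)"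

definition generated_differential_ideal ::
    "('s, 'a::comm_ring_1) dpoly set \<Rightarrow> ('s, 'a) dpoly set" where
  "generated_differential_ideal F = \<Inter>{I. differential_ideal I \<and> F \<subseteq> I}"


section \<open>Rankings and characteristic sets\<close>

text \<open>A ranking is given as a strict order: \<open>(w, v) \<in> R\<close> means \<open>w < v\<close>. Only its values on the
  derivatives of \<open>Z\<close> matter.\<close>

definition differential_ranking :: "'s set \<Rightarrow> ('s \<times> nat) rel \<Rightarrow> bool" where
  "differential_ranking Z R \<longleftrightarrow>
     strict_linear_order_on (ders Z) R \<and>
     (\<forall>v\<in>ders Z. (v, next_der v) \<in> R) \<and>
     (\<forall>v\<in>ders Z. \<forall>w\<in>ders Z. (w, v) \<in> R \<longrightarrow> (next_der w, next_der v) \<in> R)"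

text \<open>The following are meant for non-constant polynomials.\<close>

definition lead :: "('s \<times> nat) rel \<Rightarrow> ('s, 'a::zero) dpoly \<Rightarrow> 's \<times> nat" where
  "lead R f = (THE v. v \<in> mvars f \<and> (\<forall>w\<in>mvars f. w \<noteq> v \<longrightarrow> (w, v) \<in> R))"

definition initial ::
    "('s \<times> nat) rel \<Rightarrow> ('s, 'a::comm_monoid_add) dpoly \<Rightarrow> ('s, 'a) dpoly" where
  "initial R f = coeff_in (lead R f) (degree_in (lead R f) f) f"

text \<open>The rank \<open>v ^ d\<close> is encoded as the pair \<open>(v, d)\<close>.\<close>

definition rank :: "('s \<times> nat) rel \<Rightarrow> ('s, 'a::zero) dpoly \<Rightarrow> ('s \<times> nat) \<times> nat" where
  "rank R f = (lead R f, degree_in (lead R f) f)"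

definition rank_less ::
    "('s \<times> nat) rel \<Rightarrow> ('s, 'a::zero) dpoly \<Rightarrow> ('s, 'a) dpoly \<Rightarrow> bool" where
  "rank_less R f g \<longleftrightarrow> (rank R f, rank R g) \<in> R <*lex*> less_than"

definition reduced ::
    "('s \<times> nat) rel \<Rightarrow> ('s, 'a::zero) dpoly \<Rightarrow> ('s, 'a) dpoly \<Rightarrow> bool" where
  "reduced R f g \<longleftrightarrow>
     (\<forall>i>0. (next_der ^^ i) (lead R g) \<notin> mvars f) \<and>
     degree_in (lead R g) f < degree_in (lead R g) g"

definition autoreduced :: "('s \<times> nat) rel \<Rightarrow> ('s, 'a::zero) dpoly set \<Rightarrow> bool" where
  "autoreduced R A \<longleftrightarrow> A \<inter> range Const = {} \<and> (\<forall>p\<in>A. \<forall>q\<in>A - {p}. reduced R p q)"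

text \<open>Autoreduced sets are finite and their elements have pairwise distinct ranks, so
  each of them has exactly one enumeration of increasing rank.\<close>

definition autoreduced_less ::
    "('s \<times> nat) rel \<Rightarrow> ('s, 'a::zero) dpoly set \<Rightarrow> ('s, 'a) dpoly set \<Rightarrow> bool" where
  "autoreduced_less R A B \<longleftrightarrow>
     (\<exists>as bs. set as = A \<and> sorted_wrt (rank_less R) as \<and>
              set bs = B \<and> sorted_wrt (rank_less R) bs \<and>
        (length as > length bs \<and> (\<forall>i<length bs. rank R (as ! i) = rank R (bs ! i)) \<or>
         (\<exists>j. j < length as \<and> j < length bs \<and> rank_less R (as ! j) (bs ! j) \<and>
              (\<forall>i<j. rank R (as ! i) = rank R (bs ! i)))))"

definition characteristic_set ::
    "('s \<times> nat) rel \<Rightarrow> ('s, 'a::zero) dpoly set \<Rightarrow> ('s, 'a) dpoly set \<Rightarrow> bool" where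
  "characteristic_set R I C \<longleftrightarrow>
     autoreduced R C \<and> C \<subseteq> I \<and>
     \<not> (\<exists>B. autoreduced R B \<and> B \<subseteq> I \<and> autoreduced_less R B C)"

definition nonleading_vars ::
    "('s \<times> nat) rel \<Rightarrow> ('s, 'a::zero) dpoly set \<Rightarrow> ('s \<times> nat) set" where
  "nonleading_vars R C = (\<Union>p\<in>C. mvars p) - lead R ` C"

text \<open>Divisibility is that of the full ring of differential polynomials; over a field, a
  cofactor of a nonzero divisor involves no variables beyond those of the dividend, so
  nothing changes when one works in \<open>K{Z}\<close> for a subset \<open>Z\<close> of the indeterminates.\<close>

definition characteristic_presentation ::
    "('s \<times> nat) rel \<Rightarrow> ('s, 'a::field) dpoly set \<Rightarrow> ('s, 'a) dpoly set \<Rightarrow> bool" where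
  "characteristic_presentation R P C \<longleftrightarrow>
     characteristic_set R P C \<and>
     (\<forall>p\<in>C. initial R p \<in> polys UNIV (nonleading_vars R C)) \<and>
     (\<forall>p\<in>C. \<forall>q\<in>polys UNIV (nonleading_vars R C) - range Const. \<not> q dvd p)"

definition monic_mpoly :: "('v, 'a::zero_neq_one) mpoly \<Rightarrow> bool" where
  "monic_mpoly p \<longleftrightarrow> 1 \<in> mcoeffs p"

definition monic_set :: "('v, 'a::zero_neq_one) mpoly set \<Rightarrow> bool" where
  "monic_set C \<longleftrightarrow> (\<forall>p\<in>C. monic_mpoly p)"


section \<open>ODE models\<close>

text \<open>The parameters, states, outputs and inputs are indexed by the types \<open>'l\<close>, \<open>'n\<close>, \<open>'m\<close>, \<open>'k\<close>,
  which will be finite. The order on \<open>'l\<close> only serves to make \<open>\<complex>[\<mu>]\<close> an integral domain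
  for the type class system. \<open>'l ratfun\<close> is the field \<open>\<complex>(\<mu>)\<close>.\<close>

type_synonym 'l ratfun = "('l, complex) mpoly fract"

datatype ('n, 'm, 'k) indet = State 'n | Output 'm | Input 'k

type_synonym ('l, 'n, 'm, 'k) ode_dpoly = "(('n, 'm, 'k) indet, 'l ratfun) dpoly"

definition complex_numbers :: "'l::linorder ratfun set" where
  "complex_numbers = range (\<lambda>c. to_fract (Const c))"

text \<open>\<open>\<complex>[\<mu>, x, u]\<close> as a subring of \<open>\<complex>(\<mu>){x, y, u}\<close>.\<close>

definition model_polys :: "('l::linorder, 'n, 'm, 'k) ode_dpoly set" where
  "model_polys = polys (range to_fract) ((range State \<union> range Input) \<times> {0})"

text \<open>The initial condition of a model plays no role in its differential ideal and is left out.\<close>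

definition ode_model ::
    "('n \<Rightarrow> ('l::linorder, 'n, 'm, 'k) ode_dpoly) \<Rightarrow> ('m \<Rightarrow> ('l, 'n, 'm, 'k) ode_dpoly) \<Rightarrow>
     ('l, 'n, 'm, 'k) ode_dpoly \<Rightarrow> bool" where
  "ode_model f g Q \<longleftrightarrow>
     range f \<subseteq> model_polys \<and> range g \<subseteq> model_polys \<and> Q \<in> model_polys \<and> Q \<noteq> 0"

definition model_ideal ::
    "('n \<Rightarrow> ('l::linorder, 'n, 'm, 'k) ode_dpoly) \<Rightarrow> ('m \<Rightarrow> ('l, 'n, 'm, 'k) ode_dpoly) \<Rightarrow>
     ('l, 'n, 'm, 'k) ode_dpoly \<Rightarrow> ('l, 'n, 'm, 'k) ode_dpoly set" where
  "model_ideal f g Q =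
     saturation
       (generated_differential_ideal
          (range (\<lambda>i. Q * Var (State i, 1) - f i) \<union>
           range (\<lambda>j. Q * Var (Output j, 0) - g j)))
       Q"

definition io_indets :: "('n, 'm, 'k) indet set" where
  "io_indets = range Output \<union> range Input"

definition io_ideal ::
    "('n \<Rightarrow> ('l::linorder, 'n, 'm, 'k) ode_dpoly) \<Rightarrow> ('m \<Rightarrow> ('l, 'n, 'm, 'k) ode_dpoly) \<Rightarrow>
     ('l, 'n, 'm, 'k) ode_dpoly \<Rightarrow> ('l, 'n, 'm, 'k) ode_dpoly set" where
  "io_ideal f g Q = model_ideal f g Q \<inter> dpolys UNIV io_indets"

definition defines_io_ideal ::
    "('n \<Rightarrow> ('l::linorder, 'n, 'm, 'k) ode_dpoly) \<Rightarrow> ('m \<Rightarrow> ('l, 'n, 'm, 'k) ode_dpoly) \<Rightarrow>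
     ('l, 'n, 'm, 'k) ode_dpoly \<Rightarrow> 'l ratfun set \<Rightarrow> bool" where
  "defines_io_ideal f g Q k \<longleftrightarrow>
     is_subfield k \<and> complex_numbers \<subseteq> k \<and>
     io_ideal f g Q =
       generated_ideal (dpolys UNIV io_indets) (model_ideal f g Q \<inter> dpolys k io_indets)"

text \<open>\<open>k\<close> is the smallest such field, i.e.\ the least element for inclusion; this determines
  \<open>k\<close> uniquely.\<close>

definition is_io_identifiable_field ::
    "('n \<Rightarrow> ('l::linorder, 'n, 'm, 'k) ode_dpoly) \<Rightarrow> ('m \<Rightarrow> ('l, 'n, 'm, 'k) ode_dpoly) \<Rightarrow>
     ('l, 'n, 'm, 'k) ode_dpoly \<Rightarrow> 'l ratfun set \<Rightarrow> bool" where
  "is_io_identifiable_field f g Q k \<longleftrightarrow>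
     defines_io_ideal f g Q k \<and> (\<forall>k'. defines_io_ideal f g Q k' \<longrightarrow> k \<subseteq> k')"

end

theory Submission
  imports Defs "HOL-Library.Countable_Set"
begin

text \<open>
  Write \<open>I\<close> for the ideal of the model and \<open>P\<close> for its intersection with \<open>K{y,u}\<close>, where
  \<open>K = \<complex>(\<mu>)\<close>. Sending states and inputs to algebraically independent elements of a field with
  a derivation that satisfies the model equations exhibits \<open>I\<close> as the kernel of a ring
  homomorphism, so \<open>I\<close> is prime.

  Let \<open>k\<close> be a subfield of \<open>K\<close> and \<open>\<pi>\<close> a \<open>k\<close>-linear projection of \<open>K\<close> onto \<open>k\<close>, applied to
  polynomials coefficientwise. If \<open>k\<close> contains the coefficients of \<open>C\<close>, then Ritt reduction gives,
  for every \<open>f \<in> P\<close>, a product \<open>h\<close> of initials and separants with \<open>h f\<close> in the ideal of the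
  derivatives of \<open>C\<close>; as \<open>h\<close> and these derivatives have coefficients in \<open>k\<close>, also \<open>h (\<pi> f)\<close> lies
  in that ideal, whence \<open>\<pi> f \<in> P\<close> by primality. Scaling \<open>f\<close> so that one coefficient is \<open>1\<close> and subtracting
  \<open>\<pi> f\<close> removes a monomial, so \<open>P\<close> is generated by polynomials over \<open>k\<close>.

  Conversely, if \<open>P\<close> is generated by polynomials over \<open>k\<close>, then \<open>g = \<pi> c\<close> lies in \<open>P\<close> for
  \<open>c \<in> C\<close>. With \<open>a\<close> the initial of \<open>c\<close> and \<open>b = \<pi> a\<close>, the polynomial \<open>a g - b c\<close> is reduced
  with respect to \<open>C\<close>, hence zero. As \<open>c\<close> has no factor in \<open>K[N]\<close>, which contains \<open>a\<close>, unique
  factorization shows that \<open>g\<close> is a multiple of \<open>c\<close> by a constant, which is \<open>1\<close> because \<open>c\<close> is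
  monic. So \<open>c = \<pi> c\<close> has coefficients in \<open>k\<close>.
\<close>

section \<open>Multivariate polynomials\<close>

abbreviation "lookup \<equiv> Poly_Mapping.lookup"
abbreviation "keys \<equiv> Poly_Mapping.keys"
abbreviation "single \<equiv> Poly_Mapping.single"

lemma poly_mapping_add_induct [case_names zero add]:
  assumes "P 0"
    and "\<And>m a b. a \<notin> keys m \<Longrightarrow> b \<noteq> 0 \<Longrightarrow> P m \<Longrightarrow> P (m + single a b)"
  shows "P (m :: 'a \<Rightarrow>\<^sub>0 'b::monoid_add)"
proof (induction m rule: Poly_Mapping.update_induct)
  case const
  show ?case by (rule assms(1))
next
  case (update f a b)
  have "Poly_Mapping.update a b f = f + single a b"
    using update(1) by (intro poly_mapping_eqI)
      (auto simp: lookup_update lookup_add lookup_single when_def in_keys_iff)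
  then show ?case using assms(2)[OF update(1,2,3)] by simp
qed

section \<open>Additive maps given on monomials\<close>

text \<open>Evaluation, passage to univariate polynomials, coefficient extraction and derivations
  are all of this form, so their additivity is proved once, from the behaviour of \<open>F\<close>
  on single coefficients.\<close>

definition mlin :: "(('v \<Rightarrow>\<^sub>0 nat) \<Rightarrow> 'a::zero \<Rightarrow> 'b::comm_monoid_add) \<Rightarrow> ('v, 'a) mpoly \<Rightarrow> 'b" where
  "mlin F p = (\<Sum>m\<in>keys p. F m (lookup p m))"

lemma mlin_superset:
  assumes "finite M" "keys p \<subseteq> M" "\<And>m. F m 0 = 0"
  shows "mlin F p = (\<Sum>m\<in>M. F m (lookup p m))"
  unfolding mlin_def using assms by (intro sum.mono_neutral_left) (auto simp: in_keys_iff)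

lemma mlin_zero [simp]: "mlin F 0 = 0"
  by (simp add: mlin_def)

lemma mlin_single:
  assumes "\<And>m. F m 0 = 0"
  shows "mlin F (single m c) = F m c"
  using assms by (subst mlin_superset[of "{m}"]) (auto simp: lookup_single)

lemma mlin_add:
  assumes "\<And>m. F m 0 = 0" "\<And>m a b. F m (a + b) = F m a + F m b"
  shows "mlin F (p + q) = mlin F p + mlin F q"
proof -
  let ?M = "keys p \<union> keys q"
  have "mlin F (p + q) = (\<Sum>m\<in>?M. F m (lookup (p + q) m))"
    using keys_add[of p q] assms by (intro mlin_superset) auto
  also have "\<dots> = (\<Sum>m\<in>?M. F m (lookup p m)) + (\<Sum>m\<in>?M. F m (lookup q m))"
    by (simp add: lookup_add assms sum.distrib)
  also have "\<dots> = mlin F p + mlin F q"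
    using assms by (subst (1 2) mlin_superset[of ?M]) auto
  finally show ?thesis .
qed

text \<open>A polynomial is a sum of monomials, so biadditive maps are determined on pairs of
  monomials. Product rules thereby reduce to \<open>mult_single\<close>.\<close>

lemma mpoly_bilinear_eq:
  fixes B B' :: "('v, 'a::monoid_add) mpoly \<Rightarrow> ('v, 'a) mpoly \<Rightarrow> 'b::cancel_comm_monoid_add"
  assumes "\<And>p p' q. B (p + p') q = B p q + B p' q" "\<And>p q q'. B p (q + q') = B p q + B p q'"
    and "\<And>p p' q. B' (p + p') q = B' p q + B' p' q" "\<And>p q q'. B' p (q + q') = B' p q + B' p q'"
    and "\<And>m a n b. B (single m a) (single n b) = B' (single m a) (single n b)"
  shows "B p q = B' p q"
proof -
  have zero: "B 0 q = 0" "B p 0 = 0" "B' 0 q = 0" "B' p 0 = 0" for p q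
    using assms(1)[of 0 0 q] assms(2)[of p 0 0] assms(3)[of 0 0 q] assms(4)[of p 0 0] by auto
  have "B (single m a) q = B' (single m a) q" for m a
    by (induction q rule: poly_mapping_add_induct) (simp_all add: zero assms)
  then show ?thesis
    by (induction p rule: poly_mapping_add_induct) (simp_all add: zero assms)
qed

lemma mlin_mult:
  fixes F :: "('v \<Rightarrow>\<^sub>0 nat) \<Rightarrow> 'a::semiring_0 \<Rightarrow> 'b::comm_ring_1"
  assumes "\<And>m. F m 0 = 0" "\<And>m a b. F m (a + b) = F m a + F m b"
    and "\<And>m n a b. F (m + n) (a * b) = F m a * F n b"
  shows "mlin F (p * q) = mlin F p * mlin F q"
proof -
  note add = mlin_add[of F, OF assms(1,2)] and single = mlin_single[of F, OF assms(1)]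
  show ?thesis
  proof (rule mpoly_bilinear_eq[where B = "\<lambda>p q. mlin F (p * q)" and B' = "\<lambda>p q. mlin F p * mlin F q"])
    show "mlin F ((p + p') * q) = mlin F (p * q) + mlin F (p' * q)" for p p' q
      by (simp only: distrib_right add)
    show "mlin F (p * (q + q')) = mlin F (p * q) + mlin F (p * q')" for p q q'
      by (simp only: distrib_left add)
    show "mlin F (p + p') * mlin F q = mlin F p * mlin F q + mlin F p' * mlin F q" for p p' q
      by (simp only: distrib_right add)
    show "mlin F p * mlin F (q + q') = mlin F p * mlin F q + mlin F p * mlin F q'" for p q q'
      by (simp only: distrib_left add)
    show "mlin F (single m a * single n b) = mlin F (single m a) * mlin F (single n b)" for m a n b
      by (simp only: mult_single single assms(3))
  qed
qed

section \<open>Constants and occurring variables\<close>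

lemma Const_0 [simp]: "Const 0 = 0"
  and Const_add: "Const (a + b) = Const a + (Const b :: ('v, 'a::comm_ring_1) mpoly)"
  and Const_uminus: "Const (- a) = - (Const a :: ('v, 'a::comm_ring_1) mpoly)"
  and Const_mult: "Const (a * b) = Const a * (Const b :: ('v, 'a::comm_ring_1) mpoly)"
  and Const_1 [simp]: "Const 1 = (1 :: ('v, 'a::comm_ring_1) mpoly)"
  by (simp_all add: Const_def single_add single_diff single_uminus mult_single)

lemma Const_eq_iff [simp]: "Const a = Const b \<longleftrightarrow> a = b"
  by (simp add: Const_def inj_eq)

lemma Const_eq_0_iff [simp]: "Const a = 0 \<longleftrightarrow> a = 0"
  using Const_eq_iff[of a 0] by (simp del: Const_eq_iff)

lemma single_Var_power: "single (single v n) 1 = (Var v ^ n :: ('v, 'a::comm_ring_1) mpoly)"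
proof (induction n)
  case (Suc n)
  have "single (single v (Suc n)) (1::'a) = Var v * single (single v n) 1"
    by (simp add: Var_def mult_single flip: single_add)
  then show ?case using Suc by simp
qed simp

lemma mvars_zero [simp]: "mvars 0 = {}"
  and mvars_Const [simp]: "mvars (Const c) = {}"
  and mvars_Var [simp]: "mvars (Var v :: ('v, 'a::zero_neq_one) mpoly) = {v}"
  by (auto simp: mvars_def Const_def Var_def)

lemma finite_mvars [simp]: "finite (mvars p)"
  by (simp add: mvars_def)

lemma mvars_one [simp]: "mvars (1 :: ('v, 'a::comm_ring_1) mpoly) = {}"
  using mvars_Const[of "1::'a"] by simp

lemma mvars_eq_empty_iff: "mvars p = {} \<longleftrightarrow> p \<in> range Const"
proof
  assume *: "mvars p = {}"
  have "m = 0" if "m \<in> keys p" for m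
  proof -
    have "keys m = {}" using * that by (auto simp: mvars_def)
    then show ?thesis by (intro poly_mapping_eqI) (simp flip: not_in_keys_iff_lookup_eq_zero)
  qed
  then have "p = Const (lookup p 0)"
    by (intro poly_mapping_eqI) (metis Const_def lookup_single_eq lookup_single_not_eq not_in_keys_iff_lookup_eq_zero)
  then show "p \<in> range Const" by (rule image_eqI) simp
qed auto

lemma mvars_mono: "keys p \<subseteq> keys q \<Longrightarrow> mvars p \<subseteq> mvars q"
  by (auto simp: mvars_def)

lemma mvars_add: "mvars (p + q) \<subseteq> mvars p \<union> mvars q"
  using keys_add[of p q] by (auto simp: mvars_def)

lemma keys_diff': "keys (p - q) \<subseteq> keys p \<union> keys (q :: 'a \<Rightarrow>\<^sub>0 'b::ab_group_add)"
  by (auto simp: in_keys_iff lookup_minus)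

lemma mvars_diff: "mvars (p - q) \<subseteq> mvars p \<union> mvars (q :: ('v, 'a::ab_group_add) mpoly)"
  using keys_diff'[of p q] by (auto simp: mvars_def)

lemma mvars_mult: "mvars (p * q) \<subseteq> mvars p \<union> mvars q"
proof
  fix v assume "v \<in> mvars (p * q)"
  then obtain m where m: "m \<in> keys (p * q)" "v \<in> keys m" by (auto simp: mvars_def)
  then obtain a b where "m = a + b" "a \<in> keys p" "b \<in> keys q" using keys_mult[of p q] by blast
  then show "v \<in> mvars p \<union> mvars q" using m keys_add[of a b] by (auto simp: mvars_def)
qed

lemma mvars_power: "mvars (p ^ n :: ('v, 'a::comm_ring_1) mpoly) \<subseteq> mvars p"
proof (induction n)
  case (Suc n)
  then show ?case using mvars_mult[of p "p ^ n"] by auto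
qed simp

lemma mvars_sum: "mvars (sum f A) \<subseteq> (\<Union>a\<in>A. mvars (f a))"
proof (induction A rule: infinite_finite_induct)
  case (insert x F)
  then show ?case using mvars_add[of "f x" "sum f F"] by auto
qed simp_all

lemma mvars_single: "mvars (single m c) \<subseteq> keys m"
  by (auto simp: mvars_def)

lemma mpoly_eq_sum: "p = (\<Sum>m\<in>keys p. single m (lookup p m))"
  by (rule poly_mapping_eqI)
    (auto simp: lookup_sum lookup_single when_def in_keys_iff sum.delta)

lemma mpoly_induct_mvars [consumes 1, case_names Const Var add mult]:
  fixes p :: "('v, 'a::comm_ring_1) mpoly"
  assumes "mvars p \<subseteq> V"
    and Const: "\<And>c. P (Const c)" and Var: "\<And>v. v \<in> V \<Longrightarrow> P (Var v)"
    and add: "\<And>p q. P p \<Longrightarrow> P q \<Longrightarrow> P (p + q)" and mult: "\<And>p q. P p \<Longrightarrow> P q \<Longrightarrow> P (p * q)"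
  shows "P p"
proof -
  have pow: "P (Var v ^ n)" if "v \<in> V" for v n
  proof (induction n)
    case 0
    then show ?case using Const[of 1] by simp
  qed (use that in \<open>simp add: Var mult\<close>)
  have mon: "P (single m c)" if "keys m \<subseteq> V" for m and c :: 'a
    using that
  proof (induction m rule: poly_mapping_add_induct)
    case zero
    show ?case using Const[of c] by (simp add: Const_def)
  next
    case (add m v n)
    have "keys (m + single v n) = insert v (keys m)"
      using add(1,2) by (auto simp: in_keys_iff lookup_add lookup_single when_def split: if_splits)
    moreover have "single (m + single v n) c = single m c * Var v ^ n"
      by (simp add: single_Var_power[symmetric] mult_single)
    ultimately show ?case using add pow mult by auto
  qed
  have "P (\<Sum>m\<in>M. single m (lookup p m))" if "finite M" "M \<subseteq> keys p" for M
    using that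
  proof (induction M rule: finite_induct)
    case empty
    then show ?case using Const[of 0] by simp
  next
    case (insert m M)
    have "keys m \<subseteq> V" using insert assms(1) by (auto simp: mvars_def)
    then show ?case using insert by (simp add: add mon)
  qed
  from this[of "keys p"] show ?thesis by (simp flip: mpoly_eq_sum)
qed

lemma mpoly_induct [case_names Const Var add mult]:
  fixes p :: "('v, 'a::comm_ring_1) mpoly"
  assumes "\<And>c. P (Const c)" "\<And>v. P (Var v)"
    and "\<And>p q. P p \<Longrightarrow> P q \<Longrightarrow> P (p + q)" "\<And>p q. P p \<Longrightarrow> P q \<Longrightarrow> P (p * q)"
  shows "P p"
  by (rule mpoly_induct_mvars[of p UNIV]) (auto intro: assms)

section \<open>Evaluation homomorphisms\<close>

definition mpeval :: "('a \<Rightarrow> 'b) \<Rightarrow> ('v \<Rightarrow> 'b) \<Rightarrow> ('v, 'a::comm_ring_1) mpoly \<Rightarrow> 'b::comm_ring_1" where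
  "mpeval h e = mlin (\<lambda>m c. h c * (\<Prod>v\<in>keys m. e v ^ lookup m v))"

definition ringhom :: "('a::comm_ring_1 \<Rightarrow> 'b::comm_ring_1) \<Rightarrow> bool" where
  "ringhom h \<longleftrightarrow> h 1 = 1 \<and> (\<forall>a b. h (a + b) = h a + h b) \<and> (\<forall>a b. h (a * b) = h a * h b)"

lemma ringhomD:
  assumes "ringhom h"
  shows "h 1 = 1" "h (a + b) = h a + h b" "h (a * b) = h a * h b" "h 0 = 0"
    "h (a - b) = h a - h b" "h (a ^ n) = h a ^ n"
proof -
  show *: "h 1 = 1" "h (a + b) = h a + h b" "h (a * b) = h a * h b" for a b
    using assms by (auto simp: ringhom_def)
  show "h 0 = 0" using *(2)[of 0 0] by simp
  show "h (a - b) = h a - h b" using *(2)[of "a - b" b] by (simp add: algebra_simps)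
  show "h (a ^ n) = h a ^ n" by (induction n) (simp_all add: *)
qed

lemma monomial_eval_superset:
  assumes "finite S" "keys m \<subseteq> S"
  shows "(\<Prod>v\<in>keys m. e v ^ lookup m v) = (\<Prod>v\<in>S. (e v ::'b::comm_ring_1) ^ lookup m v)"
  using assms by (intro prod.mono_neutral_left) (auto simp: in_keys_iff)

lemma monomial_eval_add:
  "(\<Prod>v\<in>keys (m + n). e v ^ lookup (m + n) v) =
     (\<Prod>v\<in>keys m. e v ^ lookup m v) * (\<Prod>v\<in>keys n. (e v ::'b::comm_ring_1) ^ lookup n v)"
proof -
  let ?S = "keys m \<union> keys n"
  have "(\<Prod>v\<in>keys (m + n). e v ^ lookup (m + n) v) = (\<Prod>v\<in>?S. e v ^ lookup (m + n) v)"
    using keys_add[of m n] by (intro monomial_eval_superset) auto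
  also have "\<dots> = (\<Prod>v\<in>?S. e v ^ lookup m v) * (\<Prod>v\<in>?S. e v ^ lookup n v)"
    by (simp add: lookup_add power_add prod.distrib)
  finally show ?thesis using monomial_eval_superset[of ?S m e] monomial_eval_superset[of ?S n e] by simp
qed

lemma mpeval_Const [simp]: "ringhom h \<Longrightarrow> mpeval h e (Const c) = h c"
  unfolding mpeval_def Const_def by (subst mlin_single) (auto simp: ringhomD)

lemma mpeval_Var [simp]: "ringhom h \<Longrightarrow> mpeval h e (Var v) = e v"
  unfolding mpeval_def Var_def by (subst mlin_single) (auto simp: ringhomD lookup_single)

lemma ringhom_mpeval:
  assumes "ringhom h"
  shows "ringhom (mpeval h e)"
proof -
  have "mpeval h e 1 = 1" using mpeval_Const[OF assms, of e 1] by (simp add: ringhomD[OF assms])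
  then show ?thesis unfolding ringhom_def mpeval_def
    by (intro conjI allI mlin_add mlin_mult)
      (simp_all add: ringhomD[OF assms] monomial_eval_add algebra_simps)
qed

lemma ringhom_eq_on_mvars:
  assumes "ringhom f" "ringhom g" "\<And>c. f (Const c) = g (Const c)"
    and "\<And>v. v \<in> mvars p \<Longrightarrow> f (Var v) = g (Var v)"
  shows "f p = g (p :: ('v, 'a::comm_ring_1) mpoly)"
proof -
  have "mvars p \<subseteq> mvars p" by simp
  then show ?thesis
    by (induction p rule: mpoly_induct_mvars)
      (simp_all add: assms ringhomD[OF assms(1)] ringhomD[OF assms(2)])
qed

lemma ringhom_id: "ringhom (\<lambda>x. x)"
  and ringhom_comp: "ringhom f \<Longrightarrow> ringhom g \<Longrightarrow> ringhom (\<lambda>x. f (g x))"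
  and ringhom_Const: "ringhom (Const :: 'a::comm_ring_1 \<Rightarrow> ('v, 'a) mpoly)"
  by (simp_all add: ringhom_def Const_add Const_mult)

section \<open>Renaming of variables and absence of zero divisors\<close>

definition rename :: "('v \<Rightarrow> 'w) \<Rightarrow> ('v, 'a::comm_ring_1) mpoly \<Rightarrow> ('w, 'a) mpoly" where
  "rename j = mpeval Const (\<lambda>v. Var (j v))"

lemma ringhom_rename: "ringhom (rename j)"
  unfolding rename_def by (intro ringhom_mpeval ringhom_Const)

lemma rename_Var [simp]: "rename j (Var v) = Var (j v)"
  and rename_Const [simp]: "rename j (Const c) = Const c"
  by (simp_all add: rename_def ringhom_Const)

lemma rename_left_inverse:
  assumes "\<And>v. v \<in> mvars p \<Longrightarrow> r (j v) = v"
  shows "rename r (rename j p) = p"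
proof (rule ringhom_eq_on_mvars[of "\<lambda>p. rename r (rename j p)" "\<lambda>p. p"])
  show "ringhom (\<lambda>p. rename r (rename j p))"
    by (simp add: ringhom_def ringhomD[OF ringhom_rename])
qed (simp_all add: ringhom_id assms)

text \<open>For variables in the linearly ordered type \<open>nat\<close> the polynomials form an
  integral domain. Two polynomials involve finitely many variables, and an injective renaming of
  these into \<open>nat\<close>, undone by a left inverse, carries the property over to any
  \<open>'v\<close>.\<close>

lemma mpoly_mult_eq_0_iff:
  fixes p q :: "('v, 'a::idom) mpoly"
  shows "p * q = 0 \<longleftrightarrow> p = 0 \<or> q = 0"
proof
  assume "p * q = 0"
  obtain j :: "'v \<Rightarrow> nat" where j: "inj_on j (mvars p \<union> mvars q)"
    using finite_imp_inj_to_nat_seg[of "mvars p \<union> mvars q"] by auto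
  define r where "r = inv_into (mvars p \<union> mvars q) j"
  have r: "r (j v) = v" if "v \<in> mvars p \<union> mvars q" for v
    using j that by (simp add: r_def)
  have pq: "rename r (rename j p) = p" "rename r (rename j q) = q"
    using r by (auto intro: rename_left_inverse)
  have "rename j (p * q) = rename j p * rename j q"
    by (rule ringhomD(3)[OF ringhom_rename])
  then have "rename j p * rename j q = 0"
    unfolding \<open>p * q = 0\<close> ringhomD(4)[OF ringhom_rename[of j]] by (rule sym)
  then have "rename j p = 0 \<or> rename j q = 0" unfolding mult_eq_0_iff .
  moreover have "rename r 0 = (0 :: ('v, 'a) mpoly)" by (rule ringhomD(4)[OF ringhom_rename])
  ultimately show "p = 0 \<or> q = 0" using pq by metis
next
  show "p = 0 \<or> q = 0 \<Longrightarrow> p * q = 0" by (elim disjE) simp_all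
qed

lemma mpoly_mult_left_cancel:
  fixes p q r :: "('v, 'a::idom) mpoly"
  assumes "p \<noteq> 0"
  shows "p * q = p * r \<longleftrightarrow> q = r"
proof -
  have "p * (q - r) = 0 \<longleftrightarrow> q - r = 0" using assms mpoly_mult_eq_0_iff by blast
  then show ?thesis by (simp only: right_diff_distrib right_minus_eq)
qed

section \<open>Polynomials as univariate polynomials in one variable\<close>

definition drop_var :: "'v \<Rightarrow> ('v \<Rightarrow>\<^sub>0 nat) \<Rightarrow> 'v \<Rightarrow>\<^sub>0 nat" where
  "drop_var v m = m - single v (lookup m v)"

lemma lookup_drop_var: "lookup (drop_var v m) w = (if w = v then 0 else lookup m w)"
  by (simp add: drop_var_def lookup_minus lookup_single when_def)

lemma drop_var_add: "drop_var v (m + n) = drop_var v m + drop_var v n"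
  by (rule poly_mapping_eqI) (simp add: lookup_drop_var lookup_add)

lemma drop_var_plus: "drop_var v m + single v (lookup m v) = m"
  by (rule poly_mapping_eqI) (simp add: lookup_drop_var lookup_add lookup_single when_def)

text \<open>The coefficients stay in the ring of all variables, with \<open>v\<close> absent from
  them. Evaluation at \<open>Var v\<close> therefore inverts this map, and degrees and coefficients
  in \<open>v\<close> become those of a univariate polynomial.\<close>

definition to_poly :: "'v \<Rightarrow> ('v, 'a::comm_ring_1) mpoly \<Rightarrow> ('v, 'a) mpoly poly" where
  "to_poly v = mlin (\<lambda>m c. monom (single (drop_var v m) c) (lookup m v))"

lemma to_poly_add [simp]: "to_poly v (p + q) = to_poly v p + to_poly v q"
  unfolding to_poly_def by (rule mlin_add) (simp_all add: single_add add_monom)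

lemma to_poly_mult [simp]: "to_poly v (p * q) = to_poly v p * to_poly v q"
  unfolding to_poly_def
  by (rule mlin_mult) (simp_all add: single_add add_monom mult_monom drop_var_add mult_single lookup_add)

lemma to_poly_single: "to_poly v (single m c) = monom (single (drop_var v m) c) (lookup m v)"
  unfolding to_poly_def by (rule mlin_single) simp

lemma drop_var_zero [simp]: "drop_var v 0 = 0"
  by (simp add: drop_var_def)

lemma ringhom_to_poly: "ringhom (to_poly v)"
proof -
  have "to_poly v 1 = 1" using to_poly_single[of v 0 1] by (simp add: monom_0 one_pCons)
  then show ?thesis by (simp add: ringhom_def)
qed

lemmas to_poly_simps [simp] = ringhomD(1,4,5,6)[OF ringhom_to_poly]

lemma to_poly_Const [simp]: "to_poly v (Const c) = [:Const c:]"
  by (simp add: Const_def to_poly_single monom_0)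

lemma to_poly_Var: "to_poly v (Var w) = (if w = v then [:0, 1:] else [:Var w:])"
proof -
  have "drop_var v (single w 1) = (if w = v then 0 else single w 1)"
    by (rule poly_mapping_eqI) (auto simp: lookup_drop_var lookup_single when_def)
  then show ?thesis by (simp add: Var_def to_poly_single lookup_single monom_0 monom_Suc)
qed

lemma poly_to_poly [simp]: "poly (to_poly v p) (Var v) = p"
proof (rule ringhom_eq_on_mvars[of "\<lambda>p. poly (to_poly v p) (Var v)" "\<lambda>p. p"])
  show "ringhom (\<lambda>p. poly (to_poly v p) (Var v))" by (simp add: ringhom_def)
qed (simp_all add: ringhom_id to_poly_Var)

lemma to_poly_eq_iff [simp]: "to_poly v p = to_poly v q \<longleftrightarrow> p = q"
  by (metis poly_to_poly)

lemma to_poly_eq_0_iff [simp]: "to_poly v p = 0 \<longleftrightarrow> p = 0"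
  using to_poly_eq_iff[of v p 0] by (simp del: to_poly_eq_iff)

lemma to_poly_notin: "v \<notin> mvars p \<Longrightarrow> to_poly v p = [:p:]"
proof (rule ringhom_eq_on_mvars[of "to_poly v" "\<lambda>p. [:p:]"])
  show "ringhom (\<lambda>p. [:p:])" by (simp add: ringhom_def one_pCons)
qed (auto simp: ringhom_to_poly to_poly_Var)

lemma coeff_in_eq_mlin:
  "coeff_in v d = mlin (\<lambda>m c. if lookup m v = d then single (m - single v d) c else 0)"
  by (rule ext) (simp add: coeff_in_def mlin_def sum.If_cases Int_def conj_commute)

lemma coeff_to_poly: "coeff (to_poly v p) d = coeff_in v d p"
proof -
  have [simp]: "coeff_in v d (p + q) = coeff_in v d p + coeff_in v d q" for p q :: "('a, 'b) mpoly"
    unfolding coeff_in_eq_mlin by (rule mlin_add) (auto simp: single_add)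
  have [simp]: "coeff_in v d 0 = (0 :: ('a, 'b) mpoly)"
    by (simp add: coeff_in_eq_mlin)
  have "coeff_in v d (single m c) = coeff (to_poly v (single m c)) d" for m :: "'a \<Rightarrow>\<^sub>0 nat" and c :: 'b
    unfolding coeff_in_eq_mlin by (subst mlin_single) (auto simp: to_poly_single drop_var_def)
  then show ?thesis
    by (induction p rule: poly_mapping_add_induct) simp_all
qed

lemma lookup_coeff_in:
  "lookup (coeff_in v d p) n = (if lookup n v = 0 then lookup p (n + single v d) else (0 :: 'a::comm_ring_1))"
proof (induction p rule: poly_mapping_add_induct)
  case (add p m c)
  have "(n = m - single v d \<and> lookup m v = d) \<longleftrightarrow> lookup n v = 0 \<and> n + single v d = m"
  proof safe
    assume "lookup n v = 0" "m = n + single v d"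
  qed (auto simp: lookup_minus lookup_add lookup_single intro!: poly_mapping_eqI split: if_splits simp: when_def)
  then have "lookup (coeff_in v d (single m c)) n =
      (if lookup n v = 0 then lookup (single m c) (n + single v d) else 0)"
    unfolding coeff_in_eq_mlin
    by (subst mlin_single) (auto simp: lookup_single when_def)
  moreover have "coeff_in v d (p + single m c) = coeff_in v d p + coeff_in v d (single m c)"
    by (simp flip: coeff_to_poly)
  ultimately show ?case using add by (simp add: lookup_add)
qed (simp flip: coeff_to_poly)

lemma degree_in_le_iff: "degree_in v p \<le> n \<longleftrightarrow> (\<forall>m\<in>keys p. lookup m v \<le> n)"
  by (simp add: degree_in_def)

lemma degree_in_eq: "degree_in v p = degree (to_poly v p)"
proof (rule antisym)
  show "degree (to_poly v p) \<le> degree_in v p"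
  proof (rule degree_le, safe)
    fix i assume "degree_in v p < i"
    then have i: "lookup p m = 0" if "lookup m v = i" for m
      using that degree_in_le_iff[of v p "degree_in v p"] by (force simp: in_keys_iff)
    show "coeff (to_poly v p) i = 0"
      by (rule poly_mapping_eqI) (auto simp: coeff_to_poly lookup_coeff_in lookup_add i)
  qed
  show "degree_in v p \<le> degree (to_poly v p)"
    unfolding degree_in_le_iff
  proof
    fix m assume m: "m \<in> keys p"
    \<comment> \<open>Each monomial of \<open>p\<close> survives in the coefficient given by its own
      exponent of \<open>v\<close>.\<close>
    have "lookup (coeff (to_poly v p) (lookup m v)) (drop_var v m) = lookup p m"
      by (simp add: coeff_to_poly lookup_coeff_in lookup_drop_var drop_var_plus)
    then have "coeff (to_poly v p) (lookup m v) \<noteq> 0" using m by (auto simp: in_keys_iff)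
    then show "lookup m v \<le> degree (to_poly v p)" by (rule le_degree)
  qed
qed

lemma degree_in_0_iff: "degree_in v p = 0 \<longleftrightarrow> v \<notin> mvars p"
  using degree_in_le_iff[of v p 0] by (auto simp: mvars_def in_keys_iff)

lemma degree_in_mono: "keys p \<subseteq> keys q \<Longrightarrow> degree_in v p \<le> degree_in v q"
  using degree_in_le_iff[of v q "degree_in v q"] by (auto simp: degree_in_le_iff)

lemma degree_in_mult:
  fixes p q :: "('v, 'a::idom) mpoly"
  assumes "p \<noteq> 0" "q \<noteq> 0"
  shows "degree_in v (p * q) = degree_in v p + degree_in v q"
proof (rule antisym)
  show "degree_in v (p * q) \<le> degree_in v p + degree_in v q"
    by (simp add: degree_in_eq degree_mult_le)
  have "coeff (to_poly v p * to_poly v q) (degree (to_poly v p) + degree (to_poly v q)) \<noteq> 0"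
    using assms by (simp add: coeff_mult_degree_sum mpoly_mult_eq_0_iff)
  then show "degree_in v p + degree_in v q \<le> degree_in v (p * q)"
    unfolding degree_in_eq to_poly_mult by (rule le_degree)
qed

lemma degree_in_mult_le: "degree_in v (p * q) \<le> degree_in v p + degree_in v q"
  for p q :: "('v, 'a::comm_ring_1) mpoly"
  by (simp add: degree_in_eq degree_mult_le)

lemma degree_in_diff_le: "degree_in v p \<le> n \<Longrightarrow> degree_in v q \<le> n \<Longrightarrow> degree_in v (p - q) \<le> n"
  for p q :: "('v, 'a::comm_ring_1) mpoly"
  by (simp add: degree_in_eq degree_diff_le)

lemma mvars_mult_idom:
  fixes p q :: "('v, 'a::idom) mpoly"
  assumes "p \<noteq> 0" "q \<noteq> 0"
  shows "mvars (p * q) = mvars p \<union> mvars q"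
proof -
  have "v \<in> mvars (p * q) \<longleftrightarrow> v \<in> mvars p \<or> v \<in> mvars q" for v
    using degree_in_mult[OF assms, of v] degree_in_0_iff[of v] by (metis add_is_0)
  then show ?thesis by auto
qed

lemma mvars_coeff_in: "mvars (coeff_in v d p) \<subseteq> mvars p - {v}" for p :: "('v, 'a::comm_ring_1) mpoly"
proof
  fix w assume "w \<in> mvars (coeff_in v d p)"
  then obtain n where n: "n \<in> keys (coeff_in v d p)" "w \<in> keys n" by (auto simp: mvars_def)
  then have "lookup n v = 0" "n + single v d \<in> keys p"
    by (auto simp: in_keys_iff lookup_coeff_in split: if_splits)
  moreover have "w \<in> keys (n + single v d)" using n by (auto simp: in_keys_iff lookup_add)
  ultimately show "w \<in> mvars p - {v}" using n by (auto simp: mvars_def in_keys_iff)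
qed

lemma degree_in_coeff_in: "degree_in w (coeff_in v d p) \<le> degree_in w p"
  for p :: "('v, 'a::comm_ring_1) mpoly"
  unfolding degree_in_le_iff
proof
  fix n assume n: "n \<in> keys (coeff_in v d p)"
  then have "n + single v d \<in> keys p"
    by (auto simp: in_keys_iff lookup_coeff_in split: if_splits)
  then have "lookup (n + single v d) w \<le> degree_in w p"
    using degree_in_le_iff[of w p "degree_in w p"] by blast
  then show "lookup n w \<le> degree_in w p" by (simp add: lookup_add)
qed

lemma coeff_in_degree_neq_0: "p \<noteq> 0 \<Longrightarrow> coeff_in v (degree_in v p) p \<noteq> 0"
  for p :: "('v, 'a::comm_ring_1) mpoly"
  by (simp add: degree_in_eq flip: coeff_to_poly)

text \<open>A polynomial free of \<open>v\<close> is a constant of the univariate ring and acts on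
  each coefficient separately. Conversely, \<open>q\<close> is the sum of its coefficients times
  powers of \<open>v\<close>.\<close>

lemma dvd_iff_coeff_in:
  fixes p :: "('v, 'a::comm_ring_1) mpoly"
  assumes "v \<notin> mvars p"
  shows "p dvd q \<longleftrightarrow> (\<forall>d. p dvd coeff_in v d q)"
proof
  assume "p dvd q"
  then obtain r where "q = p * r" by (auto simp: dvd_def)
  then show "\<forall>d. p dvd coeff_in v d q"
    by (auto simp: to_poly_notin[OF assms] simp flip: coeff_to_poly)
next
  assume *: "\<forall>d. p dvd coeff_in v d q"
  have "q = (\<Sum>i\<le>degree (to_poly v q). coeff_in v i q * Var v ^ i)"
    using poly_to_poly[of v q] by (simp add: poly_altdef coeff_to_poly)
  then show "p dvd q" using * by (metis (no_types, lifting) dvd_sum dvd_mult2)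
qed

text \<open>The two terms of \<open>r\<close> have the same coefficient at \<open>v ^ n\<close>, so
  it cancels. A degree cannot drop below 0: for \<open>n = 0\<close> the conclusion is instead that
  \<open>v\<close> is absent, and even that \<open>r\<close> vanishes.\<close>

lemma coeff_in_pseudo_step:
  fixes f g :: "('v, 'a::comm_ring_1) mpoly"
  assumes "degree_in v f = n" "degree_in v g = e" "e \<le> n"
  defines "r \<equiv> coeff_in v e g * f - coeff_in v n f * Var v ^ (n - e) * g"
  shows "degree_in v r < n \<or> v \<notin> mvars r" and "n = 0 \<Longrightarrow> r = 0"
proof -
  have *: "v \<notin> mvars (coeff_in v d p)" for d and p :: "('v, 'a) mpoly"
    using mvars_coeff_in[of v d p] by auto
  have r: "to_poly v r = smult (coeff_in v e g) (to_poly v f) - smult (coeff_in v n f) ([:0, 1:] ^ (n - e) * to_poly v g)"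
    by (simp add: r_def to_poly_notin[OF *] to_poly_Var)
  have pw: "[:0, 1:] ^ k * q = monom 1 k * q" for k and q :: "('v, 'a) mpoly poly"
    by (simp add: monom_altdef)
  have le: "degree (to_poly v r) \<le> n"
    unfolding r pw using assms(1-3)
    by (intro degree_diff_le order.trans[OF degree_smult_le] order.trans[OF degree_mult_le])
       (auto simp: degree_in_eq intro!: order.trans[OF add_mono[OF degree_monom_le order.refl]])
  have 0: "coeff (to_poly v r) n = 0"
    unfolding r pw using assms(3) by (simp add: coeff_monom_mult coeff_to_poly)
  show "degree_in v r < n \<or> v \<notin> mvars r"
  proof (cases "n = 0")
    case False
    then show ?thesis using le 0 eq_zero_or_degree_less[of "to_poly v r" n] by (auto simp: degree_in_eq)
  qed (use le in \<open>auto simp: degree_in_eq simp flip: degree_in_0_iff\<close>)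
  show "r = 0" if "n = 0"
  proof -
    have "to_poly v r = 0" using le 0 that by (auto elim: degree_eq_zeroE)
    then show ?thesis by simp
  qed
qed


section \<open>Irreducible polynomials are prime\<close>

lemma mpoly_unit_iff: "p dvd 1 \<longleftrightarrow> p \<noteq> 0 \<and> mvars p = {}" for p :: "('v, 'a::field) mpoly"
proof
  assume "p dvd 1"
  then obtain q where q: "1 = p * q" by (auto simp: dvd_def)
  then have "p \<noteq> 0" "q \<noteq> 0" by auto
  then show "p \<noteq> 0 \<and> mvars p = {}" using mvars_mult_idom[of p q] q[symmetric] by auto
next
  assume "p \<noteq> 0 \<and> mvars p = {}"
  then obtain c where "p = Const c" "c \<noteq> 0" by (auto simp: mvars_eq_empty_iff)
  then have "1 = p * Const (1 / c)" by (simp flip: Const_mult)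
  then show "p dvd 1" by (rule dvdI)
qed

text \<open>Only the divisibility property of primes is recorded; \<open>p\<close> may be zero or a
  unit. Bounding the variables of the factors by \<open>V\<close> permits adjoining variables one at
  a time.\<close>

definition prime_in :: "'v set \<Rightarrow> ('v, 'a::comm_ring_1) mpoly \<Rightarrow> bool" where
  "prime_in V p \<longleftrightarrow>
     (\<forall>g h. mvars g \<subseteq> V \<longrightarrow> mvars h \<subseteq> V \<longrightarrow> p dvd g * h \<longrightarrow> p dvd g \<or> p dvd h)"

text \<open>Gauss's argument: take the first coefficients in \<open>x\<close> of \<open>g\<close>
  and \<open>h\<close> that \<open>p\<close> fails to divide, at positions \<open>i\<close> and
  \<open>j\<close>. In the coefficient of \<open>x ^ (i + j)\<close> of the product, every other
  summand is divisible by \<open>p\<close>.\<close>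

lemma prime_in_insert:
  assumes V: "mvars p \<subseteq> V" "x \<notin> V" and pr: "prime_in V p"
  shows "prime_in (insert x V) p"
  unfolding prime_in_def
proof (intro allI impI, rule ccontr)
  fix g h assume gh: "mvars g \<subseteq> insert x V" "mvars h \<subseteq> insert x V" "p dvd g * h"
    and "\<not> (p dvd g \<or> p dvd h)"
  have x: "x \<notin> mvars p" using V by auto
  have "\<exists>i. \<not> p dvd coeff_in x i g" "\<exists>i. \<not> p dvd coeff_in x i h"
    using \<open>\<not> (p dvd g \<or> p dvd h)\<close> dvd_iff_coeff_in[OF x] by blast+
  then obtain i j where i: "\<not> p dvd coeff_in x i g" "\<And>k. k < i \<Longrightarrow> p dvd coeff_in x k g"
    and j: "\<not> p dvd coeff_in x j h" "\<And>k. k < j \<Longrightarrow> p dvd coeff_in x k h"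
    using exists_least_iff[of "\<lambda>i. \<not> p dvd coeff_in x i g"]
      exists_least_iff[of "\<lambda>i. \<not> p dvd coeff_in x i h"] by metis
  let ?t = "\<lambda>k. coeff_in x k g * coeff_in x (i + j - k) h"
  have "p dvd coeff_in x (i + j) (g * h)" using gh(3) dvd_iff_coeff_in[OF x] by blast
  also have "coeff_in x (i + j) (g * h) = (\<Sum>k\<le>i + j. ?t k)"
    by (simp add: coeff_mult flip: coeff_to_poly)
  also have "\<dots> = ?t i + (\<Sum>k\<in>{..i + j} - {i}. ?t k)"
    by (intro sum.remove) auto
  finally have *: "p dvd ?t i + (\<Sum>k\<in>{..i + j} - {i}. ?t k)" .
  have "p dvd (\<Sum>k\<in>{..i + j} - {i}. ?t k)"
  proof (rule dvd_sum)
    fix k assume "k \<in> {..i + j} - {i}"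
    then have "k < i \<or> i + j - k < j" by auto
    then show "p dvd ?t k" using i(2) j(2) by (auto intro: dvd_mult dvd_mult2)
  qed
  then have "p dvd ?t i" using * dvd_add_left_iff by blast
  moreover have "mvars (coeff_in x i g) \<subseteq> V" "mvars (coeff_in x j h) \<subseteq> V"
    using mvars_coeff_in[of x i g] mvars_coeff_in[of x j h] gh by auto
  ultimately show False using pr i(1) j(1) by (auto simp: prime_in_def)
qed

text \<open>Any two factors involve finitely many variables, which are adjoined to \<open>V\<close>
  one by one.\<close>

lemma prime_in_UNIV:
  assumes "mvars p \<subseteq> V" "prime_in V p"
  shows "prime_in UNIV p"
proof -
  have *: "prime_in (V \<union> W) p" if "finite W" for W
    using that
  proof (induction W rule: finite_induct)
    case (insert x W)
    then show ?case using assms prime_in_insert[of p "V \<union> W" x] by (cases "x \<in> V") (auto simp: insert_absorb)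
  qed (use assms in simp)
  have "prime_in (V \<union> (mvars g \<union> mvars h)) p" for g h by (rule *) simp
  then show ?thesis unfolding prime_in_def by (meson sup_ge1 sup_ge2 order.trans)
qed

text \<open>Degrees add in products and a nonunit has positive degree in some variable, so splitting
  off a nonunit lowers the sum of the degrees over all variables.\<close>

lemma irreducible_factor_exists:
  fixes c :: "('v, 'a::field) mpoly"
  assumes "c \<noteq> 0" "\<not> c dvd 1"
  shows "\<exists>p. irreducible p \<and> p dvd c"
proof -
  define V where "V = mvars c"
  have "finite V" "mvars c \<subseteq> V" by (auto simp: V_def)
  then show ?thesis using assms
  proof (induction "\<Sum>v\<in>V. degree_in v c" arbitrary: c rule: less_induct)
    case less
    show ?case
    proof (cases "irreducible c")
      case False
      then obtain a b where ab: "c = a * b" "\<not> a dvd 1" "\<not> b dvd 1"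
        using less.prems by (auto simp: irreducible_def)
      then have nz: "a \<noteq> 0" "b \<noteq> 0" using less.prems by auto
      then have "mvars a \<subseteq> V" "mvars b \<subseteq> V" "mvars b \<noteq> {}"
        using less.prems ab mvars_mult_idom[of a b] by (auto simp: mpoly_unit_iff)
      then obtain v where "v \<in> V" "degree_in v b \<noteq> 0" using degree_in_0_iff[of _ b] by blast
      then have "(\<Sum>v\<in>V. degree_in v b) > 0"
        using \<open>finite V\<close> by (metis sum_eq_0_iff gr0I)
      then have "(\<Sum>v\<in>V. degree_in v a) < (\<Sum>v\<in>V. degree_in v c)"
        using nz by (simp add: ab degree_in_mult sum.distrib)
      then show ?thesis
        using less.hyps[of a] \<open>finite V\<close> \<open>mvars a \<subseteq> V\<close> nz ab by (auto intro: dvd_mult2)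
    qed auto
  qed
qed

text \<open>The argument of type \<open>itself\<close> names the coefficient field, which no other
  argument determines.\<close>

definition irreducibles_prime :: "'v set \<Rightarrow> 'a::field itself \<Rightarrow> bool" where
  "irreducibles_prime V T \<longleftrightarrow>
     (\<forall>p::('v, 'a) mpoly. mvars p \<subseteq> V \<longrightarrow> irreducible p \<longrightarrow> prime_in UNIV p)"

text \<open>The irreducible factors of \<open>c\<close> are prime, so each of them divides
  \<open>q\<close> or \<open>d\<close>. They are cancelled one at a time and collected in
  \<open>c1\<close> or \<open>c2\<close>.\<close>

lemma split_factor:
  fixes c f q d :: "('v, 'a::field) mpoly"
  assumes ufd: "irreducibles_prime V TYPE('a)" "finite V"
    and "mvars c \<subseteq> V" "c \<noteq> 0" "c * f = q * d"
  obtains c1 c2 q' d' where "mvars c1 \<subseteq> V" "mvars c2 \<subseteq> V" "c1 \<noteq> 0" "c2 \<noteq> 0"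
    "q = c1 * q'" "d = c2 * d'" "f = q' * d'"
proof -
  have "\<exists>c1 c2 q' d'. mvars c1 \<subseteq> V \<and> mvars c2 \<subseteq> V \<and> c1 \<noteq> 0 \<and> c2 \<noteq> 0 \<and>
      q = c1 * q' \<and> d = c2 * d' \<and> f = q' * d'"
    using assms(3-5)
  proof (induction "\<Sum>v\<in>V. degree_in v c" arbitrary: c q d rule: less_induct)
    case less
    show ?case
    proof (cases "c dvd 1")
      case True
      then obtain s where s: "1 = c * s" by (auto simp: dvd_def)
      have "q = c * (s * q)" using s by (simp flip: mult.assoc)
      moreover have "f = s * (c * f)" using s by (simp add: mult.commute[of s] flip: mult.assoc)
      then have "f = (s * q) * d" unfolding less.prems(3) by (simp add: mult.assoc)
      ultimately show ?thesis using less.prems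
        by (intro exI[of _ c] exI[of _ 1] exI[of _ "s * q"] exI[of _ d]) auto
    next
      case False
      then obtain p where p: "irreducible p" "p dvd c"
        using irreducible_factor_exists less.prems by blast
      then obtain c' where c': "c = p * c'" by (auto simp: dvd_def)
      then have nz: "p \<noteq> 0" "c' \<noteq> 0" using less.prems by auto
      have vars: "mvars p \<subseteq> V" "mvars c' \<subseteq> V"
        using mvars_mult_idom[OF nz] less.prems c' by auto
      have "mvars p \<noteq> {}" using p nz by (auto simp: irreducible_def mpoly_unit_iff)
      then obtain v where "v \<in> V" "degree_in v p \<noteq> 0"
        using vars degree_in_0_iff[of _ p] by blast
      then have "(\<Sum>v\<in>V. degree_in v p) > 0"
        using \<open>finite V\<close> by (metis sum_eq_0_iff gr0I)
      then have small: "(\<Sum>v\<in>V. degree_in v c') < (\<Sum>v\<in>V. degree_in v c)"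
        using nz by (simp add: c' degree_in_mult sum.distrib)
      have "q * d = p * (c' * f)" using less.prems(3) c' by (simp add: mult.assoc)
      then have "p dvd q * d" by (rule dvdI)
      moreover have "prime_in UNIV p" using ufd p vars by (auto simp: irreducibles_prime_def)
      ultimately consider "p dvd q" | "p dvd d" by (auto simp: prime_in_def)
      then show ?thesis
      proof cases
        case 1
        then obtain q0 where q0: "q = p * q0" by (auto simp: dvd_def)
        then have "p * (c' * f) = p * (q0 * d)" using \<open>q * d = p * (c' * f)\<close> by (simp add: mult.assoc)
        then have "c' * f = q0 * d" using mpoly_mult_left_cancel[OF nz(1)] by blast
        then obtain c1 c2 q' d' where *: "mvars c1 \<subseteq> V" "mvars c2 \<subseteq> V" "c1 \<noteq> 0" "c2 \<noteq> 0"
            "q0 = c1 * q'" "d = c2 * d'" "f = q' * d'"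
          using less.hyps[OF small vars(2) nz(2)] by blast
        moreover have "mvars (p * c1) \<subseteq> V" using mvars_mult[of p c1] vars * by auto
        ultimately show ?thesis using nz q0
          by (intro exI[of _ "p * c1"] exI[of _ c2] exI[of _ q'] exI[of _ d'])
            (auto simp: mpoly_mult_eq_0_iff mult.assoc)
      next
        case 2
        then obtain d0 where d0: "d = p * d0" by (auto simp: dvd_def)
        then have "p * (c' * f) = p * (q * d0)" using \<open>q * d = p * (c' * f)\<close> by (simp add: ac_simps)
        then have "c' * f = q * d0" using mpoly_mult_left_cancel[OF nz(1)] by blast
        then obtain c1 c2 q' d' where *: "mvars c1 \<subseteq> V" "mvars c2 \<subseteq> V" "c1 \<noteq> 0" "c2 \<noteq> 0"
            "q = c1 * q'" "d0 = c2 * d'" "f = q' * d'"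
          using less.hyps[OF small vars(2) nz(2)] by blast
        moreover have "mvars (p * c2) \<subseteq> V" using mvars_mult[of p c2] vars * by auto
        ultimately show ?thesis using nz d0
          by (intro exI[of _ c1] exI[of _ "p * c2"] exI[of _ q'] exI[of _ d'])
            (auto simp: mpoly_mult_eq_0_iff mult.assoc)
      qed
    qed
  qed
  then show ?thesis using that by blast
qed

text \<open>Gauss's lemma: when the factors of \<open>c\<close> are distributed over
  \<open>w\<close> and \<open>f\<close>, the share \<open>c2\<close> of \<open>f\<close> is a unit
  because \<open>f\<close> has no other factors in \<open>V\<close>. Divisibility over the fraction
  field of the polynomials in \<open>V\<close> thus implies divisibility of polynomials.\<close>

lemma primitive_dvd_cancel:
  fixes c f g w :: "('v, 'a::field) mpoly"
  assumes ufd: "irreducibles_prime V TYPE('a)" "finite V"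
    and "mvars c \<subseteq> V" "c \<noteq> 0" "c * g = w * f"
    and prim: "\<And>q. mvars q \<subseteq> V \<Longrightarrow> q dvd f \<Longrightarrow> q dvd 1"
  shows "f dvd g"
proof -
  obtain c1 c2 w' f' where *: "mvars c2 \<subseteq> V" "f = c2 * f'" "g = w' * f'"
    using split_factor[OF assms(1-5)] by metis
  then have "c2 dvd 1" by (intro prim) auto
  then obtain s where s: "1 = c2 * s" by (auto simp: dvd_def)
  have "f * (s * w') = (c2 * s) * (w' * f')" by (simp only: *(2) ac_simps)
  also have "\<dots> = g" by (simp add: *(3) flip: s)
  finally show ?thesis by (metis dvd_triv_left)
qed

text \<open>Division with remainder in \<open>x\<close> over the fraction field of the polynomials
  in \<open>V\<close>; the factor \<open>c\<close> clears the denominators. It is a product of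
  copies of the leading coefficient of \<open>d\<close>.\<close>

lemma pseudo_division:
  fixes f d :: "('v, 'a::idom) mpoly"
  assumes "mvars f \<subseteq> insert x V" "mvars d \<subseteq> insert x V" "d \<noteq> 0"
  shows "\<exists>c q r. mvars c \<subseteq> V \<and> c \<noteq> 0 \<and> mvars q \<subseteq> insert x V \<and> mvars r \<subseteq> insert x V \<and>
           c * f = q * d + r \<and> (r = 0 \<or> degree_in x r < degree_in x d)"
  using assms(1)
proof (induction "degree_in x f" arbitrary: f rule: less_induct)
  case less
  let ?n = "degree_in x f" and ?e = "degree_in x d"
  show ?case
  proof (cases "?n < ?e")
    case True
    then show ?thesis using less.prems
      by (intro exI[of _ 1] exI[of _ 0] exI[of _ f]) auto
  next
    case False
    define l where "l = coeff_in x ?e d"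
    define t where "t = coeff_in x ?n f * Var x ^ (?n - ?e)"
    define r1 where "r1 = l * f - t * d"
    have l: "mvars l \<subseteq> V" "l \<noteq> 0"
      using mvars_coeff_in[of x ?e d] assms coeff_in_degree_neq_0[OF assms(3)] by (auto simp: l_def)
    have t: "mvars t \<subseteq> insert x V"
      unfolding t_def
      using mvars_coeff_in[of x ?n f] less.prems
      by (intro order.trans[OF mvars_mult] Un_least order.trans[OF mvars_power]) auto
    have r1v: "mvars r1 \<subseteq> insert x V"
      unfolding r1_def using l t less.prems assms
      by (intro order.trans[OF mvars_diff] Un_least order.trans[OF mvars_mult]) auto
    have step: "degree_in x r1 < ?n \<or> x \<notin> mvars r1" "?n = 0 \<Longrightarrow> r1 = 0"
      using coeff_in_pseudo_step[of x f ?n d ?e] False by (simp_all add: r1_def l_def t_def)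
    show ?thesis
    proof (cases "r1 = 0")
      case True
      then have "l * f = t * d + 0" by (simp add: r1_def)
      then show ?thesis using l t by (intro exI[of _ l] exI[of _ t] exI[of _ 0]) auto
    next
      case r1: False
      then have "?n \<noteq> 0" using step(2) by blast
      then have "degree_in x r1 < ?n" using step(1) degree_in_0_iff[of x r1] by auto
      then obtain c q r where *: "mvars c \<subseteq> V" "c \<noteq> 0" "mvars q \<subseteq> insert x V" "mvars r \<subseteq> insert x V"
          "c * r1 = q * d + r" "r = 0 \<or> degree_in x r < ?e"
        using less.hyps[OF _ r1v] by blast
      have "(c * l) * f = (q + c * t) * d + r"
        using *(5) by (simp add: r1_def algebra_simps)
      moreover have "mvars (c * l) \<subseteq> V" using mvars_mult[of c l] * l by auto
      moreover have "c * l \<noteq> 0" using * l by (simp add: mpoly_mult_eq_0_iff)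
      moreover have "mvars (q + c * t) \<subseteq> insert x V"
        using * t by (intro order.trans[OF mvars_add] Un_least order.trans[OF mvars_mult]) auto
      ultimately show ?thesis using * by blast
    qed
  qed
qed

text \<open>Gauss's theorem on unique factorization. An irreducible \<open>p\<close> involving
  \<open>x\<close> is primitive over \<open>V\<close>, and a combination of \<open>p\<close> and
  \<open>g\<close> of least degree in \<open>x\<close> serves as their greatest common divisor over
  the fraction field of the polynomials in \<open>V\<close>.\<close>

lemma irreducibles_prime_insert:
  fixes V :: "'v set"
  assumes ufd: "irreducibles_prime V TYPE('a::field)" "finite V" and x: "x \<notin> V"
  shows "irreducibles_prime (insert x V) TYPE('a)"
  unfolding irreducibles_prime_def
proof (intro allI impI)
  fix p :: "('v, 'a) mpoly"
  assume pv: "mvars p \<subseteq> insert x V" and irr: "irreducible p"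
  then have "p \<noteq> 0" by (auto simp: irreducible_def)
  show "prime_in UNIV p"
  proof (cases "x \<in> mvars p")
    case False
    then show ?thesis using ufd irr pv by (auto simp: irreducibles_prime_def)
  next
    case xp: True
    have prim: "q dvd 1" if q: "mvars q \<subseteq> V" "q dvd p" for q
    proof -
      obtain r where r: "p = q * r" using q by (auto simp: dvd_def)
      then have "q dvd 1 \<or> r dvd 1" using irr by (auto simp: irreducible_def)
      \<comment> \<open>As \<open>q\<close> is free of \<open>x\<close>, the variable
        \<open>x\<close> must occur in the cofactor.\<close>
      moreover have "\<not> r dvd 1"
      proof
        assume "r dvd 1"
        then have "mvars p \<subseteq> V" using r q mvars_mult[of q r] by (auto simp: mpoly_unit_iff)
        then show False using xp x by auto
      qed
      ultimately show ?thesis by blast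
    qed
    have "p dvd g \<or> p dvd h"
      if gh: "mvars g \<subseteq> insert x V" "mvars h \<subseteq> insert x V" "p dvd g * h" for g h
    proof -
      \<comment> \<open>The ideal spanned by \<open>p\<close> and \<open>g\<close> among the
        polynomials in \<open>insert x V\<close>.\<close>
      define D where "D = {d. \<exists>\<alpha> \<beta>. mvars \<alpha> \<subseteq> insert x V \<and> mvars \<beta> \<subseteq> insert x V \<and> d = \<alpha> * p + \<beta> * g}"
      have "p \<in> D" unfolding D_def by (intro CollectI exI[of _ 1] exI[of _ 0]) auto
      have "g \<in> D" unfolding D_def by (intro CollectI exI[of _ 0] exI[of _ 1]) auto
      have Dv: "mvars d \<subseteq> insert x V" if "d \<in> D" for d
        using that gh pv unfolding D_def
        by (auto dest!: subsetD[OF mvars_add] subsetD[OF mvars_mult])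
      have Dcomb: "a * d - b * e \<in> D"
        if de: "d \<in> D" "e \<in> D" "mvars a \<subseteq> insert x V" "mvars b \<subseteq> insert x V" for a b d e
      proof -
        obtain \<alpha> \<beta> where 1: "mvars \<alpha> \<subseteq> insert x V" "mvars \<beta> \<subseteq> insert x V" "d = \<alpha> * p + \<beta> * g"
          using de by (auto simp: D_def)
        obtain \<alpha>' \<beta>' where 2: "mvars \<alpha>' \<subseteq> insert x V" "mvars \<beta>' \<subseteq> insert x V" "e = \<alpha>' * p + \<beta>' * g"
          using de by (auto simp: D_def)
        have "a * d - b * e = (a * \<alpha> - b * \<alpha>') * p + (a * \<beta> - b * \<beta>') * g"
          by (simp add: 1 2 algebra_simps)
        moreover have "mvars (a * \<alpha> - b * \<alpha>') \<subseteq> insert x V" "mvars (a * \<beta> - b * \<beta>') \<subseteq> insert x V"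
          using 1 2 de by (intro order.trans[OF mvars_diff] Un_least order.trans[OF mvars_mult]; auto)+
        ultimately show ?thesis unfolding D_def by blast
      qed
      obtain d where d: "d \<in> D" "d \<noteq> 0" "\<And>e. e \<in> D \<Longrightarrow> e \<noteq> 0 \<Longrightarrow> degree_in x d \<le> degree_in x e"
        using ex_has_least_nat[of "\<lambda>d. d \<in> D \<and> d \<noteq> 0" p "degree_in x"] \<open>p \<in> D\<close> \<open>p \<noteq> 0\<close> by blast
      \<comment> \<open>A pseudo-remainder of \<open>e\<close> by \<open>d\<close> lies in
        \<open>D\<close> again, so minimality of \<open>d\<close> forces it to be zero.\<close>
      have divides: "\<exists>c q. mvars c \<subseteq> V \<and> c \<noteq> 0 \<and> c * e = q * d" if e: "e \<in> D" for e
      proof -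
        obtain c q r where *: "mvars c \<subseteq> V" "c \<noteq> 0" "mvars q \<subseteq> insert x V"
            "c * e = q * d + r" "r = 0 \<or> degree_in x r < degree_in x d"
          using pseudo_division[OF Dv[OF e] Dv[OF d(1)] d(2)] by blast
        have "r = c * e - q * d" using *(4) by simp
        then have "r \<in> D" using Dcomb[OF e d(1), of c q] * by auto
        then have "r = 0" using d(3)[of r] *(5) by (metis not_le)
        then show ?thesis using * by auto
      qed
      obtain c q where cq: "mvars c \<subseteq> V" "c \<noteq> 0" "c * p = q * d" using divides[OF \<open>p \<in> D\<close>] by blast
      obtain c1 c2 q' d' where s: "mvars c2 \<subseteq> V" "c2 \<noteq> 0" "d = c2 * d'" "p = q' * d'"
        using split_factor[OF ufd cq] by metis
      \<comment> \<open>If \<open>q'\<close> is a unit, then \<open>d\<close> is \<open>p\<close> up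
        to a factor free of \<open>x\<close>, and \<open>p\<close> divides \<open>g\<close> because
        \<open>d\<close> does so up to such a factor. If \<open>d'\<close> is a unit, then
        \<open>d\<close> itself is free of \<open>x\<close>; multiplying the combination that
        expresses \<open>d\<close> by \<open>h\<close> gives a multiple of \<open>p\<close>.\<close>
      then have "q' dvd 1 \<or> d' dvd 1" using irr unfolding irreducible_def by blast
      then show ?thesis
      proof
        assume "q' dvd 1"
        then obtain u where u: "1 = q' * u" by (auto simp: dvd_def)
        have "d' = (q' * u) * d'" by (simp flip: u)
        then have "d' = p * u" by (simp add: s(4) mult.assoc mult.commute[of d' u])
        obtain c' w where w: "mvars c' \<subseteq> V" "c' \<noteq> 0" "c' * g = w * d" using divides[OF \<open>g \<in> D\<close>] by blast
        have "w * d = (w * c2 * u) * p"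
          unfolding s(3) by (subst \<open>d' = p * u\<close>) (simp only: ac_simps)
        then have "c' * g = (w * c2 * u) * p" using w(3) by (rule trans[rotated])
        then have "p dvd g" using primitive_dvd_cancel[OF ufd w(1,2)] prim by blast
        then show ?thesis ..
      next
        assume "d' dvd 1"
        then have "mvars d \<subseteq> V" using s mvars_mult[of c2 d'] by (auto simp: mpoly_unit_iff)
        obtain \<alpha> \<beta> where "d = \<alpha> * p + \<beta> * g" using d(1) by (auto simp: D_def)
        moreover obtain k where "g * h = p * k" using gh(3) by (auto simp: dvd_def)
        ultimately have "d * h = (\<alpha> * h + \<beta> * k) * p"
          by (simp add: distrib_right mult.assoc mult.left_commute mult.commute[of p])
        then have "p dvd h" using primitive_dvd_cancel[OF ufd \<open>mvars d \<subseteq> V\<close> d(2)] prim by blast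
        then show ?thesis ..
      qed
    qed
    then have "prime_in (insert x V) p" by (simp add: prime_in_def)
    then show ?thesis using prime_in_UNIV pv by blast
  qed
qed

lemma irreducibles_prime: "finite V \<Longrightarrow> irreducibles_prime V TYPE('a::field)"
proof (induction V rule: finite_induct)
  case empty
  then show ?case by (auto simp: irreducibles_prime_def irreducible_def mpoly_unit_iff)
qed (rule irreducibles_prime_insert)

text \<open>After cancelling \<open>a\<close>, \<open>f\<close> divides \<open>g\<close>. In no
  variable does \<open>g\<close> have larger degree than \<open>f\<close>, so the quotient involves
  no variable.\<close>

lemma proportional_if_no_factor:
  fixes a b f g :: "('v, 'a::field) mpoly"
  assumes "a * g = b * f" "a \<noteq> 0" "mvars a \<subseteq> N" "f \<noteq> 0" "keys g \<subseteq> keys f"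
    and no_factor: "\<And>q. mvars q \<subseteq> N \<Longrightarrow> q dvd f \<Longrightarrow> q \<in> range Const"
  obtains c where "g = Const c * f"
proof -
  have "f dvd g"
  proof (rule primitive_dvd_cancel[OF irreducibles_prime])
    show "a * g = b * f" "a \<noteq> 0" "mvars a \<subseteq> mvars a" by (use assms in auto)
    show "finite (mvars a)" "finite (mvars a)" by simp_all
    fix q assume q: "mvars q \<subseteq> mvars a" "q dvd f"
    then have "q \<noteq> 0" using \<open>f \<noteq> 0\<close> by auto
    moreover have "q \<in> range Const" using no_factor[of q] q assms by auto
    ultimately show "q dvd 1" by (auto simp: mpoly_unit_iff)
  qed
  then obtain k where k: "g = f * k" by (auto simp: dvd_def)
  show ?thesis
  proof (cases "k = 0")
    case True
    then show ?thesis using that[of 0] k by simp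
  next
    case False
    have "degree_in v k = 0" for v
      using degree_in_mult[OF \<open>f \<noteq> 0\<close> False, of v] degree_in_mono[OF assms(5), of v] k by simp
    then have "mvars k = {}" by (auto simp: degree_in_0_iff)
    then show ?thesis using that k by (auto simp: mvars_eq_empty_iff mult.commute)
  qed
qed


section \<open>Derivations\<close>

text \<open>The derivation along the homomorphism \<open>h\<close> that kills constants and sends
  \<open>Var v\<close> to \<open>t v\<close>: the sum over \<open>v\<close> of \<open>h\<close> of
  the partial derivative times \<open>t v\<close>. Taking values in another ring allows derivations
  from polynomials into a fraction field.\<close>

definition der :: "(('v, 'a::comm_ring_1) mpoly \<Rightarrow> 'b::comm_ring_1) \<Rightarrow> ('v \<Rightarrow> 'b) \<Rightarrow> ('v, 'a) mpoly \<Rightarrow> 'b" where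
  "der h t = mlin (\<lambda>m c. \<Sum>v\<in>keys m. h (single (m - single v 1) (of_nat (lookup m v) * c)) * t v)"

lemma der_add:
  assumes "ringhom h"
  shows "der h t (p + q) = der h t p + der h t q"
  unfolding der_def
proof (rule mlin_add)
  fix m :: "'a \<Rightarrow>\<^sub>0 nat" and a b :: 'b
  show "(\<Sum>v\<in>keys m. h (single (m - single v 1) (of_nat (lookup m v) * (a + b))) * t v) =
      (\<Sum>v\<in>keys m. h (single (m - single v 1) (of_nat (lookup m v) * a)) * t v) +
      (\<Sum>v\<in>keys m. h (single (m - single v 1) (of_nat (lookup m v) * b)) * t v)"
    by (simp only: distrib_left distrib_right single_add ringhomD[OF assms] sum.distrib)
qed (simp add: ringhomD[OF assms])

lemma der_single:
  assumes "ringhom h" "finite S" "keys m \<subseteq> S"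
  shows "der h t (single m c) = (\<Sum>v\<in>S. h (single (m - single v 1) (of_nat (lookup m v) * c)) * t v)"
proof -
  have "der h t (single m c) = (\<Sum>v\<in>keys m. h (single (m - single v 1) (of_nat (lookup m v) * c)) * t v)"
    unfolding der_def by (rule mlin_single) (simp add: ringhomD[OF assms(1)])
  also have "\<dots> = (\<Sum>v\<in>S. h (single (m - single v 1) (of_nat (lookup m v) * c)) * t v)"
    using assms(2,3) by (intro sum.mono_neutral_left) (auto simp: in_keys_iff ringhomD[OF assms(1)])
  finally show ?thesis .
qed

lemma der_Const [simp]: "ringhom h \<Longrightarrow> der h t (Const c) = 0"
  unfolding Const_def by (subst der_single[of h "{}"]) auto

lemma der_Var [simp]: "ringhom h \<Longrightarrow> der h t (Var v) = t v"
  unfolding Var_def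
  by (subst der_single[of h "{v}"]) (auto simp: ringhomD)

lemma der_mult:
  assumes h: "ringhom h"
  shows "der h t (p * q) = der h t p * h q + h p * der h t q"
proof (rule mpoly_bilinear_eq[where B = "\<lambda>p q. der h t (p * q)" and
      B' = "\<lambda>p q. der h t p * h q + h p * der h t q"])
  fix m n :: "'a \<Rightarrow>\<^sub>0 nat" and a b :: 'b
  let ?S = "keys m \<union> keys n"
  have S: "finite ?S" "keys m \<subseteq> ?S" "keys n \<subseteq> ?S" "keys (m + n) \<subseteq> ?S"
    using keys_add[of m n] by auto
  have step: "single (m + n - single v 1) (of_nat (lookup (m + n) v) * (a * b)) =
      single (m - single v 1) (of_nat (lookup m v) * a) * single n b +
      single m a * single (n - single v 1) (of_nat (lookup n v) * b)" for v
  proof -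
    \<comment> \<open>Subtraction of exponents is truncated, so the two monomials can differ when
      \<open>v\<close> is absent from \<open>m\<close>; then the coefficient is zero.\<close>
    have 1: "single (m - single v 1 + n) (of_nat (lookup m v) * a * b) =
        single (m + n - single v 1) (of_nat (lookup m v) * a * b)"
    proof (cases "lookup m v = 0")
      case False
      then have "m - single v 1 + n = m + n - single v 1"
        by (intro poly_mapping_eqI) (auto simp: lookup_add lookup_minus lookup_single when_def)
      then show ?thesis by simp
    qed simp
    have 2: "single (m + (n - single v 1)) (a * (of_nat (lookup n v) * b)) =
        single (m + n - single v 1) (a * (of_nat (lookup n v) * b))"
    proof (cases "lookup n v = 0")
      case False
      then have "m + (n - single v 1) = m + n - single v 1"
        by (intro poly_mapping_eqI) (auto simp: lookup_add lookup_minus lookup_single when_def)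
      then show ?thesis by simp
    qed simp
    have "of_nat (lookup (m + n) v) * (a * b) =
        of_nat (lookup m v) * a * b + a * (of_nat (lookup n v) * b)"
      by (simp add: lookup_add algebra_simps)
    then show ?thesis by (simp only: mult_single 1 2 single_add)
  qed
  have "der h t (single m a * single n b) =
      (\<Sum>v\<in>?S. h (single (m + n - single v 1) (of_nat (lookup (m + n) v) * (a * b))) * t v)"
    unfolding mult_single by (rule der_single[OF h S(1,4)])
  also have "\<dots> = (\<Sum>v\<in>?S. h (single (m - single v 1) (of_nat (lookup m v) * a)) * t v * h (single n b)
      + h (single m a) * (h (single (n - single v 1) (of_nat (lookup n v) * b)) * t v))"
    unfolding step by (intro sum.cong) (simp_all add: ringhomD[OF h] algebra_simps)
  also have "\<dots> = der h t (single m a) * h (single n b) + h (single m a) * der h t (single n b)"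
    unfolding sum.distrib der_single[OF h S(1,2)] der_single[OF h S(1,3)]
    by (simp only: sum_distrib_left sum_distrib_right)
  finally show "der h t (single m a * single n b) =
      der h t (single m a) * h (single n b) + h (single m a) * der h t (single n b)" .
qed (simp_all add: der_add[OF h] ringhomD[OF h] algebra_simps)

lemma dderiv_eq_der: "dderiv p = der (\<lambda>x. x) (\<lambda>v. Var (next_der v)) p"
  unfolding dderiv_def der_def mlin_def Var_def by (simp add: mult_single)

lemma dderiv_add: "dderiv (p + q) = dderiv p + dderiv q"
  and dderiv_mult: "dderiv (p * q) = dderiv p * q + p * dderiv q"
  and dderiv_Const [simp]: "dderiv (Const c) = 0"
  and dderiv_Var [simp]: "dderiv (Var v :: ('s, 'a::comm_ring_1) dpoly) = Var (next_der v)"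
  for p q :: "('s, 'a::comm_ring_1) dpoly"
  by (simp_all add: dderiv_eq_der der_add der_mult ringhom_id)

lemma dderiv_diff: "dderiv (p - q) = dderiv p - dderiv q" for p q :: "('s, 'a::comm_ring_1) dpoly"
  using dderiv_add[of "p - q" q] by (simp add: algebra_simps)

lemma mvars_der:
  "mvars (der (\<lambda>x. x) t p) \<subseteq> mvars p \<union> (\<Union>v\<in>mvars p. mvars (t v))"
  for p :: "('v, 'a::comm_ring_1) mpoly"
proof -
  have "mvars (single (m - single v 1) c * t v) \<subseteq> mvars p \<union> (\<Union>v\<in>mvars p. mvars (t v))"
    if "m \<in> keys p" "v \<in> keys m" for m v and c :: 'a
  proof -
    have "keys (m - single v 1) \<subseteq> keys m" by (auto simp: in_keys_iff lookup_minus)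
    then have "mvars (single (m - single v 1) c) \<subseteq> mvars p" "v \<in> mvars p"
      using mvars_single[of "m - single v 1" c] that by (auto simp: mvars_def)
    then show ?thesis using mvars_mult[of "single (m - single v 1) c" "t v"] by auto
  qed
  then show ?thesis
    unfolding der_def mlin_def
    by (intro order.trans[OF mvars_sum] UN_least)
qed

section \<open>Partial derivatives and separants\<close>

definition pdv :: "'v \<Rightarrow> ('v, 'a::comm_ring_1) mpoly \<Rightarrow> ('v, 'a) mpoly" where
  "pdv v = der (\<lambda>x. x) (\<lambda>w. if w = v then 1 else 0)"

lemma lookup_pdv: "lookup (pdv v p) n = of_nat (Suc (lookup n v)) * lookup p (n + single v 1)"
proof (induction p rule: poly_mapping_add_induct)
  case zero
  show ?case by (simp add: pdv_def der_def)
next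
  case (add p m c)
  have "lookup (pdv v (single m c)) n = of_nat (Suc (lookup n v)) * lookup (single m c) (n + single v 1)"
  proof -
    have "(\<Sum>w\<in>insert v (keys m). single (m - single w 1) (of_nat (lookup m w) * c) * (if w = v then 1 else 0)) =
        (\<Sum>w\<in>insert v (keys m). if v = w then single (m - single w 1) (of_nat (lookup m w) * c) else 0)"
      by (intro sum.cong) auto
    then have "pdv v (single m c) = single (m - single v 1) (of_nat (lookup m v) * c)"
      unfolding pdv_def by (subst der_single[of _ "insert v (keys m)"]) (auto simp: ringhom_id)
    moreover have "n + single v 1 = m \<longleftrightarrow> lookup m v \<noteq> 0 \<and> n = m - single v 1"
      by (auto simp: lookup_add lookup_minus lookup_single when_def intro!: poly_mapping_eqI)
    ultimately show ?thesis
      by (cases "lookup m v = 0") (auto simp: lookup_single lookup_minus lookup_add when_def)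
  qed
  moreover have "pdv v (p + single m c) = pdv v p + pdv v (single m c)"
    by (simp add: pdv_def der_add ringhom_id)
  ultimately show ?case using add by (simp add: lookup_add algebra_simps)
qed

text \<open>The chain rule with the contribution of \<open>v\<close> isolated. When \<open>v\<close>
  is the leader of \<open>p\<close>, the first factor is the separant and becomes the coefficient of
  the leader of the derivative.\<close>

lemma dderiv_split:
  fixes p :: "('s, 'a::comm_ring_1) dpoly"
  shows "dderiv p = pdv v p * Var (next_der v) + der (\<lambda>x. x) (\<lambda>w. if w = v then 0 else Var (next_der w)) p"
    (is "_ = ?r p")
proof (induction p rule: mpoly_induct)
  case (mult p q)
  then show ?case
    by (simp add: dderiv_mult pdv_def der_mult ringhom_id algebra_simps)
qed (simp_all add: pdv_def ringhom_id dderiv_add der_add algebra_simps)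

lemma keys_pdv: "n \<in> keys (pdv v p) \<Longrightarrow> n + single v 1 \<in> keys p"
  by (auto simp: in_keys_iff lookup_pdv)

lemma degree_in_pdv_le: "degree_in w (pdv v p) \<le> degree_in w p"
  unfolding degree_in_le_iff
proof
  fix n assume "n \<in> keys (pdv v p)"
  then have "lookup (n + single v 1) w \<le> degree_in w p"
    using keys_pdv[of n v p] degree_in_le_iff[of w p "degree_in w p"] by blast
  then show "lookup n w \<le> degree_in w p" by (simp add: lookup_add)
qed

lemma degree_in_pdv_less:
  assumes "v \<in> mvars p"
  shows "degree_in v (pdv v p) < degree_in v p"
proof -
  have "lookup n v < degree_in v p" if "n \<in> keys (pdv v p)" for n
  proof -
    have "lookup (n + single v 1) v \<le> degree_in v p"
      using that keys_pdv[of n v p] degree_in_le_iff[of v p "degree_in v p"] by blast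
    then show ?thesis by (simp add: lookup_add)
  qed
  then have "degree_in v (pdv v p) \<le> degree_in v p - 1"
    unfolding degree_in_le_iff by fastforce
  moreover have "degree_in v p \<noteq> 0" using assms by (simp add: degree_in_0_iff)
  ultimately show ?thesis by linarith
qed

lemma mvars_pdv: "mvars (pdv v p) \<subseteq> mvars p"
  using degree_in_pdv_le[of _ v p] degree_in_0_iff[of _ p] degree_in_0_iff[of _ "pdv v p"]
  by (metis le_zero_eq subsetI)

text \<open>Differentiation multiplies the coefficient of a monomial containing \<open>v\<close> by
  a positive exponent, which is nonzero in characteristic 0.\<close>

lemma pdv_neq_0:
  fixes p :: "('v, 'a::idom) mpoly"
  assumes "inj (of_nat :: nat \<Rightarrow> 'a)" "v \<in> mvars p"
  shows "pdv v p \<noteq> 0"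
proof -
  obtain m where m: "m \<in> keys p" "lookup m v \<noteq> 0"
    using assms(2) by (auto simp: mvars_def in_keys_iff)
  then have eq: "m - single v 1 + single v 1 = m"
    by (intro poly_mapping_eqI) (auto simp: lookup_add lookup_minus lookup_single when_def)
  have "of_nat (Suc k) \<noteq> (0 :: 'a)" for k
    using injD[OF assms(1), of "Suc k" 0] by auto
  then have "lookup (pdv v p) (m - single v 1) \<noteq> 0"
    using m unfolding lookup_pdv eq by (simp add: in_keys_iff del: of_nat_Suc)
  then show ?thesis by auto
qed


section \<open>The ideal of a model is prime\<close>

text \<open>The quotient rule, phrased by unique description since an element of the fraction field
  has many representations.\<close>

definition fract_der :: "('a::idom \<Rightarrow> 'a fract) \<Rightarrow> 'a fract \<Rightarrow> 'a fract" where
  "fract_der d z = (THE w. \<exists>a b. b \<noteq> 0 \<and> z = to_fract a / to_fract b \<and>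
      w = (d a * to_fract b - to_fract a * d b) / (to_fract b)\<^sup>2)"

lemma fract_cases_to_fract:
  obtains a b where "b \<noteq> 0" "z = to_fract a / to_fract (b :: 'a::idom)"
proof -
  obtain a b where "z = Fract a b" "b \<noteq> 0" by (rule Fract_cases)
  then show ?thesis using that by (simp add: Fract_conv_to_fract)
qed

context
  fixes d :: "'a::idom \<Rightarrow> 'a fract"
  assumes d_add: "\<And>a b. d (a + b) = d a + d b"
    and d_mult: "\<And>a b. d (a * b) = d a * to_fract b + to_fract a * d b"
begin

text \<open>Independence of the representation comes from applying \<open>d\<close> to the equation
  \<open>a * b' = a' * b\<close>.\<close>

lemma fract_der_quotient:
  assumes "b \<noteq> 0"
  shows "fract_der d (to_fract a / to_fract b) = (d a * to_fract b - to_fract a * d b) / (to_fract b)\<^sup>2"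
  unfolding fract_der_def
proof (rule the_equality)
  fix w assume "\<exists>a' b'. b' \<noteq> 0 \<and> to_fract a / to_fract b = to_fract a' / to_fract b' \<and>
      w = (d a' * to_fract b' - to_fract a' * d b') / (to_fract b')\<^sup>2"
  then obtain a' b' where b': "b' \<noteq> 0" and eq: "to_fract a / to_fract b = to_fract a' / to_fract b'"
    and w: "w = (d a' * to_fract b' - to_fract a' * d b') / (to_fract b')\<^sup>2" by blast
  let ?A = "to_fract a" and ?B = "to_fract b" and ?A' = "to_fract a'" and ?B' = "to_fract b'"
  have AB: "?A * ?B' = ?A' * ?B" using eq assms b' by (simp add: field_simps)
  then have "a * b' = a' * b" by (simp flip: to_fract_mult)
  then have "d (a * b') = d (a' * b)" by simp
  then have D: "d a * ?B' + ?A * d b' = d a' * ?B + ?A' * d b" by (simp only: d_mult)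
  have "(d a' * ?B' - ?A' * d b') * ?B\<^sup>2 = ?B' * ?B * (d a' * ?B + ?A' * d b) - ?A' * ?B * ?B' * d b - ?A' * ?B * ?B * d b'"
    by (simp add: power2_eq_square algebra_simps)
  also have "\<dots> = ?B' * ?B * (d a * ?B' + ?A * d b') - ?A * ?B' * ?B' * d b - ?A * ?B' * ?B * d b'"
    by (simp only: D AB)
  also have "\<dots> = (d a * ?B - ?A * d b) * ?B'\<^sup>2"
    by (simp add: power2_eq_square algebra_simps)
  finally show "w = (d a * ?B - ?A * d b) / ?B\<^sup>2"
    unfolding w using assms b' by (simp add: frac_eq_eq)
qed (use assms in blast)

lemma fract_der_to_fract: "fract_der d (to_fract a) = d a"
proof -
  have "d 1 = d 1 + d 1" using d_mult[of 1 1] by (simp only: mult_1 mult_1_right to_fract_1)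
  then have "d 1 = 0" by (metis add_cancel_right_right)
  then show ?thesis using fract_der_quotient[of 1 a] by simp
qed

lemma fract_der_add: "fract_der d (x + y) = fract_der d x + fract_der d y"
proof -
  obtain a b where x: "b \<noteq> 0" "x = to_fract a / to_fract b" by (rule fract_cases_to_fract)
  obtain a' b' where y: "b' \<noteq> 0" "y = to_fract a' / to_fract b'" by (rule fract_cases_to_fract)
  have nz: "to_fract b \<noteq> 0" "to_fract b' \<noteq> 0" using x y by auto
  have xy: "x + y = to_fract (a * b' + a' * b) / to_fract (b * b')"
    using x y by (simp add: field_simps)
  have "b * b' \<noteq> 0" using x y by simp
  then have "fract_der d (x + y) =
      (d (a * b' + a' * b) * to_fract (b * b') - to_fract (a * b' + a' * b) * d (b * b')) / (to_fract (b * b'))\<^sup>2"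
    unfolding xy by (rule fract_der_quotient)
  also have "\<dots> = fract_der d x + fract_der d y"
    unfolding x(2) y(2) fract_der_quotient[OF x(1)] fract_der_quotient[OF y(1)]
    using nz by (simp add: d_add d_mult field_simps power2_eq_square)
  finally show ?thesis .
qed

lemma fract_der_mult: "fract_der d (x * y) = fract_der d x * y + x * fract_der d y"
proof -
  obtain a b where x: "b \<noteq> 0" "x = to_fract a / to_fract b" by (rule fract_cases_to_fract)
  obtain a' b' where y: "b' \<noteq> 0" "y = to_fract a' / to_fract b'" by (rule fract_cases_to_fract)
  have nz: "to_fract b \<noteq> 0" "to_fract b' \<noteq> 0" using x y by auto
  have xy: "x * y = to_fract (a * a') / to_fract (b * b')"
    using x y by simp
  have "b * b' \<noteq> 0" using x y by simp
  then have "fract_der d (x * y) =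
      (d (a * a') * to_fract (b * b') - to_fract (a * a') * d (b * b')) / (to_fract (b * b'))\<^sup>2"
    unfolding xy by (rule fract_der_quotient)
  also have "\<dots> = fract_der d x * y + x * fract_der d y"
    unfolding x(2) y(2) fract_der_quotient[OF x(1)] fract_der_quotient[OF y(1)]
    using nz by (simp add: d_mult field_simps power2_eq_square)
  finally show ?thesis .
qed

end

section \<open>Ideals and normal forms modulo the model equations\<close>

lemma ideal_ofD:
  assumes "ideal_of UNIV I"
  shows "0 \<in> I" "a \<in> I \<Longrightarrow> b \<in> I \<Longrightarrow> a + b \<in> I" "a \<in> I \<Longrightarrow> r * a \<in> I" "a \<in> I \<Longrightarrow> a * r \<in> I"
    "a \<in> I \<Longrightarrow> b \<in> I \<Longrightarrow> a - b \<in> I"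
proof -
  show *: "0 \<in> I" "a \<in> I \<Longrightarrow> b \<in> I \<Longrightarrow> a + b \<in> I" "a \<in> I \<Longrightarrow> r * a \<in> I" for a b r
    using assms by (auto simp: ideal_of_def)
  show "a \<in> I \<Longrightarrow> a * r \<in> I" using *(3)[of a r] by (simp add: mult.commute)
  show "a \<in> I \<Longrightarrow> b \<in> I \<Longrightarrow> a - b \<in> I" using *(2)[of a "- 1 * b"] *(3)[of b "- 1"] by simp
qed

lemma ideal_of_UNIV_I:
  assumes "0 \<in> I" "\<And>a b. a \<in> I \<Longrightarrow> b \<in> I \<Longrightarrow> a + b \<in> I" "\<And>r a. a \<in> I \<Longrightarrow> r * a \<in> I"
  shows "ideal_of UNIV I"
  using assms by (auto simp: ideal_of_def)

lemma generated_differential_ideal: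
  shows "differential_ideal (generated_differential_ideal F)"
    and "F \<subseteq> generated_differential_ideal F"
    and "differential_ideal I \<Longrightarrow> F \<subseteq> I \<Longrightarrow> generated_differential_ideal F \<subseteq> I"
  by (auto simp: generated_differential_ideal_def differential_ideal_def ideal_of_def)

lemma generated_ideal_UNIV:
  shows "ideal_of UNIV (generated_ideal UNIV F)"
    and "F \<subseteq> generated_ideal UNIV F"
    and "ideal_of UNIV I \<Longrightarrow> F \<subseteq> I \<Longrightarrow> generated_ideal UNIV F \<subseteq> I"
  by (auto simp: generated_ideal_def ideal_of_def)

text \<open>For a model, \<open>W\<close> consists of the states and all derivatives of the inputs;
  the equations rewrite everything else in terms of \<open>W\<close> at the cost of powers of
  \<open>Q\<close>. The set \<open>S\<close> of polynomials that can be so rewritten is closed under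
  sums, products and derivation and contains all indeterminates.\<close>

lemma normal_form_mod_differential_ideal:
  fixes J :: "('s, 'a::comm_ring_1) dpoly set"
  assumes J: "differential_ideal J" and Q: "mvars Q \<subseteq> W"
    and next_W: "\<And>v. v \<in> W \<Longrightarrow> next_der v \<in> W \<or> (\<exists>q. mvars q \<subseteq> W \<and> Q * Var (next_der v) - q \<in> J)"
    and base_W: "\<And>z. (z, 0) \<in> W \<or> (\<exists>q. mvars q \<subseteq> W \<and> Q * Var (z, 0) - q \<in> J)"
  shows "\<exists>l q. mvars q \<subseteq> W \<and> Q ^ l * p - q \<in> J"
proof -
  define S where "S = {p. \<exists>l q. mvars q \<subseteq> W \<and> Q ^ l * p - q \<in> J}"
  note J' = ideal_ofD[OF J[unfolded differential_ideal_def, THEN conjunct1]]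
  have J_der: "dderiv p \<in> J" if "p \<in> J" for p using J that by (simp add: differential_ideal_def)
  have SI: "p \<in> S" if "mvars q \<subseteq> W" "Q ^ l * p - q \<in> J" for l p q using that by (auto simp: S_def)
  have base: "q \<in> S" if "mvars q \<subseteq> W" for q using SI[of q 0 q] that J'(1) by simp
  have add: "p1 + p2 \<in> S" if p: "p1 \<in> S" "p2 \<in> S" for p1 p2
  proof -
    obtain l1 q1 l2 q2 where *: "mvars q1 \<subseteq> W" "Q ^ l1 * p1 - q1 \<in> J" "mvars q2 \<subseteq> W" "Q ^ l2 * p2 - q2 \<in> J"
      using p by (auto simp: S_def)
    have "Q ^ (l1 + l2) * (p1 + p2) - (Q ^ l2 * q1 + Q ^ l1 * q2) =
        Q ^ l2 * (Q ^ l1 * p1 - q1) + Q ^ l1 * (Q ^ l2 * p2 - q2)"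
      by (simp add: algebra_simps power_add)
    moreover have "mvars (Q ^ l2 * q1 + Q ^ l1 * q2) \<subseteq> W"
      using * Q mvars_power[of Q l1] mvars_power[of Q l2]
      by (intro order.trans[OF mvars_add] Un_least order.trans[OF mvars_mult]) auto
    ultimately show ?thesis using J'(2,3) * by (metis SI)
  qed
  have mult: "p1 * p2 \<in> S" if p: "p1 \<in> S" "p2 \<in> S" for p1 p2
  proof -
    obtain l1 q1 l2 q2 where *: "mvars q1 \<subseteq> W" "Q ^ l1 * p1 - q1 \<in> J" "mvars q2 \<subseteq> W" "Q ^ l2 * p2 - q2 \<in> J"
      using p by (auto simp: S_def)
    have "Q ^ (l1 + l2) * (p1 * p2) - q1 * q2 =
        (Q ^ l2 * p2) * (Q ^ l1 * p1 - q1) + q1 * (Q ^ l2 * p2 - q2)"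
      by (simp add: algebra_simps power_add)
    moreover have "mvars (q1 * q2) \<subseteq> W"
      using * by (intro order.trans[OF mvars_mult]) auto
    ultimately show ?thesis using J'(2,3) * by (metis SI)
  qed
  have unsat: "p \<in> S" if Qs: "Q ^ a * p - s \<in> J" "s \<in> S" for a p s
  proof -
    obtain l q where *: "mvars q \<subseteq> W" "Q ^ l * s - q \<in> J" using Qs by (auto simp: S_def)
    have "Q ^ (l + a) * p - q = Q ^ l * (Q ^ a * p - s) + (Q ^ l * s - q)"
      by (simp add: algebra_simps power_add)
    then show ?thesis using J'(2,3) * Qs by (metis SI)
  qed
  have base_der: "q \<in> S \<and> dderiv q \<in> S" if "mvars q \<subseteq> W" for q
    using that
  proof (induction q rule: mpoly_induct_mvars)
    case (Const c)
    then show ?case using base[of "Const c"] base[of 0] by simp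
  next
    case (Var v)
    then have "Var (next_der v) \<in> S"
      using next_W[OF Var] base[of "Var (next_der v)"] unsat[of 1 "Var (next_der v)"] base by auto
    then show ?case using base[of "Var v"] Var by simp
  qed (auto simp: dderiv_add dderiv_mult intro: add mult)
  have diff: "p1 - p2 \<in> S" if "p1 \<in> S" "p2 \<in> S" for p1 p2
  proof -
    have "Const (- 1) \<in> S" by (rule base) (simp only: mvars_Const empty_subsetI)
    then have "p1 + Const (- 1) * p2 \<in> S" using that by (intro add mult)
    then show ?thesis by (simp add: Const_uminus)
  qed
  have der: "dderiv p \<in> S" if p: "p \<in> S" for p
  proof -
    obtain l q where *: "mvars q \<subseteq> W" "Q ^ l * p - q \<in> J" using p by (auto simp: S_def)
    let ?j = "Q ^ l * p - q"
    \<comment> \<open>The quotient rule for \<open>p = q / Q ^ l\<close>, with denominators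
      cleared.\<close>
    have "Q ^ (l + l) * dderiv p - (Q ^ l * dderiv q - dderiv (Q ^ l) * q) =
        Q ^ l * dderiv ?j - dderiv (Q ^ l) * ?j"
      by (simp add: dderiv_diff dderiv_mult algebra_simps power_add)
    also have "\<dots> \<in> J" by (intro J'(5) J'(3) J_der *(2))
    finally have 1: "Q ^ (l + l) * dderiv p - (Q ^ l * dderiv q - dderiv (Q ^ l) * q) \<in> J" .
    have "mvars (Q ^ l) \<subseteq> W" using Q mvars_power[of Q l] by auto
    then have "Q ^ l * dderiv q - dderiv (Q ^ l) * q \<in> S"
      using base_der[of "Q ^ l"] base_der[of q] * by (intro diff mult) auto
    then show ?thesis using unsat[OF 1] by blast
  qed
  have "Var (z, i) \<in> S" for z i
  proof (induction i)
    case 0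
    show ?case using base_W[of z] base[of "Var (z, 0)"] unsat[of 1 "Var (z, 0)"] base by auto
  next
    case (Suc i)
    then show ?case using der[of "Var (z, i)"] by simp
  qed
  then have "Var v \<in> S" for v by (cases v) simp
  then have "p \<in> S"
    by (induction p rule: mpoly_induct) (auto intro: base add mult)
  then show ?thesis by (simp add: S_def)
qed


section \<open>The generic solution of a model\<close>

text \<open>The homomorphism evaluates at a generic solution. Its kernel is a differential ideal
  containing the equations, and the image of \<open>Q\<close> is nonzero, so the saturation lies in
  the kernel. Conversely, the normal form in \<open>W\<close> of a kernel element is sent to zero,
  and the homomorphism is injective on polynomials in \<open>W\<close>.\<close>

theorem model_ideal_eq_kernel:
  fixes f :: "'n::finite \<Rightarrow> ('l::linorder, 'n, 'm::finite, 'k::finite) ode_dpoly"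
  assumes "ode_model f g Q"
  obtains \<phi> :: "('l, 'n, 'm, 'k) ode_dpoly \<Rightarrow> (nat, 'l ratfun) mpoly fract"
  where "ringhom \<phi>" "model_ideal f g Q = {p. \<phi> p = 0}"
    "\<And>p. \<phi> p = 0 \<Longrightarrow> \<phi> (dderiv p) = 0"
proof -
  have "(UNIV :: ('n, 'm, 'k) indet set) = range State \<union> range Output \<union> range Input"
    by (rule UNIV_eq_I) (metis UnCI indet.exhaust rangeI)
  then have "finite (UNIV :: ('n, 'm, 'k) indet set)"
    by (metis finite_Un finite_class.finite_UNIV finite_imageI)
  then have "countable ((UNIV :: ('n, 'm, 'k) indet set) \<times> (UNIV :: nat set))"
    by (intro countable_SIGMA) (simp_all add: countable_finite)
  \<comment> \<open>Coding the variables by natural numbers places the solution in the fraction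
    field of a polynomial ring whose variables are linearly ordered.\<close>
  then obtain j :: "('n, 'm, 'k) indet \<times> nat \<Rightarrow> nat" where j: "inj j"
    by (auto simp: countable_def)
  define W where "W = range (\<lambda>i. (State i :: ('n, 'm, 'k) indet, 0 :: nat)) \<union> range Input \<times> UNIV"
  let ?\<iota> = "to_fract :: (nat, 'l ratfun) mpoly \<Rightarrow> _"
  have hom_\<iota>: "ringhom ?\<iota>" by (simp add: ringhom_def)
  define \<psi> where "\<psi> = (\<lambda>p. ?\<iota> (rename j p))"
  have hom_\<psi>: "ringhom \<psi>" unfolding \<psi>_def by (rule ringhom_comp[OF hom_\<iota> ringhom_rename])
  have \<psi>_inj: "p = 0" if "\<psi> p = 0" for p
  proof -
    have "rename j p = 0" using that by (simp add: \<psi>_def)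
    moreover have "rename (inv j) (rename j p) = p" by (rule rename_left_inverse) (simp add: j)
    ultimately show ?thesis using ringhomD(4)[OF ringhom_rename[of "inv j"]] by metis
  qed
  \<comment> \<open>The derivative prescribed for each coded variable: a state moves by
    \<open>f / Q\<close>, an input to its next derivative. The value 0 at outputs is a default; the
    output components of the solution are set by \<open>b\<close>.\<close>
  define t where "t = (\<lambda>k. case inv j k of (State i, n) \<Rightarrow> \<psi> (f i) / \<psi> Q
      | (Output i, n) \<Rightarrow> 0 | (Input i, n) \<Rightarrow> \<psi> (Var (Input i, Suc n)))"
  define d where "d = fract_der (der ?\<iota> t)"
  have d_add: "d (x + y) = d x + d y" and d_mult: "d (x * y) = d x * y + x * d y"
    and d_\<iota>: "d (?\<iota> a) = der ?\<iota> t a" for x y a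
    unfolding d_def
    by (rule fract_der_add fract_der_mult fract_der_to_fract;
        simp add: der_add[OF hom_\<iota>] der_mult[OF hom_\<iota>])+
  define b where "b = (\<lambda>z. case z of State i \<Rightarrow> \<psi> (Var (State i, 0)) | Output i \<Rightarrow> \<psi> (g i) / \<psi> Q
      | Input i \<Rightarrow> \<psi> (Var (Input i, 0)))"
  \<comment> \<open>Higher derivatives are sent to iterated derivatives of the base values, so
    evaluation commutes with the derivations.\<close>
  define e where "e = (\<lambda>v. (d ^^ snd v) (b (fst v)))"
  define \<phi> where "\<phi> = mpeval (\<lambda>c. ?\<iota> (Const c)) e"
  have hom_c: "ringhom (\<lambda>c. ?\<iota> (Const c))" by (simp add: ringhom_def Const_add Const_mult)
  have hom_\<phi>: "ringhom \<phi>" unfolding \<phi>_def by (rule ringhom_mpeval[OF hom_c])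
  have \<phi>_Var: "\<phi> (Var v) = e v" and \<phi>_Const: "\<phi> (Const c) = ?\<iota> (Const c)" for v c
    by (simp_all add: \<phi>_def hom_c)
  have e_next: "e (next_der v) = d (e v)" for v by (cases v) (simp add: e_def)
  have \<phi>_der: "\<phi> (dderiv p) = d (\<phi> p)" for p
  proof (induction p rule: mpoly_induct)
    case (Const c)
    then show ?case by (simp add: \<phi>_Const d_\<iota> hom_\<iota> ringhomD(4)[OF hom_\<phi>])
  qed (simp_all add: \<phi>_Var e_next dderiv_add dderiv_mult d_add d_mult ringhomD[OF hom_\<phi>])
  have \<psi>_Var: "\<psi> (Var v) = ?\<iota> (Var (j v))" for v by (simp add: \<psi>_def)
  have e_Input: "e (Input i, n) = \<psi> (Var (Input i, n))" for i n
  proof (induction n)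
    case 0
    show ?case by (simp add: e_def b_def)
  next
    case (Suc n)
    have "e (Input i, Suc n) = d (e (Input i, n))" using e_next[of "(Input i, n)"] by simp
    also have "\<dots> = t (j (Input i, n))" by (simp add: Suc \<psi>_Var d_\<iota> hom_\<iota>)
    finally show ?case by (simp add: t_def j)
  qed
  \<comment> \<open>On \<open>W\<close> the solution consists of the coded variables
    themselves.\<close>
  have \<phi>_\<psi>: "\<phi> p = \<psi> p" if "mvars p \<subseteq> W" for p
  proof (rule ringhom_eq_on_mvars[OF hom_\<phi> hom_\<psi>])
    show "\<phi> (Const c) = \<psi> (Const c)" for c by (simp add: \<phi>_Const \<psi>_def)
    fix v assume "v \<in> mvars p"
    then have "v \<in> W" using that by auto
    then show "\<phi> (Var v) = \<psi> (Var v)"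
      unfolding W_def \<phi>_Var by (auto simp: e_Input) (simp add: e_def b_def)
  qed
  have "f i \<in> model_polys" "g k \<in> model_polys" "Q \<in> model_polys" "Q \<noteq> 0" for i k
    using assms by (auto simp: ode_model_def)
  moreover have "mvars p \<subseteq> W" if "p \<in> model_polys" for p
    using that by (auto simp: model_polys_def polys_def W_def)
  ultimately have vars: "mvars (f i) \<subseteq> W" "mvars (g k) \<subseteq> W" "mvars Q \<subseteq> W" and "Q \<noteq> 0" for i k
    by auto
  then have Q0: "\<phi> Q \<noteq> 0" using \<phi>_\<psi>[of Q] \<psi>_inj[of Q] by auto
  define F where "F = range (\<lambda>i. Q * Var (State i, 1) - f i) \<union> range (\<lambda>j. Q * Var (Output j, 0) - g j)"
  define J where "J = generated_differential_ideal F"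
  have model: "model_ideal f g Q = saturation J Q" by (simp add: model_ideal_def J_def F_def)
  have FJ: "Q * Var (State i, 1) - f i \<in> J" "Q * Var (Output k, 0) - g k \<in> J" for i k
    using generated_differential_ideal(2)[of F] by (auto simp: J_def F_def)
  have "e (State i, Suc 0) = \<psi> (f i) / \<psi> Q" for i
  proof -
    have "e (State i, Suc 0) = t (j (State i, 0))" by (simp add: e_def b_def \<psi>_Var d_\<iota> hom_\<iota>)
    then show ?thesis by (simp add: t_def j)
  qed
  then have "\<phi> p = 0" if "p \<in> F" for p
    using that Q0 vars
    by (auto simp: F_def ringhomD[OF hom_\<phi>] \<phi>_Var \<phi>_\<psi> e_def b_def)
  moreover have "differential_ideal {p. \<phi> p = 0}"
    unfolding differential_ideal_def
  proof
    show "ideal_of UNIV {p. \<phi> p = 0}"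
      by (rule ideal_of_UNIV_I) (simp_all add: ringhomD[OF hom_\<phi>])
    have "d 0 = 0" using d_add[of 0 0] by (metis add.right_neutral add_left_cancel)
    then show "\<forall>p\<in>{p. \<phi> p = 0}. dderiv p \<in> {p. \<phi> p = 0}" by (simp add: \<phi>_der)
  qed
  ultimately have J_ker: "J \<subseteq> {p. \<phi> p = 0}" and ker_der: "\<And>p. \<phi> p = 0 \<Longrightarrow> \<phi> (dderiv p) = 0"
    unfolding J_def using generated_differential_ideal(3)[of "{p. \<phi> p = 0}" F]
    by (auto simp: differential_ideal_def)
  have "saturation J Q = {p. \<phi> p = 0}"
  proof (intro equalityI subsetI)
    fix p assume "p \<in> saturation J Q"
    then show "p \<in> {p. \<phi> p = 0}"
      using J_ker Q0 by (auto simp: saturation_def ringhomD[OF hom_\<phi>] dest!: subsetD[OF J_ker])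
  next
    fix p assume p: "p \<in> {p. \<phi> p = 0}"
    have "\<exists>l q. mvars q \<subseteq> W \<and> Q ^ l * p - q \<in> J"
    proof (rule normal_form_mod_differential_ideal)
      show "differential_ideal J" unfolding J_def by (rule generated_differential_ideal)
      show "mvars Q \<subseteq> W" by (rule vars)
      show "next_der v \<in> W \<or> (\<exists>q. mvars q \<subseteq> W \<and> Q * Var (next_der v) - q \<in> J)" if v: "v \<in> W" for v
      proof -
        consider i where "v = (State i, 0)" | i n where "v = (Input i, n)"
          using v by (auto simp: W_def)
        then show ?thesis
        proof cases
          case 1
          then show ?thesis using vars(1) FJ(1) by (metis One_nat_def next_der.simps)
        qed (simp add: W_def)
      qed
      show "(z, 0) \<in> W \<or> (\<exists>q. mvars q \<subseteq> W \<and> Q * Var (z, 0) - q \<in> J)" for z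
      proof (cases z)
        case (Output i)
        then show ?thesis using vars(2) FJ(2) by metis
      qed (simp_all add: W_def)
    qed
    then obtain l q where q: "mvars q \<subseteq> W" "Q ^ l * p - q \<in> J" by blast
    then have "\<phi> q = 0" using J_ker p by (auto simp: ringhomD[OF hom_\<phi>])
    then have "q = 0" using \<phi>_\<psi>[OF q(1)] \<psi>_inj by simp
    then show "p \<in> saturation J Q" using q by (auto simp: saturation_def)
  qed
  then show ?thesis using that[of \<phi>] hom_\<phi> ker_der by (simp add: model)
qed


section \<open>Rankings and reduction\<close>

lemma next_der_funpow: "(next_der ^^ i) v = (fst v, snd v + i)"
  by (induction i) (cases v; simp)+

lemma dpolys_UNIV: "p \<in> dpolys UNIV Z \<longleftrightarrow> mvars p \<subseteq> ders Z"
  by (simp add: dpolys_def polys_def)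

section \<open>Rankings as well-founded orders\<close>

locale finite_ranking =
  fixes Z :: "'s set" and R :: "('s \<times> nat) rel"
  assumes finite_Z: "finite Z" and ranking: "differential_ranking Z R"
begin

lemma R_trans: "(u, v) \<in> R \<Longrightarrow> (v, w) \<in> R \<Longrightarrow> (u, w) \<in> R"
  and R_irrefl: "(u, u) \<notin> R"
  using ranking
  unfolding differential_ranking_def strict_linear_order_on_def irrefl_def trans_def by blast+

lemma R_total: "u \<in> ders Z \<Longrightarrow> v \<in> ders Z \<Longrightarrow> u \<noteq> v \<Longrightarrow> (u, v) \<in> R \<or> (v, u) \<in> R"
  using ranking
  unfolding differential_ranking_def strict_linear_order_on_def total_on_def by blast

lemma R_asym: "(u, v) \<in> R \<Longrightarrow> (v, u) \<notin> R"
  using R_trans R_irrefl by blast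

lemma R_next: "v \<in> ders Z \<Longrightarrow> (v, next_der v) \<in> R"
  and R_next_mono: "v \<in> ders Z \<Longrightarrow> w \<in> ders Z \<Longrightarrow> (w, v) \<in> R \<Longrightarrow> (next_der w, next_der v) \<in> R"
  using ranking unfolding differential_ranking_def by blast+

lemma next_der_in_ders [simp]: "next_der v \<in> ders Z \<longleftrightarrow> v \<in> ders Z"
  by (cases v) (simp add: ders_def)

lemma funpow_next_in_ders [simp]: "(next_der ^^ i) v \<in> ders Z \<longleftrightarrow> v \<in> ders Z"
  by (induction i) simp_all

lemma R_funpow_next: "v \<in> ders Z \<Longrightarrow> 0 < i \<Longrightarrow> (v, (next_der ^^ i) v) \<in> R"
proof (induction i)
  case (Suc i)
  have "((next_der ^^ i) v, (next_der ^^ Suc i) v) \<in> R"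
    using R_next[of "(next_der ^^ i) v"] Suc by simp
  then show ?case using Suc R_trans by (cases "i = 0") (simp, blast)
qed simp

lemma finite_has_greatest:
  assumes "finite A" "A \<noteq> {}" "A \<subseteq> ders Z"
  shows "\<exists>m\<in>A. \<forall>w\<in>A. w \<noteq> m \<longrightarrow> (w, m) \<in> R"
  using assms
proof (induction A rule: finite_ne_induct)
  case (insert x A)
  then obtain m where m: "m \<in> A" "\<forall>w\<in>A. w \<noteq> m \<longrightarrow> (w, m) \<in> R" by auto
  have "x \<noteq> m" using insert m by auto
  then have "(x, m) \<in> R \<or> (m, x) \<in> R" using R_total[of x m] insert m by auto
  then show ?case
  proof
    assume "(x, m) \<in> R"
    then show ?thesis using m by (intro bexI[of _ m]) auto
  next
    assume "(m, x) \<in> R"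
    then have "\<forall>w\<in>insert x A. w \<noteq> x \<longrightarrow> (w, x) \<in> R" using m R_trans by (metis insert_iff)
    then show ?thesis by blast
  qed
qed simp

lemma finite_has_least:
  assumes "finite A" "A \<noteq> {}" "A \<subseteq> ders Z"
  shows "\<exists>m\<in>A. \<forall>w\<in>A. w \<noteq> m \<longrightarrow> (m, w) \<in> R"
  using assms
proof (induction A rule: finite_ne_induct)
  case (insert x A)
  then obtain m where m: "m \<in> A" "\<forall>w\<in>A. w \<noteq> m \<longrightarrow> (m, w) \<in> R" by auto
  have "x \<noteq> m" using insert m by auto
  then have "(x, m) \<in> R \<or> (m, x) \<in> R" using R_total[of x m] insert m by auto
  then show ?case
  proof
    assume "(m, x) \<in> R"
    then show ?thesis using m by (intro bexI[of _ m]) auto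
  next
    assume "(x, m) \<in> R"
    then have "\<forall>w\<in>insert x A. w \<noteq> x \<longrightarrow> (x, w) \<in> R" using m R_trans by (metis insert_iff)
    then show ?thesis by blast
  qed
qed simp

text \<open>With finitely many indeterminates, only the lowest derivative of each indeterminate
  can be minimal in a given set.\<close>

lemma wf_ranking: "wf (R \<inter> ders Z \<times> ders Z)"
  unfolding wf_eq_minimal
proof (intro allI impI)
  fix S and x :: "'s \<times> nat" assume "x \<in> S"
  show "\<exists>m\<in>S. \<forall>y. (y, m) \<in> R \<inter> ders Z \<times> ders Z \<longrightarrow> y \<notin> S"
  proof (cases "S \<inter> ders Z = {}")
    case True
    then show ?thesis using \<open>x \<in> S\<close> by auto
  next
    case False
    define low where "low = (\<lambda>z. (z, LEAST i. (z, i) \<in> S))"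
    define T where "T = low ` {z \<in> Z. \<exists>i. (z, i) \<in> S}"
    have TS: "T \<subseteq> S" unfolding T_def low_def by (auto intro: LeastI)
    have "finite T" "T \<noteq> {}" "T \<subseteq> ders Z"
      using finite_Z False by (auto simp: T_def low_def ders_def)
    then obtain m where m: "m \<in> T" "\<forall>w\<in>T. w \<noteq> m \<longrightarrow> (m, w) \<in> R"
      using finite_has_least by blast
    have "y \<notin> S" if y: "(y, m) \<in> R" "y \<in> ders Z" for y
    proof
      assume "y \<in> S"
      obtain z i where zi: "y = (z, i)" by (cases y)
      define i0 where "i0 = (LEAST i. (z, i) \<in> S)"
      have "i0 \<le> i" using \<open>y \<in> S\<close> zi by (auto simp: i0_def intro: Least_le)
      have t: "(z, i0) \<in> T" "(z, i0) \<in> ders Z"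
        using \<open>y \<in> S\<close> y zi by (auto simp: T_def low_def i0_def ders_def)
      have "y = (next_der ^^ (i - i0)) (z, i0)"
        using \<open>i0 \<le> i\<close> by (simp add: next_der_funpow zi)
      then have "y = (z, i0) \<or> ((z, i0), y) \<in> R"
        using R_funpow_next[OF t(2), of "i - i0"] by (cases "i - i0 = 0") auto
      then have "((z, i0), m) \<in> R" using y R_trans by blast
      then show False using m(2) t(1) R_irrefl R_asym by metis
    qed
    then show ?thesis using m TS by blast
  qed
qed

lemma lead_eqI:
  assumes "v \<in> mvars p" "\<And>w. w \<in> mvars p \<Longrightarrow> w \<noteq> v \<Longrightarrow> (w, v) \<in> R"
  shows "lead R p = v"
  unfolding lead_def
proof (rule the_equality)
  show "v \<in> mvars p \<and> (\<forall>w\<in>mvars p. w \<noteq> v \<longrightarrow> (w, v) \<in> R)" using assms by blast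
  show "u = v" if "u \<in> mvars p \<and> (\<forall>w\<in>mvars p. w \<noteq> u \<longrightarrow> (w, u) \<in> R)" for u
    using that assms(1) assms(2)[of u] R_asym[of u v] by metis
qed

lemma lead_greatest:
  assumes "mvars p \<subseteq> ders Z" "mvars p \<noteq> {}"
  shows "lead R p \<in> mvars p" "w \<in> mvars p \<Longrightarrow> w \<noteq> lead R p \<Longrightarrow> (w, lead R p) \<in> R"
proof -
  obtain v where v: "v \<in> mvars p" "\<forall>w\<in>mvars p. w \<noteq> v \<longrightarrow> (w, v) \<in> R"
    using finite_has_greatest[of "mvars p"] assms by auto
  then have "lead R p = v" by (intro lead_eqI) auto
  then show "lead R p \<in> mvars p" "w \<in> mvars p \<Longrightarrow> w \<noteq> lead R p \<Longrightarrow> (w, lead R p) \<in> R"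
    using v by auto
qed

lemma notin_mvars_if_above_lead:
  assumes "mvars p \<subseteq> ders Z" "(lead R p, w) \<in> R"
  shows "w \<notin> mvars p"
  using lead_greatest[OF assms(1)] assms(2) R_irrefl R_asym by blast

section \<open>Pseudo-reduction\<close>

text \<open>Pseudo-division at the leader of \<open>g\<close>. No variable above the leader occurs
  in \<open>g\<close> or its initial, so degrees there cannot grow and reductions already made at
  higher variables are not spoiled.\<close>

lemma reduction_step:
  fixes f g :: "('s, 'a::comm_ring_1) dpoly"
  assumes "mvars g \<subseteq> ders Z" "mvars g \<noteq> {}" "mvars f \<subseteq> ders Z"
    and "degree_in (lead R g) g \<le> degree_in (lead R g) f"
  obtains s where "mvars (initial R g * f - s * g) \<subseteq> ders Z"
    "degree_in (lead R g) (initial R g * f - s * g) < degree_in (lead R g) f"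
    "\<And>w. (lead R g, w) \<in> R \<Longrightarrow> degree_in w (initial R g * f - s * g) \<le> degree_in w f"
proof -
  let ?v = "lead R g"
  let ?n = "degree_in ?v f" and ?e = "degree_in ?v g"
  define s where "s = coeff_in ?v ?n f * Var ?v ^ (?n - ?e)"
  let ?r = "initial R g * f - s * g"
  have v: "?v \<in> mvars g" using lead_greatest assms by blast
  then have e: "?e > 0" using degree_in_0_iff[of ?v g] by simp
  have "degree_in ?v ?r < ?n \<or> ?v \<notin> mvars ?r"
    using coeff_in_pseudo_step(1)[of ?v f ?n g ?e] assms(4) by (simp add: s_def initial_def)
  then have 1: "degree_in ?v ?r < ?n" using e assms(4) degree_in_0_iff[of ?v ?r] by auto
  have vars: "mvars (initial R g) \<subseteq> mvars g" "mvars s \<subseteq> insert ?v (mvars f)"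
    using mvars_coeff_in[of ?v ?e g] mvars_coeff_in[of ?v ?n f]
      mvars_mult[of "coeff_in ?v ?n f" "Var ?v ^ (?n - ?e)"] mvars_power[of "Var ?v :: ('s, 'a) dpoly" "?n - ?e"]
    by (auto simp: initial_def s_def)
  have "mvars (initial R g) \<subseteq> ders Z" "mvars s \<subseteq> ders Z"
    using vars assms(1,3) v by blast+
  then have 2: "mvars ?r \<subseteq> ders Z"
    using assms(1,3) by (intro order.trans[OF mvars_diff] Un_least order.trans[OF mvars_mult]) auto
  have 3: "degree_in w ?r \<le> degree_in w f" if w: "(?v, w) \<in> R" for w
  proof -
    have "w \<notin> mvars g" using notin_mvars_if_above_lead[OF assms(1)] w by auto
    moreover have "w \<noteq> ?v" using w R_irrefl by metis
    ultimately have "degree_in w g = 0" "degree_in w (initial R g) = 0"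
      "degree_in w (Var ?v ^ (?n - ?e) :: ('s, 'a) dpoly) = 0"
      using vars mvars_power[of "Var ?v :: ('s, 'a) dpoly" "?n - ?e"] by (auto simp: degree_in_0_iff)
    then show ?thesis
      using degree_in_mult_le[of w "initial R g" f] degree_in_mult_le[of w s g]
        degree_in_mult_le[of w "coeff_in ?v ?n f" "Var ?v ^ (?n - ?e)"] degree_in_coeff_in[of w ?v ?n f]
      by (intro degree_in_diff_le) (auto simp: s_def)
  qed
  show ?thesis using that 1 2 3 by blast
qed

text \<open>The induction runs over a bound on the highest derivative at which the polynomial is
  not yet reduced, together with its degree there.\<close>

lemma pseudo_reduction:
  fixes G :: "('s, 'a::comm_ring_1) dpoly set"
  assumes G: "\<And>g. g \<in> G \<Longrightarrow> mvars g \<subseteq> ders Z \<and> mvars g \<noteq> {} \<and> initial R g \<in> M"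
    and M: "1 \<in> M" "\<And>a b. a \<in> M \<Longrightarrow> b \<in> M \<Longrightarrow> a * b \<in> M"
    and J: "ideal_of UNIV J" "G \<subseteq> J"
    and f: "mvars f \<subseteq> ders Z"
  shows "\<exists>h\<in>M. \<exists>r. mvars r \<subseteq> ders Z \<and> h * f - r \<in> J \<and>
           (\<forall>g\<in>G. degree_in (lead R g) r < degree_in (lead R g) g)"
proof -
  \<comment> \<open>The leaders of elements of \<open>G\<close> at which \<open>f\<close> is still
    too large.\<close>
  define bad where "bad f = {v. \<exists>g\<in>G. lead R g = v \<and> degree_in v g \<le> degree_in v f}"
    for f :: "('s, 'a) dpoly"
  have bad_vars: "bad f \<subseteq> mvars f" for f
  proof
    fix v assume "v \<in> bad f"
    then obtain g where g: "g \<in> G" "lead R g = v" "degree_in v g \<le> degree_in v f" by (auto simp: bad_def)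
    then have "v \<in> mvars g" using lead_greatest(1)[of g] G by auto
    then show "v \<in> mvars f" using g(3) degree_in_0_iff[of v g] degree_in_0_iff[of v f] by (metis le_zero_eq)
  qed
  let ?good = "\<lambda>f. \<exists>h\<in>M. \<exists>r. mvars r \<subseteq> ders Z \<and> h * f - r \<in> J \<and>
           (\<forall>g\<in>G. degree_in (lead R g) r < degree_in (lead R g) g)"
  have already: "?good f" if "bad f = {}" "mvars f \<subseteq> ders Z" for f
  proof (intro bexI[of _ 1] exI[of _ f] conjI ballI)
    show "1 * f - f \<in> J" using J ideal_ofD(1) by simp
    show "degree_in (lead R g) f < degree_in (lead R g) g" if "g \<in> G" for g
      using \<open>bad f = {}\<close> that unfolding bad_def not_le[symmetric] by blast
  qed (use M that in auto)
  have main: "?good f" if "mvars f \<subseteq> ders Z" "fst vd \<in> ders Z" "\<And>w. w \<in> bad f \<Longrightarrow> w = fst vd \<or> (w, fst vd) \<in> R"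
    "degree_in (fst vd) f \<le> snd vd" for f vd
    using that
  proof (induction vd arbitrary: f rule: wf_induct[OF wf_lex_prod[OF wf_ranking wf_less_than]])
    case (1 vd)
    obtain v d where vd: "vd = (v, d)" by (cases vd)
    note IH = 1(1)[rule_format]
    note f = 1(2) and v = 1(3)[unfolded vd fst_conv] and bnd = 1(4)[unfolded vd fst_conv]
      and deg = 1(5)[unfolded vd fst_conv snd_conv]
    show ?case
    proof (cases "bad f = {}")
      case True
      then show ?thesis using already f by blast
    next
      case False
      have "finite (bad f)" "bad f \<subseteq> ders Z" using bad_vars[of f] f finite_subset[OF bad_vars] by auto
      then obtain u where u: "u \<in> bad f" "\<forall>w\<in>bad f. w \<noteq> u \<longrightarrow> (w, u) \<in> R"
        using finite_has_greatest False by blast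
      have uZ: "u \<in> ders Z" using u bad_vars f by blast
      show ?thesis
      proof (cases "u = v")
        case False
        then have "(u, v) \<in> R" using bnd u by metis
        then have "((u, degree_in u f), vd) \<in> (R \<inter> ders Z \<times> ders Z) <*lex*> less_than"
          using uZ v by (simp add: vd)
        then show ?thesis using IH[of "(u, degree_in u f)" f] f uZ u by auto
      next
        case True
        then obtain g where g: "g \<in> G" "lead R g = v" "degree_in v g \<le> degree_in v f"
          using u by (auto simp: bad_def)
        obtain s where s: "mvars (initial R g * f - s * g) \<subseteq> ders Z"
          "degree_in v (initial R g * f - s * g) < degree_in v f"
          "\<And>w. (v, w) \<in> R \<Longrightarrow> degree_in w (initial R g * f - s * g) \<le> degree_in w f"
          using reduction_step[of g f] G[OF g(1)] f g(2,3) by metis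
        define f' where "f' = initial R g * f - s * g"
        \<comment> \<open>The step may create bad variables below \<open>v\<close>, which the
          lexicographic measure permits, but none above.\<close>
        have "w = v \<or> (w, v) \<in> R" if w: "w \<in> bad f'" for w
        proof (rule ccontr)
          assume "\<not> (w = v \<or> (w, v) \<in> R)"
          moreover have "w \<in> ders Z" using w bad_vars[of f'] s(1) by (auto simp: f'_def)
          ultimately have "(v, w) \<in> R" using R_total v by blast
          then have "w \<in> bad f" using w s(3)[of w] by (auto simp: bad_def f'_def)
          then show False using bnd \<open>\<not> (w = v \<or> (w, v) \<in> R)\<close> by blast
        qed
        moreover have "((v, degree_in v f'), vd) \<in> (R \<inter> ders Z \<times> ders Z) <*lex*> less_than"
          using s(2) deg by (simp add: vd f'_def)
        ultimately have "?good f'"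
          using IH[of "(v, degree_in v f')" f'] s(1) v by (simp add: f'_def)
        then obtain h r where h: "h \<in> M" "mvars r \<subseteq> ders Z" "h * f' - r \<in> J"
          "\<forall>g\<in>G. degree_in (lead R g) r < degree_in (lead R g) g" by blast
        have "h * initial R g * f - r = (h * f' - r) + (h * s) * g"
          by (simp add: f'_def algebra_simps)
        also have "\<dots> \<in> J" using h(3) g(1) J by (intro ideal_ofD(2,3)[OF J(1)]) auto
        finally have "h * initial R g * f - r \<in> J" .
        then show ?thesis using h M(2) G[OF g(1)] by blast
      qed
    qed
  qed
  show ?thesis
  proof (cases "bad f = {}")
    case True
    then show ?thesis using already f by blast
  next
    case False
    have "finite (bad f)" "bad f \<subseteq> ders Z" using bad_vars[of f] f finite_subset[OF bad_vars] by auto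
    then obtain u where u: "u \<in> bad f" "\<forall>w\<in>bad f. w \<noteq> u \<longrightarrow> (w, u) \<in> R"
      using finite_has_greatest False by blast
    then have "u \<in> ders Z" using bad_vars f by blast
    then show ?thesis using main[of f "(u, degree_in u f)"] u f by auto
  qed
qed

section \<open>Autoreduced and characteristic sets\<close>

text \<open>Supplies the increasing lists over which \<open>autoreduced_less\<close> quantifies, by
  repeatedly removing the element with the greatest leader.\<close>

lemma sorted_enumeration:
  assumes "finite A" "inj_on (lead R) A" "\<And>p. p \<in> A \<Longrightarrow> lead R p \<in> ders Z"
  obtains as where "set as = A" "sorted_wrt (rank_less R) as"
proof -
  have "\<exists>as. set as = A \<and> sorted_wrt (rank_less R) as"
    using assms
  proof (induction "card A" arbitrary: A)
    case (Suc n)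
    then have "A \<noteq> {}" by auto
    moreover have "lead R ` A \<subseteq> ders Z" using Suc.prems(3) by blast
    ultimately obtain m where m: "m \<in> lead R ` A" "\<forall>w\<in>lead R ` A. w \<noteq> m \<longrightarrow> (w, m) \<in> R"
      using finite_has_greatest[of "lead R ` A"] Suc.prems(1) by blast
    then obtain p where p: "p \<in> A" "lead R p = m" by blast
    have "n = card (A - {p})" using Suc.hyps(2) p Suc.prems by simp
    moreover have "inj_on (lead R) (A - {p})" using Suc.prems(2) by (rule inj_on_subset) auto
    ultimately obtain as where as: "set as = A - {p}" "sorted_wrt (rank_less R) as"
      using Suc.hyps(1)[of "A - {p}"] Suc.prems by auto
    have "rank_less R q p" if "q \<in> A - {p}" for q
    proof -
      have "lead R q \<noteq> m" using Suc.prems(2) p that by (auto simp: inj_on_def)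
      then show ?thesis using m(2) that p by (auto simp: rank_less_def rank_def)
    qed
    then have "set (as @ [p]) = A \<and> sorted_wrt (rank_less R) (as @ [p])"
      using as p by (auto simp: sorted_wrt_append)
    then show ?case by blast
  qed auto
  then show ?thesis using that by blast
qed

text \<open>Two leaders cannot be derivatives of the same indeterminate: the higher one would be a
  proper derivative of the lower one, or they would coincide and each degree would be less than the
  other. Hence there are at most as many elements as indeterminates.\<close>

lemma autoreduced_props:
  fixes C :: "('s, 'a::zero) dpoly set"
  assumes C: "autoreduced R C" "\<forall>p\<in>C. mvars p \<subseteq> ders Z"
  shows "p \<in> C \<Longrightarrow> mvars p \<noteq> {}" "inj_on (lead R) C" "finite C"
proof -
  show ne: "mvars p \<noteq> {}" if "p \<in> C" for p
    using C(1) that mvars_eq_empty_iff[of p] by (auto simp: autoreduced_def)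
  have red: "reduced R p q" if "p \<in> C" "q \<in> C" "p \<noteq> q" for p q
    using C(1) that by (auto simp: autoreduced_def)
  show inj: "inj_on (lead R) C"
  proof (rule inj_onI, rule ccontr)
    fix p q assume "p \<in> C" "q \<in> C" "lead R p = lead R q" "p \<noteq> q"
    then show False using red[of p q] red[of q p] by (auto simp: reduced_def)
  qed
  have inj2: "inj_on (\<lambda>p. fst (lead R p)) C"
  proof (rule inj_onI, rule ccontr)
    fix p q assume pq: "p \<in> C" "q \<in> C" "fst (lead R p) = fst (lead R q)" "p \<noteq> q"
    have False if "p \<in> C" "q \<in> C" "fst (lead R p) = fst (lead R q)" "p \<noteq> q"
      "snd (lead R p) < snd (lead R q)" for p q
    proof -
      have "lead R q = (next_der ^^ (snd (lead R q) - snd (lead R p))) (lead R p)"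
        using that by (simp add: next_der_funpow prod_eq_iff)
      moreover have "lead R q \<in> mvars q" using lead_greatest(1) ne C(2) that by blast
      moreover have "0 < snd (lead R q) - snd (lead R p)" using that by simp
      moreover have "reduced R q p" using red that by blast
      ultimately show False unfolding reduced_def by metis
    qed
    from this[of p q] this[of q p] pq have "snd (lead R p) = snd (lead R q)"
      by (metis linorder_neqE_nat)
    then show False using inj pq by (auto simp: inj_on_def prod_eq_iff)
  qed
  have "(\<lambda>p. fst (lead R p)) ` C \<subseteq> Z"
  proof safe
    fix p assume p: "p \<in> C"
    have "lead R p \<in> ders Z" using lead_greatest(1) ne C(2) p by blast
    then show "fst (lead R p) \<in> Z" by (auto simp: ders_def)
  qed
  then have "finite ((\<lambda>p. fst (lead R p)) ` C)" using finite_Z finite_subset by blast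
  then show "finite C" using inj2 by (rule finite_imageD)
qed

text \<open>A non-constant element of the ideal that is reduced with respect to \<open>C\<close> could replace
  the elements of \<open>C\<close> whose leaders are not below its own, giving a lower autoreduced set.\<close>

lemma reduced_wrt_characteristic_set:
  fixes C :: "('s, 'a::zero) dpoly set"
  assumes C: "characteristic_set R P C" "\<And>p. p \<in> P \<Longrightarrow> mvars p \<subseteq> ders Z"
    and r: "r \<in> P" "\<And>c. c \<in> C \<Longrightarrow> reduced R r c"
  shows "r \<in> range Const"
proof (rule ccontr)
  assume nonconst: "r \<notin> range Const"
  have auto: "autoreduced R C" and CP: "C \<subseteq> P"
    and minimal: "\<And>B. autoreduced R B \<Longrightarrow> B \<subseteq> P \<Longrightarrow> \<not> autoreduced_less R B C"
    using C(1) by (auto simp: characteristic_set_def)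
  have Cv: "\<forall>p\<in>C. mvars p \<subseteq> ders Z" using C(2) CP by auto
  note props = autoreduced_props[OF auto Cv]
  have lead_C: "lead R p \<in> mvars p" "lead R p \<in> ders Z" if "p \<in> C" for p
    using lead_greatest(1)[of p] props(1)[OF that] Cv that by blast+
  have rv: "mvars r \<subseteq> ders Z" "mvars r \<noteq> {}"
    using C(2) r(1) nonconst mvars_eq_empty_iff[of r] by auto
  have lead_r: "lead R r \<in> mvars r" "lead R r \<in> ders Z" using lead_greatest(1)[OF rv] rv by auto
  \<comment> \<open>The part of \<open>C\<close> that is kept. In the new set, \<open>r\<close>
    follows it in increasing rank.\<close>
  define L where "L = {c \<in> C. (lead R c, lead R r) \<in> R}"
  have below: "rank_less R c r" if "c \<in> L" for c
    using that by (auto simp: L_def rank_less_def rank_def)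
  \<comment> \<open>When the leaders agree, reducedness of \<open>r\<close> makes its degree
    smaller.\<close>
  have above: "rank_less R r c" if "c \<in> C - L" for c
  proof (cases "lead R c = lead R r")
    case True
    then show ?thesis using r(2)[of c] that by (auto simp: reduced_def rank_less_def rank_def)
  next
    case False
    then have "(lead R r, lead R c) \<in> R"
      using R_total[of "lead R c" "lead R r"] lead_C lead_r that by (auto simp: L_def)
    then show ?thesis by (simp add: rank_less_def rank_def)
  qed
  have rank_less_trans: "rank_less R a c" if "rank_less R a b" "rank_less R b c" for a b c :: "('s, 'a) dpoly"
    using that by (auto simp: rank_less_def rank_def intro: R_trans)
  have "inj_on (lead R) L" "inj_on (lead R) (C - L)"
    using props(2) by (auto simp: L_def elim: inj_on_subset)
  then obtain xs ys where xs: "set xs = L" "sorted_wrt (rank_less R) xs"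
    and ys: "set ys = C - L" "sorted_wrt (rank_less R) ys"
    using sorted_enumeration[of L] sorted_enumeration[of "C - L"] props(3) lead_C
    by (metis (no_types, lifting) DiffD1 L_def finite_Diff finite_subset mem_Collect_eq subsetI)
  have C_eq: "set (xs @ ys) = C" using xs ys by (auto simp: L_def)
  have C_sorted: "sorted_wrt (rank_less R) (xs @ ys)"
    unfolding sorted_wrt_append using xs ys below above rank_less_trans by blast
  have B_sorted: "sorted_wrt (rank_less R) (xs @ [r])"
    using xs below by (simp add: sorted_wrt_append)
  have "autoreduced R (set (xs @ [r]))"
    unfolding autoreduced_def
  proof (intro conjI ballI)
    show "set (xs @ [r]) \<inter> range Const = {}"
      using auto nonconst xs by (auto simp: autoreduced_def L_def)
    fix p q assume pq: "p \<in> set (xs @ [r])" "q \<in> set (xs @ [r]) - {p}"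
    consider "p \<in> L" "q \<in> L" "p \<noteq> q" | "p = r" "q \<in> L" | "p \<in> L" "q = r" using pq xs by auto
    then show "reduced R p q"
    proof cases
      case 1
      then show ?thesis using auto by (auto simp: autoreduced_def L_def)
    next
      case 2
      then show ?thesis using r(2) by (auto simp: L_def)
    next
      case 3
      then have p: "p \<in> C" "(lead R p, lead R r) \<in> R" by (auto simp: L_def)
      \<comment> \<open>The leader of \<open>r\<close> and all its derivatives lie above the leader
        of \<open>p\<close>, hence do not occur in \<open>p\<close>.\<close>
      have "(lead R p, (next_der ^^ i) (lead R r)) \<in> R" for i
        using R_funpow_next[OF lead_r(2), of i] p(2) R_trans by (cases "i = 0") auto
      then have "(next_der ^^ i) (lead R r) \<notin> mvars p" for i
        using notin_mvars_if_above_lead Cv p(1) by blast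
      from this this[of 0] have "degree_in (lead R r) p = 0" "\<And>i. (next_der ^^ i) (lead R r) \<notin> mvars p"
        by (simp_all add: degree_in_0_iff)
      moreover have "degree_in (lead R r) r > 0" using lead_r degree_in_0_iff[of "lead R r" r] by auto
      ultimately show ?thesis using 3 by (simp add: reduced_def)
    qed
  qed
  moreover have "set (xs @ [r]) \<subseteq> P" using xs CP r(1) by (auto simp: L_def)
  moreover have "autoreduced_less R (set (xs @ [r])) C"
    unfolding autoreduced_less_def
  proof (intro exI conjI)
    show "length (xs @ [r]) > length (xs @ ys) \<and>
          (\<forall>i<length (xs @ ys). rank R ((xs @ [r]) ! i) = rank R ((xs @ ys) ! i)) \<or>
        (\<exists>j. j < length (xs @ [r]) \<and> j < length (xs @ ys) \<and>
          rank_less R ((xs @ [r]) ! j) ((xs @ ys) ! j) \<and>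
          (\<forall>i<j. rank R ((xs @ [r]) ! i) = rank R ((xs @ ys) ! i)))"
    \<comment> \<open>Either nothing of \<open>C\<close> was dropped and the new list is longer, or
      \<open>r\<close> has smaller rank than the first dropped element.\<close>
    proof (cases ys)
      case Nil
      then show ?thesis by (simp add: nth_append)
    next
      case (Cons y ys')
      then have "rank_less R r y" using above ys by auto
      then show ?thesis using Cons
        by (intro disjI2 exI[of _ "length xs"]) (simp add: nth_append)
    qed
  qed (use C_eq C_sorted B_sorted in simp_all)
  ultimately show False using minimal by blast
qed

end


section \<open>Descent to a subfield\<close>

lemma lookup_Const_mult: "lookup (Const c * p) m = c * lookup p m" for p :: "('v, 'a::comm_ring_1) mpoly"
proof -
  have "Const c * p = Poly_Mapping.map ((*) c) p"
    by (simp add: Const_def mult_map_scale_conv_mult)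
  then show ?thesis by (simp add: Poly_Mapping.map.rep_eq when_def)
qed

lemma lookup_map_zero:
  assumes "h 0 = 0"
  shows "lookup (Poly_Mapping.map h p) m = h (lookup p m)"
  using assms by (simp add: Poly_Mapping.map.rep_eq when_def)

lemma mcoeffs_subset_iff: "0 \<in> k \<Longrightarrow> mcoeffs p \<subseteq> k \<longleftrightarrow> (\<forall>m. lookup p m \<in> k)"
  unfolding mcoeffs_def image_subset_iff Ball_def in_keys_iff by metis

lemma subfieldD:
  assumes "is_subfield k"
  shows "0 \<in> k" "1 \<in> k" "a \<in> k \<Longrightarrow> b \<in> k \<Longrightarrow> a + b \<in> k" "a \<in> k \<Longrightarrow> b \<in> k \<Longrightarrow> a - b \<in> k"
    "a \<in> k \<Longrightarrow> b \<in> k \<Longrightarrow> a * b \<in> k" "a \<in> k \<Longrightarrow> b \<in> k \<Longrightarrow> a / b \<in> k"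
  using assms by (auto simp: is_subfield_def)

lemma subfield_of_nat: "is_subfield k \<Longrightarrow> of_nat n \<in> k"
  by (induction n) (auto intro: subfieldD)

lemma subfield_sum: "is_subfield k \<Longrightarrow> (\<And>x. x \<in> A \<Longrightarrow> f x \<in> k) \<Longrightarrow> sum f A \<in> k"
  by (induction A rule: infinite_finite_induct) (auto intro: subfieldD)

lemma is_subfield_generated_subfield: "is_subfield (generated_subfield S)"
  by (auto simp: generated_subfield_def is_subfield_def)

lemma generated_subfield_superset: "S \<subseteq> generated_subfield S"
  by (auto simp: generated_subfield_def)

lemma generated_subfield_least: "is_subfield k \<Longrightarrow> S \<subseteq> k \<Longrightarrow> generated_subfield S \<subseteq> k"
  by (auto simp: generated_subfield_def)

section \<open>Linear projections onto a subfield\<close>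

text \<open>Linearity over \<open>k\<close> together with \<pi> 1 = 1 makes \<pi> the identity on
  \<open>k\<close>.\<close>

definition subfield_projection :: "'a::field set \<Rightarrow> ('a \<Rightarrow> 'a) \<Rightarrow> bool" where
  "subfield_projection k \<pi> \<longleftrightarrow> (\<forall>a b. \<pi> (a + b) = \<pi> a + \<pi> b) \<and>
     (\<forall>c\<in>k. \<forall>z. \<pi> (c * z) = c * \<pi> z) \<and> range \<pi> \<subseteq> k \<and> \<pi> 1 = 1"

text \<open>The kernel of the projection is a \<open>k\<close>-subspace maximal among those avoiding \<open>1\<close>.\<close>

lemma subfield_projection_exists:
  fixes k :: "'a::field set"
  assumes k: "is_subfield k"
  obtains \<pi> where "subfield_projection k \<pi>"
proof -
  note k' = subfieldD[OF k]
  define S where "S = {W. (0::'a) \<in> W \<and> (\<forall>a\<in>W. \<forall>b\<in>W. a + b \<in> W) \<and> (\<forall>c\<in>k. \<forall>a\<in>W. c * a \<in> W) \<and> 1 \<notin> W}"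
  have "\<exists>W\<in>S. \<forall>X\<in>S. W \<subseteq> X \<longrightarrow> X = W"
  proof (rule subset_Zorn_nonempty)
    show "S \<noteq> {}" by (auto simp: S_def intro!: exI[of _ "{0}"])
    fix \<C> assume \<C>: "\<C> \<noteq> {}" "subset.chain S \<C>"
    have "a + b \<in> \<Union>\<C>" if "a \<in> X" "X \<in> \<C>" "b \<in> Y" "Y \<in> \<C>" for a b X Y
    proof -
      have "X \<subseteq> Y \<or> Y \<subseteq> X" using \<C>(2) that by (auto simp: subset_chain_def)
      moreover have "X \<in> S" "Y \<in> S" using \<C>(2) that by (auto simp: subset_chain_def)
      ultimately show ?thesis using that unfolding S_def by blast
    qed
    moreover have "0 \<in> \<Union>\<C>" "1 \<notin> \<Union>\<C>" "\<And>c a. c \<in> k \<Longrightarrow> a \<in> \<Union>\<C> \<Longrightarrow> c * a \<in> \<Union>\<C>"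
      using \<C> unfolding S_def subset_chain_def by blast+
    ultimately show "\<Union>\<C> \<in> S" unfolding S_def by blast
  qed
  then obtain W where W: "W \<in> S" and max: "\<And>X. X \<in> S \<Longrightarrow> W \<subseteq> X \<Longrightarrow> X = W" by blast
  have W': "0 \<in> W" "\<And>a b. a \<in> W \<Longrightarrow> b \<in> W \<Longrightarrow> a + b \<in> W" "\<And>c a. c \<in> k \<Longrightarrow> a \<in> W \<Longrightarrow> c * a \<in> W" "1 \<notin> W"
    using W by (auto simp: S_def)
  have ex: "\<exists>c\<in>k. z - c \<in> W" for z
  proof (cases "z \<in> W")
    case True
    then show ?thesis using k'(1) by (intro bexI[of _ 0]) auto
  next
    case False
    \<comment> \<open>The subspace spanned by \<open>W\<close> and \<open>z\<close>. It is strictly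
      larger than \<open>W\<close>, so by maximality it contains 1; solving for \<open>z\<close>
      shows that \<open>z\<close> is congruent to \<open>1 / c\<close> modulo
      \<open>W\<close>.\<close>
    define X where "X = {w + c * z |w c. w \<in> W \<and> c \<in> k}"
    have "W \<subseteq> X" unfolding X_def using k'(1) by force
    moreover have "z \<in> X" unfolding X_def using k'(2) W'(1) by force
    ultimately have "X \<notin> S" using max False by blast
    moreover have "0 \<in> X" using \<open>W \<subseteq> X\<close> W'(1) by blast
    moreover have "a + b \<in> X" if ab: "a \<in> X" "b \<in> X" for a b
    proof -
      obtain w c w' c' where "a = w + c * z" "b = w' + c' * z" "w \<in> W" "c \<in> k" "w' \<in> W" "c' \<in> k"
        using ab unfolding X_def by blast
      moreover from this have "a + b = (w + w') + (c + c') * z" by (simp add: algebra_simps)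
      ultimately show ?thesis unfolding X_def using W'(2) k'(3) by blast
    qed
    moreover have "e * a \<in> X" if ea: "e \<in> k" "a \<in> X" for e a
    proof -
      obtain w c where "a = w + c * z" "w \<in> W" "c \<in> k" using ea unfolding X_def by blast
      moreover from this have "e * a = e * w + (e * c) * z" by (simp add: algebra_simps)
      ultimately show ?thesis unfolding X_def using W'(3) k'(5) ea by blast
    qed
    ultimately have "1 \<in> X" by (auto simp: S_def)
    then obtain w c where wc: "1 = w + c * z" "w \<in> W" "c \<in> k" unfolding X_def by blast
    then have "c \<noteq> 0" using W'(4) by auto
    have w: "w = 1 - c * z" using wc(1) by (simp add: algebra_simps)
    have "z - 1 / c = (0 - 1 / c) * w" unfolding w using \<open>c \<noteq> 0\<close> by (simp add: field_simps)
    moreover have c: "1 / c \<in> k" using k'(2) wc(3) by (rule k'(6))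
    moreover have "0 - 1 / c \<in> k" using k'(1) c by (rule k'(4))
    ultimately show ?thesis using W'(3) wc(2) by metis
  qed
  \<comment> \<open>A nonzero element of \<open>k\<close> in \<open>W\<close> could be scaled to 1,
    which \<open>W\<close> avoids.\<close>
  have uniq: "c = c'" if "c \<in> k" "c' \<in> k" "z - c \<in> W" "z - c' \<in> W" for c c' z
  proof (rule ccontr)
    assume "c \<noteq> c'"
    have "0 - 1 \<in> k" using k'(1,2) by (rule k'(4))
    then have "(0 - 1) * (z - c) \<in> W" using that W'(3) by blast
    then have "(z - c') + (0 - 1) * (z - c) \<in> W" using that W'(2) by blast
    moreover have "(z - c') + (0 - 1) * (z - c) = c - c'" by simp
    moreover have "1 / (c - c') \<in> k" using that by (intro k'(2,4,6))
    ultimately have "1 / (c - c') * (c - c') \<in> W" using W'(3) by metis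
    then show False using W'(4) \<open>c \<noteq> c'\<close> by simp
  qed
  define \<pi> where "\<pi> z = (SOME c. c \<in> k \<and> z - c \<in> W)" for z
  have \<pi>: "\<pi> z \<in> k" "z - \<pi> z \<in> W" for z
    using someI_ex[of "\<lambda>c. c \<in> k \<and> z - c \<in> W"] ex[of z] by (auto simp: \<pi>_def)
  have "\<pi> (a + b) = \<pi> a + \<pi> b" for a b
  proof (rule uniq)
    have "(a - \<pi> a) + (b - \<pi> b) \<in> W" by (intro W'(2) \<pi>)
    then show "a + b - (\<pi> a + \<pi> b) \<in> W" by (simp add: algebra_simps)
  qed (use \<pi> k' in auto)
  moreover have "\<pi> (c * z) = c * \<pi> z" if "c \<in> k" for c z
  proof (rule uniq)
    have "c * (z - \<pi> z) \<in> W" using that \<pi> W'(3) by blast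
    then show "c * z - c * \<pi> z \<in> W" by (simp add: algebra_simps)
  qed (use that \<pi> k' in auto)
  moreover have "\<pi> 1 = 1" by (rule uniq[of _ _ 1]) (use \<pi> k' W' in auto)
  moreover have "range \<pi> \<subseteq> k" using \<pi>(1) by blast
  ultimately show ?thesis using that[of \<pi>] unfolding subfield_projection_def by blast
qed

section \<open>Projection of polynomials by coefficients\<close>

context
  fixes k :: "'a::field set" and \<pi> :: "'a \<Rightarrow> 'a"
  assumes \<pi>: "subfield_projection k \<pi>"
begin

lemma proj_add: "\<pi> (a + b) = \<pi> a + \<pi> b"
  and proj_scale: "c \<in> k \<Longrightarrow> \<pi> (c * a) = c * \<pi> a"
  and proj_in: "\<pi> a \<in> k"
  and proj_1: "\<pi> 1 = 1"
  using \<pi> by (auto simp: subfield_projection_def)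

lemma proj_0: "\<pi> 0 = 0"
  using proj_add[of 0 0] by (metis add.right_neutral add_left_cancel)

lemmas lookup_map_proj = lookup_map_zero[of \<pi>, OF proj_0]

lemma keys_map_proj: "keys (Poly_Mapping.map \<pi> p) \<subseteq> keys p"
  by (auto simp: in_keys_iff lookup_map_proj proj_0)

lemma map_proj_add:
  "Poly_Mapping.map \<pi> (p + q) = Poly_Mapping.map \<pi> p + Poly_Mapping.map \<pi> q"
  by (rule poly_mapping_eqI) (simp add: lookup_map_proj lookup_add proj_add)

lemma map_proj_single: "Poly_Mapping.map \<pi> (single m c) = single m (\<pi> c)"
  by (rule poly_mapping_eqI) (simp add: lookup_map_proj lookup_single when_def proj_0)

lemma map_proj_zero: "Poly_Mapping.map \<pi> 0 = 0"
  by (rule poly_mapping_eqI) (simp add: lookup_map_proj proj_0)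

lemma coeff_in_map_proj:
  "coeff_in v d (Poly_Mapping.map \<pi> p) = Poly_Mapping.map \<pi> (coeff_in v d p)"
  by (rule poly_mapping_eqI) (simp add: lookup_map_proj lookup_coeff_in proj_0)

lemma map_proj_mult:
  assumes "mcoeffs h \<subseteq> k"
  shows "Poly_Mapping.map \<pi> (h * p) = h * Poly_Mapping.map \<pi> p"
proof -
  have 1: "Poly_Mapping.map \<pi> (single m c * p) = single m c * Poly_Mapping.map \<pi> p" if "c \<in> k" for m c
    by (induction p rule: poly_mapping_add_induct)
      (simp_all add: map_proj_zero map_proj_add map_proj_single distrib_left mult_single proj_scale that)
  have "Poly_Mapping.map \<pi> ((\<Sum>m\<in>M. single m (lookup h m)) * p) = (\<Sum>m\<in>M. single m (lookup h m)) * Poly_Mapping.map \<pi> p"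
    if "finite M" "M \<subseteq> keys h" for M
    using that
  proof (induction M rule: finite_induct)
    case (insert m M)
    then have "lookup h m \<in> k" using assms by (auto simp: mcoeffs_def)
    then show ?case using insert by (simp add: distrib_right map_proj_add 1)
  qed (simp add: map_proj_zero)
  from this[of "keys h"] show ?thesis by (simp flip: mpoly_eq_sum)
qed

text \<open>For a generator \<open>g\<close> with coefficients in \<open>k\<close>, the projection
  of \<open>a * g\<close> is the projection of \<open>a\<close> times \<open>g\<close>, again a
  multiple of \<open>g\<close>.\<close>

lemma map_proj_generated_ideal:
  fixes F :: "('s, 'a) dpoly set"
  assumes F: "\<And>g. g \<in> F \<Longrightarrow> mcoeffs g \<subseteq> k" "F \<subseteq> dpolys UNIV Z"
    and p: "p \<in> generated_ideal (dpolys UNIV Z) F"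
  shows "Poly_Mapping.map \<pi> p \<in> generated_ideal (dpolys UNIV Z) F"
proof -
  have dp_mult: "a * b \<in> dpolys UNIV Z" if "a \<in> dpolys UNIV Z" "b \<in> dpolys UNIV Z" for a b :: "('s, 'a) dpoly"
    using that mvars_mult[of a b] by (auto simp: dpolys_UNIV)
  let ?G = "generated_ideal (dpolys UNIV Z) F"
  \<comment> \<open>The projection is not multiplicative, so closure under multiplication is
    obtained by requiring the property for all multiples of \<open>p\<close> at once.\<close>
  let ?I = "{p \<in> dpolys UNIV Z. \<forall>a\<in>dpolys UNIV Z. Poly_Mapping.map \<pi> (a * p) \<in> ?G}"
  have G: "0 \<in> ?G" "a \<in> ?G \<Longrightarrow> b \<in> ?G \<Longrightarrow> a + b \<in> ?G" "r \<in> dpolys UNIV Z \<Longrightarrow> a \<in> ?G \<Longrightarrow> r * a \<in> ?G" "F \<subseteq> ?G" for a b r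
    by (auto simp: generated_ideal_def ideal_of_def)
  have "ideal_of (dpolys UNIV Z) ?I"
    unfolding ideal_of_def
  proof (intro conjI ballI)
    show "0 \<in> ?I" using G(1) by (simp add: map_proj_zero dpolys_UNIV)
    show "a + b \<in> ?I" if "a \<in> ?I" "b \<in> ?I" for a b
      using that G(2) mvars_add[of a b] by (auto simp: distrib_left map_proj_add dpolys_UNIV)
    show "r * a \<in> ?I" if "r \<in> dpolys UNIV Z" "a \<in> ?I" for r a
      using that dp_mult by (auto simp flip: mult.assoc)
  qed auto
  moreover have "F \<subseteq> ?I"
  proof
    fix g assume g: "g \<in> F"
    have "Poly_Mapping.map \<pi> (a * g) \<in> ?G" if a: "a \<in> dpolys UNIV Z" for a
    proof -
      have "Poly_Mapping.map \<pi> (a * g) = Poly_Mapping.map \<pi> a * g"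
        using map_proj_mult[OF F(1)[OF g], of a] by (simp only: mult.commute)
      moreover have "Poly_Mapping.map \<pi> a \<in> dpolys UNIV Z"
        using a mvars_mono[OF keys_map_proj, of a] by (auto simp: dpolys_UNIV)
      ultimately show ?thesis using G(3,4) g by auto
    qed
    then show "g \<in> ?I" using g F(2) by blast
  qed
  ultimately have "?G \<subseteq> ?I" by (auto simp: generated_ideal_def)
  then have "p \<in> ?I" using p by (rule subsetD)
  then have "\<forall>a\<in>dpolys UNIV Z. Poly_Mapping.map \<pi> (a * p) \<in> ?G" unfolding mem_Collect_eq by (rule conjunct2)
  moreover have "(1 :: ('s, 'a) dpoly) \<in> dpolys UNIV Z" by (simp add: dpolys_UNIV)
  ultimately have "Poly_Mapping.map \<pi> (1 * p) \<in> ?G" by (rule bspec)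
  then show ?thesis by simp
qed

end

section \<open>Coefficients of derivatives, initials and separants\<close>

lemma mcoeffs_dderiv:
  fixes p :: "('s, 'a::field) dpoly"
  assumes k: "is_subfield k" and p: "mcoeffs p \<subseteq> k"
  shows "mcoeffs (dderiv p) \<subseteq> k"
proof -
  have "lookup p m \<in> k" for m using p subfieldD(1)[OF k] by (simp add: mcoeffs_subset_iff)
  then have "of_nat i * lookup p m \<in> k" for i m
    using subfieldD(5)[OF k subfield_of_nat[OF k]] by blast
  then have "lookup (dderiv p) n \<in> k" for n
    unfolding dderiv_def lookup_sum lookup_single when_def
    using subfieldD(1)[OF k] by (intro subfield_sum[OF k]) simp
  then show ?thesis using subfieldD(1)[OF k] by (simp add: mcoeffs_subset_iff)
qed

lemma mcoeffs_funpow_dderiv: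
  fixes p :: "('s, 'a::field) dpoly"
  shows "is_subfield k \<Longrightarrow> mcoeffs p \<subseteq> k \<Longrightarrow> mcoeffs ((dderiv ^^ i) p) \<subseteq> k"
  by (induction i) (simp_all add: mcoeffs_dderiv)

lemma mcoeffs_pdv:
  fixes p :: "('v, 'a::field) mpoly"
  assumes "is_subfield k" "mcoeffs p \<subseteq> k"
  shows "mcoeffs (pdv v p) \<subseteq> k"
proof -
  have "lookup p m \<in> k" for m using assms subfieldD(1)[OF assms(1)] by (simp add: mcoeffs_subset_iff)
  then have "lookup (pdv v p) n \<in> k" for n
    unfolding lookup_pdv using subfieldD(5)[OF assms(1) subfield_of_nat[OF assms(1)]] by blast
  then show ?thesis using subfieldD(1)[OF assms(1)] by (simp add: mcoeffs_subset_iff)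
qed

lemma mcoeffs_coeff_in:
  fixes p :: "('v, 'a::field) mpoly"
  shows "is_subfield k \<Longrightarrow> mcoeffs p \<subseteq> k \<Longrightarrow> mcoeffs (coeff_in v d p) \<subseteq> k"
  using subfieldD(1)[of k] by (auto simp: mcoeffs_subset_iff lookup_coeff_in)

inductive_set mult_closure :: "'a::monoid_mult set \<Rightarrow> 'a set" for S where
  one: "1 \<in> mult_closure S"
| incl: "a \<in> S \<Longrightarrow> a \<in> mult_closure S"
| mult: "a \<in> mult_closure S \<Longrightarrow> b \<in> mult_closure S \<Longrightarrow> a * b \<in> mult_closure S"

section \<open>Prime differential ideals with a characteristic set\<close>

text \<open>Here \<open>I\<close> is an ideal of the full differential ring while \<open>C\<close>
  belongs to its part in the indeterminates \<open>Z\<close>. For a model these are the outputs and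
  inputs.\<close>

locale prime_characteristic_set = finite_ranking Z R
  for Z :: "'s set" and R :: "('s \<times> nat) rel" +
  fixes I :: "('s, 'a::field) dpoly set" and C :: "('s, 'a) dpoly set"
  assumes ideal_I: "ideal_of UNIV I" and dderiv_I: "p \<in> I \<Longrightarrow> dderiv p \<in> I"
    and proper_I: "1 \<notin> I" and prime_I: "p * q \<in> I \<Longrightarrow> p \<in> I \<or> q \<in> I"
    and char_set: "characteristic_set R (I \<inter> dpolys UNIV Z) C"
    and char_0: "inj (of_nat :: nat \<Rightarrow> 'a)"
begin

lemma C_props:
  assumes "c \<in> C"
  shows "c \<in> I" "mvars c \<subseteq> ders Z" "mvars c \<noteq> {}" "lead R c \<in> mvars c" "lead R c \<in> ders Z" "c \<noteq> 0"
proof -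
  have C: "autoreduced R C" "C \<subseteq> I \<inter> dpolys UNIV Z"
    using char_set by (auto simp: characteristic_set_def)
  then have Cv: "\<forall>c\<in>C. mvars c \<subseteq> ders Z" using dpolys_UNIV by blast
  show *: "c \<in> I" "mvars c \<subseteq> ders Z" using C(2) Cv assms by blast+
  show **: "mvars c \<noteq> {}" using autoreduced_props(1)[OF C(1) Cv assms] .
  then show "c \<noteq> 0" by auto
  show "lead R c \<in> mvars c" "lead R c \<in> ders Z" using lead_greatest(1)[OF *(2) **] *(2) by auto
qed

lemma C_autoreduced: "c \<in> C \<Longrightarrow> d \<in> C \<Longrightarrow> c \<noteq> d \<Longrightarrow> reduced R c d"
  using char_set by (auto simp: characteristic_set_def autoreduced_def)

lemma proper_derivative_notin:
  assumes "c \<in> C" "0 < i"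
  shows "(next_der ^^ i) (lead R c) \<notin> mvars c"
  using notin_mvars_if_above_lead R_funpow_next C_props assms by blast

text \<open>Minimality of \<open>C\<close> leaves only constants, and a nonzero constant would put 1
  into \<open>I\<close>.\<close>

lemma reduced_eq_0:
  assumes "r \<in> I" "mvars r \<subseteq> ders Z" "\<And>c. c \<in> C \<Longrightarrow> reduced R r c"
  shows "r = 0"
proof (rule ccontr)
  assume "r \<noteq> 0"
  have "r \<in> range Const"
    using reduced_wrt_characteristic_set[OF char_set] assms by (auto simp: dpolys_UNIV)
  then obtain a where a: "r = Const a" "a \<noteq> 0" using \<open>r \<noteq> 0\<close> by auto
  have "Const (1 / a) * r \<in> I" using ideal_I assms(1) by (rule ideal_ofD)
  then show False using proper_I a by (simp flip: Const_mult)
qed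

text \<open>The degree bounds let \<open>s\<close> inherit from \<open>c\<close> reducedness with
  respect to the rest of \<open>C\<close>, and the strict bound at the leader makes it reduced with
  respect to \<open>c\<close> as well. This applies to initials and separants.\<close>

lemma smaller_notin_I:
  assumes c: "c \<in> C" and s: "s \<noteq> 0" "\<And>w. degree_in w s \<le> degree_in w c"
    "degree_in (lead R c) s < degree_in (lead R c) c"
  shows "s \<notin> I"
proof
  assume "s \<in> I"
  have vars: "mvars s \<subseteq> mvars c"
    using s(2) by (metis degree_in_0_iff le_zero_eq subsetI)
  have "reduced R s d" if "d \<in> C" for d
  proof (cases "d = c")
    case True
    then show ?thesis using proper_derivative_notin[OF c] vars s(3) by (auto simp: reduced_def)
  next
    case False
    then have "reduced R c d" using c that C_autoreduced by blast
    then show ?thesis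
      using vars s(2)[of "lead R d"] unfolding reduced_def by (meson le_less_trans subsetD)
  qed
  then show False using reduced_eq_0[OF \<open>s \<in> I\<close>] vars C_props(2)[OF c] s(1) by auto
qed

text \<open>The partial derivative of \<open>c\<close> by its leader is the separant of
  \<open>c\<close>.\<close>

definition initials_separants :: "('s, 'a) dpoly set" where
  "initials_separants = (\<Union>c\<in>C. {initial R c, pdv (lead R c) c})"

lemma initials_separants_notin_I: "h \<in> mult_closure initials_separants \<Longrightarrow> h \<notin> I"
proof (induction rule: mult_closure.induct)
  case one
  show ?case by (rule proper_I)
next
  case (incl a)
  then obtain c where c: "c \<in> C" "a = initial R c \<or> a = pdv (lead R c) c"
    by (auto simp: initials_separants_def)
  note v = C_props(4)[OF c(1)]
  have pos: "0 < degree_in (lead R c) c" using v degree_in_0_iff[of "lead R c" c] by auto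
  from c(2) show ?case
  proof
    assume a: "a = initial R c"
    have "lead R c \<notin> mvars a" using mvars_coeff_in[of "lead R c"] by (auto simp: a initial_def)
    then have "degree_in (lead R c) a = 0" by (simp add: degree_in_0_iff)
    then show ?thesis
      using smaller_notin_I[OF c(1), of a] pos C_props(6)[OF c(1)]
      by (simp add: a initial_def degree_in_coeff_in coeff_in_degree_neq_0)
  next
    assume a: "a = pdv (lead R c) c"
    show ?thesis unfolding a
      by (rule smaller_notin_I[OF c(1)])
        (simp_all add: pdv_neq_0 char_0 v degree_in_pdv_le degree_in_pdv_less)
  qed
next
  case (mult a b)
  then show ?case using prime_I by blast
qed

text \<open>A proper derivative of \<open>c\<close> is linear in the corresponding derivative of the
  leader, with the separant as coefficient. Monotonicity of the ranking keeps the other variables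
  below, also under further differentiation.\<close>

lemma derivative_eq_separant:
  assumes c: "c \<in> C"
  shows "\<exists>t. (dderiv ^^ Suc i) c = pdv (lead R c) c * Var ((next_der ^^ Suc i) (lead R c)) + t \<and>
    mvars t \<subseteq> {w \<in> ders Z. (w, (next_der ^^ Suc i) (lead R c)) \<in> R}"
proof -
  let ?v = "lead R c" and ?s = "pdv (lead R c) c"
  note C' = C_props[OF c]
  have below_next: "w \<in> ders Z \<and> (w, next_der u) \<in> R"
    if "w \<in> ders Z" "w = u \<or> (w, u) \<in> R" "u \<in> ders Z" for u w
    using that R_next R_trans by metis
  have c_below: "w \<in> ders Z" "w = ?v \<or> (w, ?v) \<in> R" if "w \<in> mvars c" for w
    using that C' lead_greatest(2) by blast+
  show ?thesis
  proof (induction i)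
    case 0
    \<comment> \<open>The part of the derivative in which every variable except the leader is
      differentiated.\<close>
    let ?t = "der (\<lambda>x. x) (\<lambda>w. if w = ?v then 0 else Var (next_der w)) c :: ('s, 'a) dpoly"
    have "mvars ?t \<subseteq> {w \<in> ders Z. (w, next_der ?v) \<in> R}"
    proof
      fix w assume "w \<in> mvars ?t"
      then consider "w \<in> mvars c" | u where "u \<in> mvars c" "u \<noteq> ?v" "w = next_der u"
        using mvars_der[of "\<lambda>w. if w = ?v then 0 else Var (next_der w)" c] by (auto split: if_splits)
      then show "w \<in> {w \<in> ders Z. (w, next_der ?v) \<in> R}"
      proof cases
        case 1
        then show ?thesis using below_next c_below C'(5) by blast
      next
        case 2
        then show ?thesis using R_next_mono c_below[of u] C'(5) next_der_in_ders by blast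
      qed
    qed
    then show ?case using dderiv_split[of c ?v] by auto
  next
    case (Suc i)
    define u where "u = (next_der ^^ Suc i) ?v"
    obtain t where t: "(dderiv ^^ Suc i) c = ?s * Var u + t" "mvars t \<subseteq> {w \<in> ders Z. (w, u) \<in> R}"
      using Suc u_def by blast
    have u: "u \<in> ders Z" "(?v, u) \<in> R"
      unfolding u_def using C'(5) R_funpow_next[of ?v "Suc i"] funpow_next_in_ders[of "Suc i" ?v] by blast+
    define t' where "t' = dderiv ?s * Var u + dderiv t"
    have "(dderiv ^^ Suc (Suc i)) c = ?s * Var (next_der u) + t'"
      using arg_cong[OF t(1), of dderiv] by (simp add: dderiv_add dderiv_mult t'_def algebra_simps)
    moreover have "mvars t' \<subseteq> {w \<in> ders Z. (w, next_der u) \<in> R}"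
    proof
      fix w assume w: "w \<in> mvars t'"
      have der_below: "x \<in> {w \<in> ders Z. (w, next_der u) \<in> R}"
        if "x \<in> mvars (dderiv q)" "mvars q \<subseteq> {w \<in> ders Z. (w, u) \<in> R}" for x and q :: "('s, 'a) dpoly"
      proof -
        have "x \<in> mvars q \<or> (\<exists>y\<in>mvars q. x = next_der y)"
          using that(1) mvars_der[of "\<lambda>w. Var (next_der w)" q] by (auto simp: dderiv_eq_der)
        then show ?thesis
          using that(2) below_next u(1) R_next_mono next_der_in_ders by blast
      qed
      have s: "mvars ?s \<subseteq> {w \<in> ders Z. (w, u) \<in> R}"
      proof
        fix x assume "x \<in> mvars ?s"
        then have "x \<in> mvars c" by (rule subsetD[OF mvars_pdv])
        then show "x \<in> {w \<in> ders Z. (w, u) \<in> R}" using c_below u(2) R_trans by blast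
      qed
      have "w \<in> mvars (dderiv ?s) \<or> w = u \<or> w \<in> mvars (dderiv t)"
        using w mvars_add[of "dderiv ?s * Var u" "dderiv t"] mvars_mult[of "dderiv ?s" "Var u"]
        unfolding t'_def by auto
      then show "w \<in> {w \<in> ders Z. (w, next_der u) \<in> R}"
        using der_below s t(2) below_next u(1) by blast
    qed
    ultimately show ?case by (auto simp: u_def)
  qed
qed

text \<open>Consequently reduction by a proper derivative multiplies by a separant only, and being
  reduced at its leader means not containing that leader.\<close>

lemma lead_initial_derivative:
  assumes c: "c \<in> C" and i: "0 < i"
  defines "u \<equiv> (next_der ^^ i) (lead R c)" and "g \<equiv> (dderiv ^^ i) c"
  shows "mvars g \<subseteq> ders Z" "u \<in> mvars g" "lead R g = u" "degree_in u g = 1"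
    "initial R g = pdv (lead R c) c"
proof -
  let ?s = "pdv (lead R c) c"
  note C' = C_props[OF c]
  obtain j where j: "i = Suc j" using i by (cases i) auto
  obtain t where t: "g = ?s * Var u + t" "mvars t \<subseteq> {w \<in> ders Z. (w, u) \<in> R}"
    using derivative_eq_separant[OF c, of j] unfolding j u_def g_def by blast
  have u: "u \<in> ders Z" "(lead R c, u) \<in> R"
    unfolding u_def using C'(5) R_funpow_next[OF C'(5) i] funpow_next_in_ders[of i "lead R c"] by blast+
  have u_c: "u \<notin> mvars c" using notin_mvars_if_above_lead[OF C'(2)] u by blast
  then have u_s: "u \<notin> mvars ?s" using mvars_pdv[of "lead R c" c] by blast
  have u_t: "u \<notin> mvars t" using subsetD[OF t(2), of u] R_irrefl[of u] by blast
  have s0: "?s \<noteq> 0" using char_0 C'(4) by (rule pdv_neq_0)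
  have tp: "to_poly u g = [:t, ?s:]"
    unfolding t(1) by (simp add: to_poly_notin[OF u_s] to_poly_notin[OF u_t] to_poly_Var)
  show deg: "degree_in u g = 1" using s0 by (simp add: degree_in_eq tp)
  show "u \<in> mvars g" using deg degree_in_0_iff[of u g] by auto
  have below: "w = u \<or> w \<in> ders Z \<and> (w, u) \<in> R" if "w \<in> mvars g" for w
  proof -
    have "w \<in> mvars c \<or> w = u \<or> w \<in> mvars t"
      using that mvars_add[of "?s * Var u" t] mvars_mult[of ?s "Var u"] mvars_pdv[of "lead R c" c]
      unfolding t(1) by auto
    moreover have "w \<in> ders Z \<and> (w, u) \<in> R" if "w \<in> mvars c"
      using that C' lead_greatest(2)[OF C'(2,3) that] u(2) R_trans by blast
    ultimately show ?thesis using t(2) by blast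
  qed
  show "mvars g \<subseteq> ders Z" using below u(1) by blast
  show lead: "lead R g = u" using \<open>u \<in> mvars g\<close> below by (intro lead_eqI) blast+
  show "initial R g = ?s"
    unfolding initial_def lead deg by (simp add: tp flip: coeff_to_poly)
qed

text \<open>The case \<open>i = 0\<close> makes \<open>C\<close> itself part of this set.\<close>

definition derivatives :: "('s, 'a) dpoly set" where
  "derivatives = {(dderiv ^^ i) c |c i. c \<in> C}"

lemma derivatives_subset_I: "derivatives \<subseteq> I"
proof -
  have "(dderiv ^^ i) c \<in> I" if "c \<in> C" for c i
    by (induction i) (simp_all add: C_props(1)[OF that] dderiv_I)
  then show ?thesis by (auto simp: derivatives_def)
qed

text \<open>Pseudo-reduction by all derivatives of \<open>C\<close> leaves a remainder in
  \<open>I\<close> that is reduced with respect to \<open>C\<close>, hence zero.\<close>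

lemma ritt_reduction:
  assumes f: "f \<in> I" "mvars f \<subseteq> ders Z"
  obtains h where "h \<in> mult_closure initials_separants" "h * f \<in> generated_ideal UNIV derivatives"
proof -
  let ?J = "generated_ideal UNIV derivatives" and ?M = "mult_closure initials_separants"
  have JI: "?J \<subseteq> I" by (rule generated_ideal_UNIV(3)[OF ideal_I derivatives_subset_I])
  have G: "mvars g \<subseteq> ders Z \<and> mvars g \<noteq> {} \<and> initial R g \<in> ?M" if g: "g \<in> derivatives" for g
  proof -
    obtain c i where c: "c \<in> C" "g = (dderiv ^^ i) c" using g unfolding derivatives_def by blast
    have "initial R c \<in> ?M" "pdv (lead R c) c \<in> ?M"
      using c by (auto simp: initials_separants_def intro!: mult_closure.incl)
    then show ?thesis
      using C_props(2,3)[OF c(1)] lead_initial_derivative[OF c(1), of i] c(2)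
      by (cases "i = 0") auto
  qed
  obtain h r where h: "h \<in> ?M" and r: "mvars r \<subseteq> ders Z" "h * f - r \<in> ?J"
      "\<forall>g\<in>derivatives. degree_in (lead R g) r < degree_in (lead R g) g"
    using pseudo_reduction[OF G mult_closure.one mult_closure.mult generated_ideal_UNIV(1,2) f(2)] by blast
  have "h * f \<in> I" using ideal_I f(1) by (rule ideal_ofD(3))
  moreover have "h * f - r \<in> I" using r(2) JI by blast
  ultimately have "h * f - (h * f - r) \<in> I" by (rule ideal_ofD(5)[OF ideal_I])
  then have "r \<in> I" by simp
  moreover have "reduced R r c" if c: "c \<in> C" for c
    unfolding reduced_def
  proof (intro conjI allI impI)
    have "(dderiv ^^ 0) c \<in> derivatives" using c unfolding derivatives_def by blast
    then show "degree_in (lead R c) r < degree_in (lead R c) c" using r(3) by auto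
    fix i :: nat assume i: "0 < i"
    have "(dderiv ^^ i) c \<in> derivatives" using c unfolding derivatives_def by blast
    \<comment> \<open>A proper derivative has degree 1 in its leader, so this bound says that the
      leader is absent from \<open>r\<close>.\<close>
    then have "degree_in ((next_der ^^ i) (lead R c)) r < 1"
      using r(3) lead_initial_derivative(3,4)[OF c i] by metis
    then show "(next_der ^^ i) (lead R c) \<notin> mvars r" by (simp add: degree_in_0_iff)
  qed
  ultimately have "r = 0" using reduced_eq_0 r(1) by blast
  then show ?thesis using that h r(2) by simp
qed

section \<open>Coefficient fields and fields of definition\<close>

theorem generated_over_coefficient_field:
  assumes k: "is_subfield k" and coeffs: "\<And>c. c \<in> C \<Longrightarrow> mcoeffs c \<subseteq> k"
  shows "I \<inter> dpolys UNIV Z = generated_ideal (dpolys UNIV Z) (I \<inter> dpolys k Z)"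
proof
  let ?D = "dpolys UNIV Z :: ('s, 'a) dpoly set"
  let ?G = "generated_ideal ?D (I \<inter> dpolys k Z)"
  have "ideal_of ?D (I \<inter> ?D)"
    unfolding ideal_of_def
  proof (intro conjI ballI)
    show "0 \<in> I \<inter> ?D" using ideal_ofD(1)[OF ideal_I] by (simp add: dpolys_UNIV)
    show "a + b \<in> I \<inter> ?D" if "a \<in> I \<inter> ?D" "b \<in> I \<inter> ?D" for a b
      using that mvars_add[of a b] ideal_ofD(2)[OF ideal_I, of a b] unfolding Int_iff dpolys_UNIV by blast
    show "r * a \<in> I \<inter> ?D" if "r \<in> ?D" "a \<in> I \<inter> ?D" for r a
      using that mvars_mult[of r a] ideal_ofD(3)[OF ideal_I, of a r] unfolding Int_iff dpolys_UNIV by blast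
  qed simp
  moreover have "I \<inter> dpolys k Z \<subseteq> I \<inter> ?D" by (auto simp: dpolys_def polys_def)
  ultimately show "?G \<subseteq> I \<inter> ?D" by (auto simp: generated_ideal_def)
  have G: "0 \<in> ?G" "a \<in> ?G \<Longrightarrow> b \<in> ?G \<Longrightarrow> a + b \<in> ?G" "r \<in> ?D \<Longrightarrow> a \<in> ?G \<Longrightarrow> r * a \<in> ?G"
    "I \<inter> dpolys k Z \<subseteq> ?G" for a b r
    by (auto simp: generated_ideal_def ideal_of_def)
  obtain \<pi> where \<pi>: "subfield_projection k \<pi>" using subfield_projection_exists[OF k] .
  have der_k: "mcoeffs g \<subseteq> k" if g: "g \<in> derivatives" for g
  proof -
    obtain c i where "c \<in> C" "g = (dderiv ^^ i) c" using g unfolding derivatives_def by blast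
    then show ?thesis using mcoeffs_funpow_dderiv[OF k coeffs] by simp
  qed
  \<comment> \<open>Commuting with the projection passes to products, so it is enough to know it for
    initials and separants, whose coefficients lie in \<open>k\<close>.\<close>
  have M_comm: "Poly_Mapping.map \<pi> (h * p) = h * Poly_Mapping.map \<pi> p"
    if "h \<in> mult_closure initials_separants" for h p
    using that
  proof (induction arbitrary: p rule: mult_closure.induct)
    case (incl h)
    then obtain c where c: "c \<in> C" "h = initial R c \<or> h = pdv (lead R c) c"
      by (auto simp: initials_separants_def)
    then have "mcoeffs h \<subseteq> k"
      using mcoeffs_pdv[OF k coeffs[OF c(1)]] mcoeffs_coeff_in[OF k coeffs[OF c(1)]]
      unfolding initial_def by metis
    then show ?case by (rule map_proj_mult[OF \<pi>])
  qed (simp_all add: mult.assoc)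
  have proj_I: "Poly_Mapping.map \<pi> f \<in> I" if f: "f \<in> I" "mvars f \<subseteq> ders Z" for f
  proof -
    obtain h where h: "h \<in> mult_closure initials_separants" "h * f \<in> generated_ideal UNIV derivatives"
      using ritt_reduction[OF f] .
    have UNIV_eq: "dpolys UNIV (UNIV :: 's set) = (UNIV :: ('s, 'a) dpoly set)"
      by (auto simp: dpolys_UNIV ders_def)
    have "Poly_Mapping.map \<pi> (h * f) \<in> generated_ideal UNIV derivatives"
      using map_proj_generated_ideal[OF \<pi>, of derivatives UNIV "h * f"] der_k h(2) by (simp add: UNIV_eq)
    also have "generated_ideal UNIV derivatives \<subseteq> I"
      by (rule generated_ideal_UNIV(3)[OF ideal_I derivatives_subset_I])
    finally have "h * Poly_Mapping.map \<pi> f \<in> I" by (simp add: M_comm[OF h(1)])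
    then show ?thesis using prime_I initials_separants_notin_I[OF h(1)] by blast
  qed
  have "f \<in> ?G" if "f \<in> I" "mvars f \<subseteq> ders Z" for f
    using that
  proof (induction "card (keys f)" arbitrary: f rule: less_induct)
    case less
    show ?case
    proof (cases "f = 0")
      case True
      then show ?thesis using G(1) by simp
    next
      case False
      then obtain m where m: "lookup f m \<noteq> 0"
        by (metis lookup_zero poly_mapping_eqI)
      define a where "a = lookup f m"
      \<comment> \<open>Division by \<open>a\<close> makes the coefficient at \<open>m\<close> equal
        to 1, which the projection fixes. Subtracting \<open>a\<close> times \<open>f1\<close> then
        removes the monomial \<open>m\<close> and introduces no new one.\<close>
      define f1 where "f1 = Poly_Mapping.map \<pi> (Const (1 / a) * f)"
      define f2 where "f2 = f - Const a * f1"
      have lookup_f1: "lookup f1 n = \<pi> (1 / a * lookup f n)" for n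
        by (simp add: f1_def lookup_map_proj[OF \<pi>] lookup_Const_mult)
      have keys_f1: "keys f1 \<subseteq> keys f"
        by (auto simp: in_keys_iff lookup_f1 proj_0[OF \<pi>])
      have "Const (1 / a) * f \<in> I" using ideal_I less.prems(1) by (rule ideal_ofD(3))
      moreover have "mvars (Const (1 / a) * f) \<subseteq> ders Z"
        using mvars_mult[of "Const (1 / a)" f] less.prems(2) by (simp add: subset_trans)
      ultimately have f1_I: "f1 \<in> I" unfolding f1_def by (rule proj_I)
      have f1_Z: "mvars f1 \<subseteq> ders Z" using mvars_mono[OF keys_f1] less.prems(2) by blast
      have "mcoeffs f1 \<subseteq> k"
        using proj_in[OF \<pi>] subfieldD(1)[OF k] by (simp add: mcoeffs_subset_iff lookup_f1)
      then have "f1 \<in> ?G" using G(4) f1_I f1_Z by (auto simp: dpolys_def polys_def)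
      then have 1: "Const a * f1 \<in> ?G" by (intro G(3)) (simp_all add: dpolys_UNIV)
      have "f2 \<in> I" unfolding f2_def
        using less.prems(1) f1_I by (intro ideal_ofD(5)[OF ideal_I] ideal_ofD(3)[OF ideal_I])
      moreover have keys_f2: "keys f2 \<subseteq> keys f - {m}"
      proof
        fix n assume n: "n \<in> keys f2"
        have "lookup f2 n = lookup f n - a * lookup f1 n"
          by (simp add: f2_def lookup_minus lookup_Const_mult)
        moreover have "lookup f1 n = 0" if "n \<notin> keys f" using that keys_f1 by (auto simp: in_keys_iff)
        moreover have "lookup f1 m = 1" using m by (simp add: lookup_f1 a_def proj_1[OF \<pi>])
        ultimately show "n \<in> keys f - {m}" using n by (auto simp: in_keys_iff a_def)
      qed
      moreover have "card (keys f2) < card (keys f)"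
      proof (rule psubset_card_mono)
        have "m \<in> keys f" using m by (simp add: in_keys_iff)
        then show "keys f2 \<subset> keys f" using keys_f2 by blast
      qed simp
      moreover have "mvars f2 \<subseteq> ders Z"
        using mvars_mono[of f2 f] keys_f2 less.prems(2) by blast
      ultimately have "f2 \<in> ?G" using less.hyps by blast
      then have "f2 + Const a * f1 \<in> ?G" using 1 by (rule G(2))
      then show ?thesis by (simp add: f2_def)
    qed
  qed
  then show "I \<inter> ?D \<subseteq> ?G" unfolding dpolys_UNIV[symmetric] by blast
qed

text \<open>Compares \<open>c\<close> with its projection, which the hypothesis on \<open>k\<close>
  places in \<open>I\<close>: minimality of \<open>C\<close> shows the two to be proportional over
  the polynomials in the non-leading variables, and the absence of factors improves this to a
  constant.\<close>

theorem coefficients_in_field_of_definition: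
  assumes pres: "characteristic_presentation R (I \<inter> dpolys UNIV Z) C" and monic: "monic_set C"
    and k: "is_subfield k"
    and gen: "I \<inter> dpolys UNIV Z = generated_ideal (dpolys UNIV Z) (I \<inter> dpolys k Z)"
    and c: "c \<in> C"
  shows "mcoeffs c \<subseteq> k"
proof -
  obtain \<pi> where \<pi>: "subfield_projection k \<pi>" using subfield_projection_exists[OF k] .
  note C' = C_props[OF c]
  let ?v = "lead R c" and ?N = "nonleading_vars R C"
  let ?d = "degree_in ?v c"
  define g where "g = Poly_Mapping.map \<pi> c"
  define a where "a = initial R c"
  define b where "b = coeff_in ?v ?d g"
  \<comment> \<open>The cross product cancels the coefficients of \<open>?v ^ ?d\<close> in
    \<open>c\<close> and \<open>g\<close>.\<close>
  define r where "r = a * g - b * c"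
  have keys_g: "keys g \<subseteq> keys c" unfolding g_def by (rule keys_map_proj[OF \<pi>])
  have "b = Poly_Mapping.map \<pi> a"
    by (simp add: b_def a_def g_def initial_def coeff_in_map_proj[OF \<pi>])
  then have keys_b: "keys b \<subseteq> keys a" using keys_map_proj[OF \<pi>] by simp
  have a_N: "mvars a \<subseteq> ?N"
    using pres c unfolding characteristic_presentation_def polys_def a_def by blast
  \<comment> \<open>Projecting creates no monomials, so \<open>b\<close> inherits from the initial
    \<open>a\<close> the restriction to non-leading variables.\<close>
  then have b_N: "mvars b \<subseteq> ?N" using mvars_mono[OF keys_b] by blast
  have no_factor: "q \<in> range Const" if "mvars q \<subseteq> ?N" "q dvd c" for q
    using pres c that unfolding characteristic_presentation_def polys_def by blast
  have lead_notin: "lead R d \<notin> mvars a" "lead R d \<notin> mvars b" if "d \<in> C" for d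
    using a_N b_N that by (auto simp: nonleading_vars_def)
  have a_c: "mvars a \<subseteq> mvars c"
    using mvars_coeff_in[of ?v ?d c] by (auto simp: a_def initial_def)
  have "c \<in> generated_ideal (dpolys UNIV Z) (I \<inter> dpolys k Z)"
    using C'(1,2) by (simp add: dpolys_UNIV flip: gen)
  then have "g \<in> generated_ideal (dpolys UNIV Z) (I \<inter> dpolys k Z)"
    unfolding g_def
    by (rule map_proj_generated_ideal[OF \<pi>, rotated 2]) (auto simp: dpolys_def polys_def)
  then have g_I: "g \<in> I" by (simp flip: gen)
  have r_I: "r \<in> I"
    unfolding r_def using g_I C'(1) by (intro ideal_ofD(5)[OF ideal_I] ideal_ofD(3)[OF ideal_I])
  have r_c: "mvars r \<subseteq> mvars c"
    unfolding r_def
    using a_c mvars_mono[OF keys_b] mvars_mono[OF keys_g]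
    by (intro order.trans[OF mvars_diff] Un_least order.trans[OF mvars_mult]) auto
  have deg_r: "degree_in w r \<le> degree_in w c" if "w \<notin> mvars a" "w \<notin> mvars b" for w
  proof -
    have "degree_in w a = 0" "degree_in w b = 0" using that by (simp_all add: degree_in_0_iff)
    then show ?thesis
      unfolding r_def
      using degree_in_mult_le[of w a g] degree_in_mult_le[of w b c] degree_in_mono[OF keys_g, of w]
      by (intro degree_in_diff_le) auto
  qed
  have pos: "0 < ?d" using C'(4) degree_in_0_iff[of ?v c] by auto
  have deg_lead: "degree_in ?v r < ?d"
  proof (cases "degree_in ?v g = ?d")
    case True
    have "r = coeff_in ?v ?d c * g - coeff_in ?v ?d g * Var ?v ^ (?d - ?d) * c"
      by (simp add: r_def a_def b_def initial_def)
    then have "degree_in ?v r < ?d \<or> ?v \<notin> mvars r"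
      using coeff_in_pseudo_step(1)[OF True refl order.refl] by simp
    then show ?thesis using pos degree_in_0_iff[of ?v r] by auto
  next
    \<comment> \<open>The projection has killed the whole initial, so \<open>b\<close> is zero and
      \<open>r\<close> is just \<open>a * g\<close>.\<close>
    case False
    then have less: "degree_in ?v g < ?d" using degree_in_mono[OF keys_g, of ?v] by simp
    then have "b = 0" by (simp add: b_def degree_in_eq coeff_eq_0 flip: coeff_to_poly)
    moreover have "degree_in ?v a = 0" using lead_notin(1)[OF c] by (simp add: degree_in_0_iff)
    ultimately show ?thesis using degree_in_mult_le[of ?v a g] less by (simp add: r_def)
  qed
  have "reduced R r d" if d: "d \<in> C" for d
  proof (cases "d = c")
    case True
    then show ?thesis using deg_lead proper_derivative_notin[OF c] r_c by (auto simp: reduced_def)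
  next
    case False
    \<comment> \<open>The leader of \<open>d\<close> occurs neither in \<open>a\<close> nor in
      \<open>b\<close>, so multiplying by them does not raise the degree in it and \<open>r\<close>
      inherits reducedness from \<open>c\<close>.\<close>
    then have "reduced R c d" using C_autoreduced c d by blast
    then show ?thesis
      using r_c deg_r[of "lead R d"] lead_notin[OF d] unfolding reduced_def by (meson le_less_trans subsetD)
  qed
  then have "r = 0" using reduced_eq_0[OF r_I] r_c C'(2) by blast
  then have "a * g = b * c" by (simp add: r_def)
  moreover have "a \<noteq> 0" using coeff_in_degree_neq_0[OF C'(6)] by (simp add: a_def initial_def)
  ultimately obtain e where e: "g = Const e * c"
    using proportional_if_no_factor[OF _ _ a_N C'(6) keys_g no_factor] by blast
  \<comment> \<open>The projection fixes the coefficient 1, which forces the proportionality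
    constant to be 1.\<close>
  obtain m where m: "lookup c m = 1"
    using monic c by (auto simp: monic_set_def monic_mpoly_def mcoeffs_def)
  have "lookup g m = 1" by (simp add: g_def lookup_map_proj[OF \<pi>] m proj_1[OF \<pi>])
  then have "e = 1" using m by (simp add: e lookup_Const_mult)
  then have "lookup c n = \<pi> (lookup c n)" for n
    using lookup_map_proj[OF \<pi>, of c n] e by (simp add: g_def)
  then have "lookup c n \<in> k" for n using proj_in[OF \<pi>] by metis
  then show ?thesis using subfieldD(1)[OF k] by (simp add: mcoeffs_subset_iff)
qed

end


section \<open>Application to the ideal of a model\<close>

lemma inj_of_nat_ratfun: "inj (of_nat :: nat \<Rightarrow> 'l::linorder ratfun)"
proof (rule injI)
  fix m n :: nat
  assume "(of_nat m :: 'l ratfun) = of_nat n"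
  moreover have "of_nat k = to_fract (of_nat k :: ('l, complex) mpoly)" for k
    by (induction k) simp_all
  ultimately have "to_fract (of_nat m :: ('l, complex) mpoly) = to_fract (of_nat n)" by metis
  then show "m = n" unfolding to_fract_eq_iff of_nat_eq_iff .
qed

theorem corollary5p7:
  fixes f :: "'n::finite \<Rightarrow> ('l::{finite,linorder}, 'n, 'm::finite, 'k::finite) ode_dpoly"
    and g :: "'m \<Rightarrow> ('l, 'n, 'm, 'k) ode_dpoly"
    and Q :: "('l, 'n, 'm, 'k) ode_dpoly"
    and R :: "(('n, 'm, 'k) indet \<times> nat) rel"
    and C :: "('l, 'n, 'm, 'k) ode_dpoly set"
  assumes "ode_model f g Q"
    and "differential_ranking io_indets R"
    and "characteristic_presentation R (io_ideal f g Q) C"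
    and "monic_set C"
  shows "is_io_identifiable_field f g Q
           (generated_subfield (complex_numbers \<union> (\<Union>p\<in>C. mcoeffs p)))"
proof -
  let ?I = "model_ideal f g Q" and ?Z = "io_indets :: ('n, 'm, 'k) indet set"
  obtain \<phi> :: "('l, 'n, 'm, 'k) ode_dpoly \<Rightarrow> (nat, 'l ratfun) mpoly fract"
    where \<phi>: "ringhom \<phi>" and I: "?I = {p. \<phi> p = 0}" and der: "\<And>p. \<phi> p = 0 \<Longrightarrow> \<phi> (dderiv p) = 0"
    using model_ideal_eq_kernel[OF assms(1)] by metis
  \<comment> \<open>As the kernel of a homomorphism into a field, the model ideal is proper and
    prime.\<close>
  interpret prime_characteristic_set ?Z R ?I C
  proof
    show "finite ?Z" by (simp add: io_indets_def)
    show "differential_ranking ?Z R" by (rule assms(2))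
    show "ideal_of UNIV ?I"
      unfolding I by (rule ideal_of_UNIV_I) (simp_all add: ringhomD[OF \<phi>])
    show "p \<in> ?I \<Longrightarrow> dderiv p \<in> ?I" for p unfolding I by (simp add: der)
    show "1 \<notin> ?I" by (simp add: I ringhomD[OF \<phi>])
    show "p * q \<in> ?I \<Longrightarrow> p \<in> ?I \<or> q \<in> ?I" for p q by (simp add: I ringhomD[OF \<phi>])
    show "characteristic_set R (?I \<inter> dpolys UNIV ?Z) C"
      using assms(3) by (simp add: characteristic_presentation_def io_ideal_def)
  qed (rule inj_of_nat_ratfun)
  let ?S = "complex_numbers \<union> (\<Union>p\<in>C. mcoeffs p)"
  let ?k = "generated_subfield ?S"
  have S: "?S \<subseteq> ?k" by (rule generated_subfield_superset)
  show ?thesis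
    unfolding is_io_identifiable_field_def
  proof (intro conjI allI impI)
    show "defines_io_ideal f g Q ?k"
      unfolding defines_io_ideal_def io_ideal_def
    proof (intro conjI generated_over_coefficient_field is_subfield_generated_subfield)
      show "complex_numbers \<subseteq> ?k" using S by blast
      show "mcoeffs c \<subseteq> ?k" if "c \<in> C" for c using S that by blast
    qed
    fix k' assume k': "defines_io_ideal f g Q k'"
    then have "mcoeffs c \<subseteq> k'" if "c \<in> C" for c
      using that assms(3,4) unfolding defines_io_ideal_def io_ideal_def
      by (intro coefficients_in_field_of_definition) auto
    then show "?k \<subseteq> k'"
      using k' unfolding defines_io_ideal_def by (intro generated_subfield_least) auto
  qed
qed

end
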